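(* For all integers $q_1 > q_2 \geq 3$, there exists $c>0$ such that for $p = p(n) \le c \cdot n^{-\frac{q_2}{q_1(q_2-1)}}$, the hypergraph $H(n,q_1,q_2,p)$ is asymmetrically-2-colorable asymptotically almost surely (i.e. with probability tending to $1$ as $n \to \infty$).
   Context: $[n]=\{1,\dotsc,n\}$; $[n]_p$ is the random subset of $[n]$ containing each element independently with probability $p$. $H(n,q_1,q_2)$ is the hypergraph with vertex set $[n]$ whose edges are all arithmetic progressions (nonzero common difference) in $[n]$ of length $q_1$ ("long edges") and of length $q_2$ ("short edges"). $H(n,q_1,q_2,p)$ is the subhypergraph of $H(n,q_1,q_2)$ induced by $[n]_p$. A hypergraph whose edges have sizes $q_1$ (long) or $q_2$ (short) is asymmetrically-2-colorable if its vertices can be colored red/blue so that no long edge is entirely red and no short edge is entirely blue. *)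

theory Defs
  imports "HOL-Probability.Probability"
begin

type_synonym 'a hypergraph = "'a set \<times> 'a set set"

definition verts :: "'a hypergraph \<Rightarrow> 'a set" where
  "verts H = fst H"

definition edges :: "'a hypergraph \<Rightarrow> 'a set set" where
  "edges H = snd H"

definition induced :: "'a hypergraph \<Rightarrow> 'a set \<Rightarrow> 'a hypergraph" where
  "induced H W = (verts H \<inter> W, {e \<in> edges H. e \<subseteq> W})"

(* A negative common difference gives the same sets of natural numbers as its absolute value. *)
definition arith_prog :: "nat \<Rightarrow> nat set \<Rightarrow> bool" where
  "arith_prog q e \<longleftrightarrow> (\<exists>a d. d \<noteq> 0 \<and> e = (\<lambda>i. a + i * d) ` {..<q})"

definition AP_hypergraph :: "nat \<Rightarrow> nat \<Rightarrow> nat \<Rightarrow> nat hypergraph" where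
  "AP_hypergraph n q1 q2 = ({1..n}, {e. e \<subseteq> {1..n} \<and> (arith_prog q1 e \<or> arith_prog q2 e)})"

(* Meaningful for 0 \<le> p \<le> 1; bernoulli_pmf truncates other values of p. *)
definition random_subset :: "nat \<Rightarrow> real \<Rightarrow> nat set pmf" where
  "random_subset n p =
     map_pmf (\<lambda>X. {i \<in> {1..n}. X i}) (Pi_pmf {1..n} False (\<lambda>_. bernoulli_pmf p))"

definition random_AP_hypergraph :: "nat \<Rightarrow> nat \<Rightarrow> nat \<Rightarrow> real \<Rightarrow> nat hypergraph pmf" where
  "random_AP_hypergraph n q1 q2 p =
     map_pmf (induced (AP_hypergraph n q1 q2)) (random_subset n p)"

datatype colour = Red | Blue

(* Long and short edges are told apart by their sizes q1 and q2, so this is meant for q1 \<noteq> q2.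
   Only the values of the colouring on the vertices matter when all edges lie in verts H. *)
definition asym_2_colorable :: "nat \<Rightarrow> nat \<Rightarrow> 'a hypergraph \<Rightarrow> bool" where
  "asym_2_colorable q1 q2 H \<longleftrightarrow>
     (\<exists>col :: 'a \<Rightarrow> colour.
        (\<forall>e \<in> edges H. card e = q1 \<longrightarrow> \<not> (\<forall>v \<in> e. col v = Red)) \<and>
        (\<forall>e \<in> edges H. card e = q2 \<longrightarrow> \<not> (\<forall>v \<in> e. col v = Blue)))"

end

theory Submission
  imports Defs "HOL-Real_Asymp.Real_Asymp"
begin

text \<open>If the hypergraph on the random set \<open>V\<close> is not colourable, take a minimal
  uncolourable family \<open>M\<close> of long edges in \<open>V\<close>: every vertex \<open>v\<close> of every \<open>e \<in> M\<close> lies on a short edge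
  \<open>s\<close> with \<open>s \<inter> e = {v}\<close> such that each \<open>y \<in> s\<close> is the only point of \<open>s\<close> on some \<open>E y \<in> M\<close>. With
  high probability the long edges of all such clusters are pairwise disjoint, because overlapping
  progressions through distinct private points have too large a union.

  One then explores \<open>M\<close> from a long edge, attaching at each step a cluster to the newest edge. Let
  \<open>y = n powr (- 1 / (q1 * (q2 - 1)))\<close>, so that the threshold is \<open>p \<le> c * y ^ q2\<close>, and let
  \<open>b = q1 * (q2 - 2)\<close>. The expected number of starting edges is at most \<open>q1 * y powr (- b)\<close>, a step
  that meets the explored set only in \<open>v\<close> multiplies expectations by at most \<open>1 / 2\<close> (for small \<open>c\<close>),
  one that meets it in a second point by \<open>y ^ b\<close>, and every other configuration costs \<open>y ^ (b + 1)\<close>,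
  always up to powers of the explored size. Hence neither two steps with a second point, nor \<open>log 2 n\<close>
  steps with at most one, nor any other configuration occur with probability bounded away from 0.\<close>

section \<open>Unions of arithmetic progressions\<close>

text \<open>The exponent is the one at which a clean step is balanced: a vertex lies on about
  \<open>n\<close> short edges, and each of the \<open>q2 - 1\<close> new vertices contributes about
  \<open>n * p ^ q1\<close> together with its long edge. With \<open>p = c * y ^ q2\<close> and
  \<open>n * y ^ (q1 * (q2 - 1)) = 1\<close>, the product \<open>n * (n * p ^ q1) ^ (q2 - 1)\<close>
  equals \<open>c ^ (q1 * (q2 - 1))\<close>, free of \<open>n\<close>. Longer explorations thus do
  not become rare by a power of \<open>n\<close>; only the constant \<open>c\<close> makes them
  decay, and about \<open>log n\<close> halvings are needed to outweigh the starts. This is the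
  obstacle that shapes the argument: every estimate has to hold for explored sets of logarithmic
  size, with losses polynomial in that size. A single step with a second contact cannot be excluded
  by such a count, since its gain only cancels the number of starts; it has to be carried along.
  Genericity of the newest edge keeps the other contacts under control, for it leaves no room for a
  short edge with three old points.\<close>

definition ap :: "nat \<Rightarrow> nat \<Rightarrow> nat \<Rightarrow> nat set" where
  "ap a d L = (\<lambda>i. a + i * d) ` {..<L}"

lemma arith_prog_iff_ap: "arith_prog q e \<longleftrightarrow> (\<exists>a d. d > 0 \<and> e = ap a d q)"
  by (auto simp: arith_prog_def ap_def)

lemma finite_ap [simp]: "finite (ap a d L)"
  by (simp add: ap_def)

lemma card_ap: "d > 0 \<Longrightarrow> card (ap a d L) = L"
  unfolding ap_def by (subst card_image) (auto simp: inj_on_def)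

lemma ap_cong: "x \<in> ap a d L \<Longrightarrow> x mod d = a mod d"
  by (auto simp: ap_def)

text \<open>Congruent elements are spaced at least \<open>m\<close> apart. The bound says that
  \<open>card I\<close> is at most the ceiling of \<open>L / m\<close>, written without division so
  that it suits linear arithmetic.\<close>

lemma card_residue_class_le:
  fixes I :: "nat set"
  assumes "L \<ge> 1" "m \<ge> 1" "I \<subseteq> {..<L}" and cong: "\<And>i j. i \<in> I \<Longrightarrow> j \<in> I \<Longrightarrow> i mod m = j mod m"
  shows "m * card I + 1 \<le> L + m"
proof (cases "I = {}")
  case False
  have fin: "finite I" using assms(3) finite_subset by blast
  define i0 where "i0 = Min I"
  have i0: "i0 \<in> I" "\<And>i. i \<in> I \<Longrightarrow> i0 \<le> i"
    using fin False by (auto simp: i0_def)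
  have "I \<subseteq> (\<lambda>k. i0 + m * k) ` {..(L - 1 - i0) div m}"
  proof
    fix i assume i: "i \<in> I"
    then have "m dvd i - i0" using cong[OF i i0(1)] i0(2)[OF i]
      by (metis mod_eq_dvd_iff_nat)
    then obtain k where k: "i - i0 = m * k" by blast
    have "i < L" using i assms(3) by auto
    then have "m * k \<le> L - 1 - i0" using k by linarith
    then have "k \<le> (L - 1 - i0) div m" using assms(2) by (simp add: less_eq_div_iff_mult_less_eq mult.commute)
    moreover have "i = i0 + m * k" using k i0(2)[OF i] by linarith
    ultimately show "i \<in> (\<lambda>k. i0 + m * k) ` {..(L - 1 - i0) div m}" by blast
  qed
  then have "card I \<le> card ((\<lambda>k. i0 + m * k) ` {..(L - 1 - i0) div m})"
    by (intro card_mono) auto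
  also have "\<dots> \<le> (L - 1 - i0) div m + 1" using card_image_le[of "{..(L - 1 - i0) div m}"] by simp
  finally have "m * card I \<le> m * ((L - 1 - i0) div m) + m"
    using mult_le_mono2[of "card I" "(L - 1 - i0) div m + 1" m] by (simp add: algebra_simps)
  also have "\<dots> \<le> L - 1 - i0 + m" by simp
  finally show ?thesis using assms(1) by linarith
qed (use assms in auto)

lemma mod_div_gcd_eq:
  fixes D d :: nat
  assumes "D > 0" and eq: "(a + i * d) mod D = (a + j * d) mod D" and "j \<le> i"
  shows "i mod (D div gcd D d) = j mod (D div gcd D d)"
proof -
  let ?g = "gcd D d"
  have g: "?g > 0" using assms(1) by simp
  have "a + j * d \<le> a + i * d" using assms(3) by simp
  then have "D dvd (a + i * d) - (a + j * d)" using eq mod_eq_dvd_iff_nat by blast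
  then have "D dvd (i - j) * d" by (simp add: diff_mult_distrib)
  moreover have "D = ?g * (D div ?g)" by simp
  moreover have "(i - j) * d = ?g * ((i - j) * (d div ?g))"
    by (metis dvd_mult_div_cancel gcd_dvd2 mult.left_commute)
  ultimately have "?g * (D div ?g) dvd ?g * ((i - j) * (d div ?g))" by argo
  then have "D div ?g dvd (i - j) * (d div ?g)" by (subst (asm) nat_mult_dvd_cancel1[OF g])
  moreover have "coprime (D div ?g) (d div ?g)"
    using assms(1) by (intro div_gcd_coprime) simp
  ultimately have "D div ?g dvd i - j" using coprime_dvd_mult_left_iff by blast
  then show ?thesis using assms(3) mod_eq_dvd_iff_nat by blast
qed

text \<open>\<open>D div gcd D d\<close> is the period of the indices \<open>i\<close> for which
  \<open>a + i * d\<close> stays in one class modulo \<open>D\<close>. \<open>A\<close> is an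
  arbitrary set because it will also be a union of two progressions lying in a common residue
  class.\<close>

lemma card_Int_ap_le:
  assumes "L \<ge> 1" "d > 0" "D > 0"
    and cong: "\<And>x y. x \<in> A \<inter> ap a d L \<Longrightarrow> y \<in> A \<inter> ap a d L \<Longrightarrow> x mod D = y mod D"
  shows "(D div gcd D d) * card (A \<inter> ap a d L) + 1 \<le> L + D div gcd D d"
proof -
  define m where "m = D div gcd D d"
  define I where "I = {i. i < L \<and> a + i * d \<in> A}"
  have im: "A \<inter> ap a d L = (\<lambda>i. a + i * d) ` I" by (auto simp: I_def ap_def)
  have card: "card (A \<inter> ap a d L) = card I"
    unfolding im using assms(2) by (subst card_image) (auto simp: inj_on_def)
  have m1: "m \<ge> 1" using assms(2,3) by (simp add: m_def Suc_leI div_greater_zero_iff)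
  have key: "i mod m = j mod m" if "i \<in> I" "j \<in> I" for i j
  proof -
    have "a + i * d \<in> A \<inter> ap a d L" "a + j * d \<in> A \<inter> ap a d L" using that im by auto
    then have eq: "(a + i * d) mod D = (a + j * d) mod D" using cong by blast
    show ?thesis
    proof (cases "j \<le> i")
      case True
      then show ?thesis unfolding m_def using mod_div_gcd_eq[OF assms(3) eq] by blast
    next
      case False
      then show ?thesis unfolding m_def using mod_div_gcd_eq[OF assms(3) eq[symmetric]] by simp
    qed
  qed
  have "m * card I + 1 \<le> L + m"
  proof (rule card_residue_class_le)
    show "I \<subseteq> {..<L}" by (auto simp: I_def)
  qed (use assms(1) m1 key in blast)+
  then show ?thesis using card m_def by simp
qed

lemma times_Suc_le_mono:
  fixes m k L r :: nat
  assumes "m * k + 1 \<le> L + m" "r \<le> m" "L \<ge> 1"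
  shows "r * k + 1 \<le> L + r"
proof (cases k)
  case (Suc k')
  then have "m * k' + 1 \<le> L" using assms(1) by (simp add: algebra_simps)
  moreover have "r * k' \<le> m * k'" using assms(2) by (rule mult_le_mono1)
  ultimately show ?thesis unfolding Suc mult_Suc_right by linarith
qed (use assms in auto)

lemma card_Int_ap_ge_mod:
  assumes "L \<ge> 1" "d > 0" "D > 0" "r \<le> D div gcd D d"
    and cong: "\<And>x y. x \<in> A \<inter> ap a d L \<Longrightarrow> y \<in> A \<inter> ap a d L \<Longrightarrow> x mod D = y mod D"
  shows "r * card (A \<inter> ap a d L) + 1 \<le> L + r"
  using times_Suc_le_mono[OF card_Int_ap_le[OF assms(1-3) cong] assms(4) assms(1)] .

lemma card_Int_two_ap:
  assumes "L \<ge> 1" "d > 0" "D > 0" "r \<le> D div gcd D d"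
  shows "r * card (ap b D K \<inter> ap a d L) + 1 \<le> L + r"
  using assms by (intro card_Int_ap_ge_mod) (auto dest!: ap_cong)

lemma div_gcd_ge_2:
  fixes d D :: nat
  assumes "0 < d" "0 < D" "\<not> D dvd d"
  shows "2 \<le> D div gcd D d"
proof -
  have "D div gcd D d \<noteq> 0" using assms by (simp add: div_eq_0_iff gcd_le1_nat leD)
  moreover have "D div gcd D d \<noteq> 1"
    by (metis assms(3) dvd_mult_div_cancel gcd_dvd1 gcd_dvd2 mult.right_neutral)
  ultimately show ?thesis by linarith
qed

text \<open>\<open>D div gcd D d\<close> is the denominator of \<open>d / D\<close> in lowest terms,
  and 1/2 is the only fraction strictly between 0 and 1 whose denominator is at most 2.\<close>

lemma div_gcd_ge_3:
  fixes d D :: nat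
  assumes "0 < d" "d < D" "D \<noteq> 2 * d"
  shows "3 \<le> D div gcd D d"
proof -
  have 2: "2 \<le> D div gcd D d" using assms by (intro div_gcd_ge_2) (auto dest: dvd_imp_le)
  have "D div gcd D d \<noteq> 2"
  proof
    assume "D div gcd D d = 2"
    then have D: "D = 2 * gcd D d" by (metis dvd_mult_div_cancel gcd_dvd1 mult.commute)
    obtain k where k: "d = gcd D d * k" by (metis dvdE gcd_dvd2)
    have g: "gcd D d > 0" using assms(1) by (simp add: gcd_pos_nat)
    have "gcd D d * k < gcd D d * 2" using assms(2) D k by (metis mult.commute)
    then have "k < 2" using g by simp
    moreover have "k \<noteq> 0" using k assms(1) by (cases k) auto
    ultimately have "k = 1" by linarith
    then show False using k D assms(3) by simp
  qed
  with 2 show ?thesis by simp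
qed

lemma card_Int_distinct_diff:
  assumes "L \<ge> 1" "d > 0" "D > 0" "d \<noteq> D"
  shows "2 * card (ap b D L \<inter> ap a d L) \<le> L + 1"
proof (cases "d < D")
  case True
  then have "2 \<le> D div gcd D d" using assms by (intro div_gcd_ge_2) (auto dest: dvd_imp_le)
  then show ?thesis using card_Int_two_ap[of L d D 2 b L a] assms by simp
next
  case False
  then have "2 \<le> d div gcd d D" using assms by (intro div_gcd_ge_2) (auto dest: dvd_imp_le)
  then show ?thesis using card_Int_two_ap[of L D d 2 a L b] assms by (simp add: Int_commute)
qed

lemma card_Int_ratio_not_2:
  assumes "L \<ge> 1" "d > 0" "D > 0" "d \<noteq> D" "D \<noteq> 2 * d" "d \<noteq> 2 * D"
  shows "3 * card (ap b D L \<inter> ap a d L) \<le> L + 2"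
proof (cases "d < D")
  case True
  then have "3 \<le> D div gcd D d" using assms by (intro div_gcd_ge_3) auto
  then show ?thesis using card_Int_two_ap[of L d D 3 b L a] assms by simp
next
  case False
  then have "3 \<le> d div gcd d D" using assms by (intro div_gcd_ge_3) auto
  then show ?thesis using card_Int_two_ap[of L D d 3 a L b] assms by (simp add: Int_commute)
qed

text \<open>Among six consecutive integers at most 3 + 2 - 1 = 4 lie in the two classes, so the
  induction strips off six indices at a time; the additive 3 pays for an incomplete last
  block.\<close>

lemma sum_mod_2_or_mod_3:
  "3 * (\<Sum>i<L. of_bool (i mod 2 = a \<or> i mod 3 = (b::nat))) \<le> 2 * L + (3::nat)"
proof (induction L rule: less_induct)
  case (less L)
  let ?P = "\<lambda>i. i mod 2 = a \<or> i mod 3 = b"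
  show ?case
  proof (cases "L < 6")
    case True
    then consider "L = 0" | "L = 1" | "L = 2" | "L = 3" | "L = 4" | "L = 5" by linarith
    then show ?thesis
      by cases (auto simp: lessThan_nat_numeral lessThan_Suc split: if_splits)
  next
    case False
    define K where "K = L - 6"
    have L: "L = Suc (Suc (Suc (Suc (Suc (Suc K)))))" using False by (simp add: K_def)
    have "of_bool (?P K) + of_bool (?P (Suc K)) + of_bool (?P (Suc (Suc K)))
        + of_bool (?P (Suc (Suc (Suc K)))) + of_bool (?P (Suc (Suc (Suc (Suc K)))))
        + of_bool (?P (Suc (Suc (Suc (Suc (Suc K)))))) \<le> (4::nat)"
    proof -
      have "K mod 2 = 0 \<or> K mod 2 = 1" "K mod 3 = 0 \<or> K mod 3 = 1 \<or> K mod 3 = 2" by linarith+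
      moreover have "a = 0 \<or> a = 1 \<or> a > 1" "b = 0 \<or> b = 1 \<or> b = 2 \<or> b > 2" by linarith+
      ultimately show ?thesis by (elim disjE) (simp_all add: mod_Suc)
    qed
    then show ?thesis using less.IH[of K] L by (simp del: of_bool_eq_1_iff)
  qed
qed

section \<open>Unions of three progressions with distinct differences\<close>

lemma card_Un3_Int_ge:
  assumes "finite A" "finite B" "finite C"
  shows "card A + card B + card C \<le> card (A \<union> B \<union> C) + card (B \<inter> A) + card ((A \<union> B) \<inter> C)"
  using card_Un_Int[OF assms(1,2)] card_Un_Int[of "A \<union> B" C] assms by (simp add: Int_commute)

lemma card_Un3_pairs_ge:
  assumes "finite A" "finite B" "finite C"
  shows "card A + card B + card C \<le> card (A \<union> B \<union> C) + card (B \<inter> A) + card (A \<inter> C) + card (B \<inter> C)"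
proof -
  have "card ((A \<union> B) \<inter> C) \<le> card (A \<inter> C) + card (B \<inter> C)"
    by (metis Int_Un_distrib2 card_Un_le)
  then show ?thesis using card_Un3_Int_ge[OF assms] by linarith
qed

text \<open>If \<open>d\<close> divides \<open>D\<close> and two progressions with these differences meet, their union lies in one
  residue class modulo \<open>d\<close>, which a third progression can only meet sparsely.\<close>
lemma card_Un3_ap_dvd_ge:
  assumes "L \<ge> 1" "0 < d" "0 < D" "0 < d3" "d dvd D" "d \<noteq> D" "\<not> d dvd d3"
    and "ap b D L \<inter> ap a d L \<noteq> {}"
  shows "2 * L \<le> card (ap a d L \<union> ap b D L \<union> ap c d3 L) + 1"
proof -
  have ba: "b mod d = a mod d"
  proof -
    obtain z where "z \<in> ap b D L" "z \<in> ap a d L" using assms(8) by blast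
    then have "z mod D = b mod D" "z mod d = a mod d" by (auto dest: ap_cong)
    then show ?thesis using assms(5) by (metis mod_mod_cancel)
  qed
  have in_class: "x mod d = a mod d" if "x \<in> ap a d L \<union> ap b D L" for x
    using that ba assms(5) by (metis UnE ap_cong mod_mod_cancel)
  have "2 * card ((ap a d L \<union> ap b D L) \<inter> ap c d3 L) + 1 \<le> L + 2"
    using assms(2,4,7) by (intro card_Int_ap_ge_mod[where D=d] assms div_gcd_ge_2) (metis IntD1 in_class)+
  moreover have "2 * card (ap b D L \<inter> ap a d L) \<le> L + 1"
    using assms by (intro card_Int_distinct_diff) auto
  ultimately show ?thesis
    using card_Un3_Int_ge[of "ap a d L" "ap b D L" "ap c d3 L"] assms by (simp add: card_ap)
qed

lemma card_Un3_ap_disjoint_ge: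
  assumes "L \<ge> 1" "0 < d1" "0 < d2" "0 < d3" "d1 \<noteq> d3" "d2 \<noteq> d3"
    and "ap b d2 L \<inter> ap a d1 L = {}"
  shows "2 * L \<le> card (ap a d1 L \<union> ap b d2 L \<union> ap c d3 L) + 1"
  using card_Un3_pairs_ge[of "ap a d1 L" "ap b d2 L" "ap c d3 L"] assms
    card_Int_distinct_diff[of L d3 d1 a c] card_Int_distinct_diff[of L d3 d2 b c]
  by (simp add: card_ap)

text \<open>The pairwise overlaps can reach about \<open>L / 2\<close>, \<open>L / 3\<close> and
  \<open>L / 3\<close>, together more than \<open>L\<close>. Hence the two sparser progressions are
  intersected with the first one jointly: the indices covered lie in one class modulo 2 or one class
  modulo 3, a proportion of 2/3 only.\<close>

lemma card_Un3_ap_1_2_3_ge: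
  assumes "L \<ge> 1" "0 < d"
  shows "2 * L \<le> card (ap a d L \<union> ap b (2 * d) L \<union> ap c (3 * d) L) + 2"
proof -
  let ?A = "ap a d L" and ?B = "ap b (2 * d) L" and ?C = "ap c (3 * d) L"
  show ?thesis
  proof (cases "?B \<inter> ?A = {} \<or> ?C \<inter> ?A = {}")
    case True
    then show ?thesis
    proof
      assume "?B \<inter> ?A = {}"
      then show ?thesis using card_Un3_ap_disjoint_ge[of L d "2*d" "3*d" b a c] assms by simp
    next
      assume "?C \<inter> ?A = {}"
      then show ?thesis using card_Un3_ap_disjoint_ge[of L d "3*d" "2*d" c a b] assms
        by (simp add: Un_ac)
    qed
  next
    case False
    then obtain x y where "x \<in> ?B" "x \<in> ?A" "y \<in> ?C" "y \<in> ?A" by blast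
    moreover from calculation obtain i0 j0 where "x = a + i0 * d" "y = a + j0 * d" unfolding ap_def by blast
    ultimately have i0: "a + i0 * d \<in> ?B" and j0: "a + j0 * d \<in> ?C" by simp_all
    define I where "I = {i. i < L \<and> a + i * d \<in> ?B \<union> ?C}"
    have im: "(?B \<union> ?C) \<inter> ?A = (\<lambda>i. a + i * d) ` I" by (auto simp: I_def ap_def)
    have "I \<subseteq> {i. i < L \<and> (i mod 2 = i0 mod 2 \<or> i mod 3 = j0 mod 3)}"
    proof (clarsimp simp: I_def)
      fix i assume i: "i mod 3 \<noteq> j0 mod 3" "a + i * d \<in> ?B \<or> a + i * d \<in> ?C"
      show "i mod 2 = i0 mod 2"
      proof -
        have *: "i mod k = j mod k" if "k > 0" "(a + i * d) mod (k * d) = (a + j * d) mod (k * d)" for i j k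
        proof -
          have "(k * d) div gcd (k * d) d = k" using assms by simp
          then show ?thesis
            using mod_div_gcd_eq[of "k * d" a i d j] mod_div_gcd_eq[of "k * d" a j d i] that assms
            by (metis nat_le_linear nat_0_less_mult_iff)
        qed
        have "a + i * d \<notin> ?C" using *[of 3 i j0] i(1) j0 by (metis ap_cong zero_less_numeral)
        then have "a + i * d \<in> ?B" using i by blast
        then show ?thesis using *[of 2 i i0] i0 by (metis ap_cong zero_less_numeral)
      qed
    qed
    then have "card I \<le> card {i. i < L \<and> (i mod 2 = i0 mod 2 \<or> i mod 3 = j0 mod 3)}"
      by (intro card_mono) auto
    also have "\<dots> = (\<Sum>i<L. of_bool (i mod 2 = i0 mod 2 \<or> i mod 3 = j0 mod 3))"
      by (simp add: sum.If_cases of_bool_def Int_def)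
    finally have "3 * card I \<le> 2 * L + 3" using sum_mod_2_or_mod_3[of "i0 mod 2" "j0 mod 3" L] by linarith
    then have "3 * card ((?B \<union> ?C) \<inter> ?A) \<le> 2 * L + 3"
      unfolding im using card_image_le[of I "\<lambda>i. a + i * d"] by (simp add: I_def)
    moreover have "3 * card (?C \<inter> ?B) \<le> L + 2"
      using assms by (intro card_Int_ratio_not_2) auto
    ultimately show ?thesis
      using card_Un3_Int_ge[of ?B ?C ?A] assms by (simp add: card_ap Un_ac)
  qed
qed

text \<open>The first two overlap in at most about \<open>L / 2\<close> points, which leaves
  \<open>L / 2\<close> for the third. If \<open>d\<close> does not divide \<open>d3\<close>, the
  residue class modulo \<open>d\<close> handles it. For \<open>d3 = d * m\<close> with even
  \<open>m\<close> the roles are exchanged and the class is taken modulo \<open>2 * d\<close>;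
  \<open>m = 3\<close> is the exceptional triple, and odd \<open>m \<ge> 5\<close> gives overlaps of
  about \<open>L / 5\<close> each.\<close>

lemma card_Un3_ap_ratio_2_ge:
  assumes "L \<ge> 1" "0 < d" "0 < d3" "d3 \<noteq> d" "d3 \<noteq> 2 * d"
  shows "2 * L \<le> card (ap a d L \<union> ap b (2 * d) L \<union> ap c d3 L) + 2"
proof (cases "ap b (2 * d) L \<inter> ap a d L = {}")
  case True
  then show ?thesis using card_Un3_ap_disjoint_ge[of L d "2*d" d3 b a c] assms by simp
next
  case meet: False
  show ?thesis
  proof (cases "d dvd d3")
    case False
    then show ?thesis using card_Un3_ap_dvd_ge[of L d "2*d" d3 b a c] meet assms by simp
  next
    case True
    then obtain m where m: "d3 = d * m" by blast
    have m3: "m \<ge> 3"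
    proof -
      have "m \<noteq> 0" "m \<noteq> 1" "m \<noteq> 2" using m assms by auto
      then show ?thesis by linarith
    qed
    show ?thesis
    proof (cases "even m")
      case True
      then have dv: "2 * d dvd d3" using m by auto
      have nd: "\<not> 2 * d dvd d" using assms by (auto dest: dvd_imp_le)
      show ?thesis
      proof (cases "ap c d3 L \<inter> ap b (2 * d) L = {}")
        case True
        then show ?thesis using card_Un3_ap_disjoint_ge[of L "2*d" d3 d c b a] assms
          by (simp add: Un_ac)
      next
        case False
        then show ?thesis using card_Un3_ap_dvd_ge[of L "2*d" d3 d c b a] dv nd assms
          by (simp add: Un_ac)
      qed
    next
      case odd: False
      show ?thesis
      proof (cases "m = 3")
        case True
        then show ?thesis using card_Un3_ap_1_2_3_ge[of L d a b c] assms m by (simp add: mult.commute)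
      next
        case False
        then have m5: "5 \<le> m" using m3 odd by presburger
        have "gcd d3 d = d" "gcd d3 (2 * d) = d"
        proof -
          show "gcd d3 d = d" using m by simp
          have "gcd m 2 = 1" using odd by (simp add: coprime_iff_gcd_eq_1[symmetric])
          then have "gcd (d * m) (d * 2) = d" by (metis gcd_mult_distrib_nat mult.right_neutral)
          then show "gcd d3 (2 * d) = d" using m by (simp add: mult.commute)
        qed
        then have "d3 div gcd d3 d = m" "d3 div gcd d3 (2 * d) = m" using m assms by auto
        then have "5 * card (ap c d3 L \<inter> ap a d L) + 1 \<le> L + 5"
          "5 * card (ap c d3 L \<inter> ap b (2 * d) L) + 1 \<le> L + 5"
          using m5 assms by (intro card_Int_two_ap; simp)+
        moreover have "2 * card (ap b (2 * d) L \<inter> ap a d L) \<le> L + 1"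
          using assms by (intro card_Int_distinct_diff) auto
        ultimately show ?thesis
          using card_Un3_pairs_ge[of "ap a d L" "ap b (2*d) L" "ap c d3 L"] assms
          by (simp add: card_ap Int_commute)
      qed
    qed
  qed
qed

text \<open>The total overlap may be about \<open>L\<close>. Without a ratio 2 every pair shares at
  most about \<open>L / 3\<close> points; a pair of ratio 2 is treated by the preceding
  lemma.\<close>

lemma card_Un3_ap_ge:
  assumes "L \<ge> 1" "0 < d1" "0 < d2" "0 < d3" "d1 \<noteq> d2" "d1 \<noteq> d3" "d2 \<noteq> d3"
  shows "2 * L \<le> card (ap a d1 L \<union> ap b d2 L \<union> ap c d3 L) + 2"
proof -
  consider "d2 = 2 * d1" | "d1 = 2 * d2" | "d3 = 2 * d1" | "d1 = 2 * d3" | "d3 = 2 * d2" | "d2 = 2 * d3"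
    | "d2 \<noteq> 2 * d1" "d1 \<noteq> 2 * d2" "d3 \<noteq> 2 * d1" "d1 \<noteq> 2 * d3" "d3 \<noteq> 2 * d2" "d2 \<noteq> 2 * d3" by blast
  then show ?thesis
  proof cases
    case 1
    then show ?thesis using card_Un3_ap_ratio_2_ge[of L d1 d3 a b c] assms by simp
  next
    case 2
    then show ?thesis using card_Un3_ap_ratio_2_ge[of L d2 d3 b a c] assms by (simp add: Un_ac)
  next
    case 3
    then show ?thesis using card_Un3_ap_ratio_2_ge[of L d1 d2 a c b] assms by (simp add: Un_ac)
  next
    case 4
    then show ?thesis using card_Un3_ap_ratio_2_ge[of L d3 d2 c a b] assms by (simp add: Un_ac)
  next
    case 5
    then show ?thesis using card_Un3_ap_ratio_2_ge[of L d2 d1 b c a] assms by (simp add: Un_ac)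
  next
    case 6
    then show ?thesis using card_Un3_ap_ratio_2_ge[of L d3 d1 c b a] assms by (simp add: Un_ac)
  next
    case 7
    then have "3 * card (ap b d2 L \<inter> ap a d1 L) \<le> L + 2" "3 * card (ap a d1 L \<inter> ap c d3 L) \<le> L + 2"
      "3 * card (ap b d2 L \<inter> ap c d3 L) \<le> L + 2"
      using assms by (intro card_Int_ratio_not_2; auto)+
    then show ?thesis
      using card_Un3_pairs_ge[of "ap a d1 L" "ap b d2 L" "ap c d3 L"] assms by (simp add: card_ap)
  qed
qed

section \<open>Progressions with equal differences and private points\<close>

lemma ap_meet_diff:
  assumes "0 < d" "ap a d L \<inter> ap b d L \<noteq> {}" "a < b"
  obtains k where "b = a + k * d" "0 < k" "k < L"
proof -
  obtain i j where ij: "a + i * d = b + j * d" "i < L" "j < L"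
    using assms(2) by (auto simp: ap_def)
  have "j \<le> i" using ij(1) assms(3) by (metis add_mono less_imp_le linorder_not_le mult_le_mono1 add_less_le_mono order_less_irrefl)
  then have b: "b = a + (i - j) * d" using ij(1) by (simp add: diff_mult_distrib)
  moreover have "0 < i - j" using b assms(3) by (cases "i - j") auto
  moreover have "i - j < L" using ij(2) by simp
  ultimately show ?thesis by (rule that)
qed

text \<open>Since the outer two meet, \<open>c\<close> is fewer than \<open>L\<close> steps beyond
  \<open>a\<close>, so their union is an unbroken progression reaching past the end of the middle
  one.\<close>

lemma ap_subset_Un_if_between:
  assumes "0 < d" "a < b" "b < c" "ap a d L \<inter> ap b d L \<noteq> {}" "ap b d L \<inter> ap c d L \<noteq> {}"
    "ap a d L \<inter> ap c d L \<noteq> {}"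
  shows "ap b d L \<subseteq> ap a d L \<union> ap c d L"
proof
  fix x assume "x \<in> ap b d L"
  then obtain i where i: "x = b + i * d" "i < L" by (auto simp: ap_def)
  obtain k where k: "b = a + k * d" "0 < k" "k < L" using ap_meet_diff assms by metis
  obtain l where l: "c = b + l * d" "0 < l" "l < L" using ap_meet_diff assms by metis
  obtain m where m: "c = a + m * d" "m < L" using ap_meet_diff assms by (metis order_less_trans)
  have mkl: "m = k + l"
  proof -
    have "m * d = (k + l) * d" using k l m by (simp add: algebra_simps)
    then show ?thesis using assms(1) by simp
  qed
  show "x \<in> ap a d L \<union> ap c d L"
  proof (cases "k + i < L")
    case True
    have "x = a + (k + i) * d" using i k by (simp add: algebra_simps)
    then show ?thesis using True by (auto simp: ap_def)
  next
    case False
    then have "l \<le> i" using m(2) mkl by linarith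
    then have "x = c + (i - l) * d" "i - l < L" using i l by (auto simp: algebra_simps)
    then show ?thesis by (auto simp: ap_def)
  qed
qed

text \<open>The second progression starts inside the first and therefore contains its next term
  \<open>a + L * d\<close>. This extra point decides the four-edge case of
  \<open>private_ap_union_card\<close>.\<close>

lemma ap_Suc_subset_Un:
  assumes "0 < d" "ap a d L \<inter> ap b d L \<noteq> {}" "a < b"
  shows "ap a d (Suc L) \<subseteq> ap a d L \<union> ap b d L"
proof
  fix x assume "x \<in> ap a d (Suc L)"
  then obtain i where "x = a + i * d" "i \<in> {..<Suc L}" unfolding ap_def by blast
  then have i: "x = a + i * d" "i \<le> L" by simp_all
  obtain k where k: "b = a + k * d" "0 < k" "k < L" using ap_meet_diff[OF assms] .
  show "x \<in> ap a d L \<union> ap b d L"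
  proof (cases "i < L")
    case False
    then have "x = b + (L - k) * d" "L - k < L" using i k by (auto simp: algebra_simps diff_mult_distrib)
    then show ?thesis by (auto simp: ap_def)
  qed (use i in \<open>auto simp: ap_def\<close>)
qed

text \<open>Three progressions with distinct differences already cover \<open>2 * q1 - 2\<close> points. With at most two
  differences, privacy allows each of them only twice (the middle one of three would be covered by
  the other two), which leaves \<open>card G \<le> 4\<close>.\<close>
lemma private_ap_union_card:
  fixes q1 q2 :: nat and E :: "nat \<Rightarrow> nat set"
  assumes q: "q2 < q1" "3 \<le> q2" and G: "2 \<le> card G" "card G \<le> q2"
    and E: "\<And>u. u \<in> G \<Longrightarrow> arith_prog q1 (E u)" "\<And>u. u \<in> G \<Longrightarrow> u \<in> E u"
    and priv: "\<And>u v. u \<in> G \<Longrightarrow> v \<in> G \<Longrightarrow> u \<noteq> v \<Longrightarrow> u \<notin> E v"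
  shows "q1 * (q2 + card G) < q2 * card (\<Union>(E ` G)) + 2 * q1"
proof -
  have finG: "finite G" using G(1) by (metis card.infinite not_numeral_le_zero)
  obtain a d where ad: "\<And>u. u \<in> G \<Longrightarrow> 0 < d u \<and> E u = ap (a u) (d u) q1"
    using E(1) unfolding arith_prog_iff_ap by metis
  let ?U = "card (\<Union>(E ` G))"
  have finU: "finite (\<Union>(E ` G))" using finG ad by auto
  have cardE: "card (E u) = q1" if "u \<in> G" for u using ad[OF that] card_ap by simp
  have mono: "card X \<le> ?U" if "X \<subseteq> \<Union>(E ` G)" for X using card_mono[OF finU that] .
  \<comment> \<open>As \<open>card G \<le> q2\<close>, the left side is at most
    \<open>2 * q1 * q2\<close>, and \<open>q2 * (2 * q1 - 2) + 2 * q1\<close> exceeds this because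
    \<open>q2 < q1\<close>.\<close>
  have large: ?thesis if "2 * q1 \<le> ?U + 2"
  proof -
    have "q2 * (2 * q1) \<le> q2 * (?U + 2)" using that by (rule mult_le_mono2)
    then have "2 * (q1 * q2) \<le> q2 * ?U + 2 * q2" by (simp add: algebra_simps)
    moreover have "q1 * card G \<le> q1 * q2" using G(2) by (rule mult_le_mono2)
    ultimately show ?thesis using q unfolding distrib_left by linarith
  qed
  show ?thesis
  proof (cases "\<exists>u\<in>G. \<exists>v\<in>G. E u \<inter> E v = {}")
    case True
    then obtain u v where uv: "u \<in> G" "v \<in> G" "E u \<inter> E v = {}" by blast
    have "card (E u \<union> E v) = 2 * q1" using uv cardE ad by (subst card_Un_disjoint) auto
    then show ?thesis using mono[of "E u \<union> E v"] uv by (intro large) (metis SUP_upper Un_least trans_le_add1)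
  next
    case meet: False
    show ?thesis
    proof (cases "\<exists>u\<in>G. \<exists>v\<in>G. \<exists>w\<in>G. d u \<noteq> d v \<and> d u \<noteq> d w \<and> d v \<noteq> d w")
      case True
      then obtain u v w where uvw: "u \<in> G" "v \<in> G" "w \<in> G" "d u \<noteq> d v" "d u \<noteq> d w" "d v \<noteq> d w" by blast
      have "2 * q1 \<le> card (E u \<union> E v \<union> E w) + 2"
        using card_Un3_ap_ge[of q1 "d u" "d v" "d w" "a u" "a v" "a w"] uvw ad q by auto
      moreover have "card (E u \<union> E v \<union> E w) \<le> ?U" using uvw by (intro mono) auto
      ultimately show ?thesis by (intro large) simp
    next
      case two: False
      have no3: False if "u \<in> G" "v \<in> G" "w \<in> G" "d u = d v" "d v = d w" "a u < a v" "a v < a w" for u v w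
      proof -
        have "E v \<subseteq> E u \<union> E w"
          using ap_subset_Un_if_between[of "d v" "a u" "a v" "a w" q1] meet that ad by metis
        then show False using E(2) priv that by (metis UnE subset_iff nat_neq_iff)
      qed
      have aneq: "a u \<noteq> a v" if "u \<in> G" "v \<in> G" "d u = d v" "u \<noteq> v" for u v
        using that ad E(2) priv by metis
      have fib: "card {u \<in> G. d u = r} \<le> 2" for r
      proof (rule ccontr)
        assume "\<not> ?thesis"
        then have "3 \<le> card {u \<in> G. d u = r}" by simp
        then obtain H where H: "H \<subseteq> {u \<in> G. d u = r}" "card H = 3" by (meson obtain_subset_with_card_n)
        then obtain u v w where uvw: "H = {u, v, w}" "u \<noteq> v" "v \<noteq> w" "u \<noteq> w" by (metis card_3_iff)
        then have *: "u \<in> G" "v \<in> G" "w \<in> G" "d u = d v" "d v = d w" "d u = d w" using H by auto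
        then have "a u \<noteq> a v" "a v \<noteq> a w" "a u \<noteq> a w" using aneq uvw by auto
        then show False using no3[of u v w] no3[of u w v] no3[of v u w] no3[of v w u] no3[of w u v] no3[of w v u] *
          by (metis linorder_neqE_nat)
      qed
      have img: "card (d ` G) \<le> 2"
      proof (rule ccontr)
        assume "\<not> ?thesis"
        then obtain H where H: "H \<subseteq> d ` G" "card H = 3"
          by (metis (no_types, lifting) Suc_leI eval_nat_numeral(3) linorder_not_le obtain_subset_with_card_n)
        then obtain x y z where "H = {x, y, z}" "x \<noteq> y" "y \<noteq> z" "x \<noteq> z" by (metis card_3_iff)
        then show False using H two by (auto simp: image_iff) 
      qed
      have cardG: "card G = (\<Sum>r\<in>d ` G. card {u \<in> G. d u = r})"
        using sum.image_gen[OF finG, of "\<lambda>_. 1::nat" d] by simp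
      also have "\<dots> \<le> (\<Sum>r\<in>d ` G. 2)" by (intro sum_mono fib)
      finally have le: "card G \<le> card (d ` G) * 2" by simp
      then have G4: "card G \<le> 4" using img by linarith
      have dist: "\<exists>u\<in>G. \<exists>v\<in>G. d u \<noteq> d v" if "3 \<le> card G"
      proof (rule ccontr)
        assume "\<not> ?thesis"
        moreover obtain u where "u \<in> G" using G(1) by (metis all_not_in_conv card.empty not_numeral_le_zero)
        ultimately have "d ` G \<subseteq> {d u}" by blast
        then have "card (d ` G) \<le> 1" using card_mono[of "{d u}" "d ` G"] by simp
        then show False using le that by linarith
      qed
      have pairq: "4 * q1 \<le> 2 * card (E u \<union> E v) + (q1 + 1)" if "u \<in> G" "v \<in> G" "d u \<noteq> d v" for u v
        using card_Int_distinct_diff[of q1 "d u" "d v" "a v" "a u"] that ad q cardE[of u] cardE[of v]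
          card_Un_Int[of "E u" "E v"] by (auto simp: Int_commute)
      consider "card G = 2" | "card G = 3" | "card G = 4" using G(1) G4 by linarith
      then show ?thesis
      proof cases
        case 1
        then obtain u v where uv: "G = {u, v}" "u \<noteq> v" by (meson card_2_iff)
        \<comment> \<open>For two edges a single point beyond \<open>E v\<close> is enough:
          \<open>q2 * (q1 + 1) + 2 * q1\<close> exceeds \<open>q1 * (q2 + 2)\<close> by
          \<open>q2\<close>.\<close>
        have "u \<notin> E v" using priv uv by auto
        then have "card (insert u (E v)) = q1 + 1" using cardE[of v] uv ad by auto
        moreover have "card (insert u (E v)) \<le> ?U" using uv E(2) by (intro mono) auto
        ultimately have "q2 * (q1 + 1) \<le> q2 * ?U" by (intro mult_le_mono2) simp
        then have "q1 * q2 + q2 \<le> q2 * ?U" by (simp add: algebra_simps)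
        then show ?thesis unfolding 1 distrib_left using q by linarith
      next
        case 2
        then obtain u v where uv: "u \<in> G" "v \<in> G" "d u \<noteq> d v" using dist by auto
        have "card (E u \<union> E v) \<le> ?U" using uv by (intro mono) auto
        then have "3 * q1 \<le> 2 * ?U + 1" using pairq[OF uv] by linarith
        then have "q2 * (3 * q1) \<le> q2 * (2 * ?U + 1)" by (rule mult_le_mono2)
        then have *: "3 * (q1 * q2) \<le> 2 * (q2 * ?U) + q2" by (simp add: algebra_simps)
        have "q1 * 3 \<le> q1 * q2" using q(2) by (rule mult_le_mono2)
        then show ?thesis unfolding 2 distrib_left using * q by linarith
      next
        case 3
        then have c2: "card (d ` G) = 2" using le img by linarith
        then obtain r t where rt: "d ` G = {r, t}" "r \<noteq> t" by (meson card_2_iff)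
        have "card {u \<in> G. d u = r} + card {u \<in> G. d u = t} = 4" using cardG rt 3 by simp
        then have f2: "card {u \<in> G. d u = r} = 2" "card {u \<in> G. d u = t} = 2" using fib[of r] fib[of t] by linarith+
        \<comment> \<open>Two edges with equal difference contain a progression of length
          \<open>q1 + 1\<close>. Length \<open>q1\<close> would not do: for \<open>q2 = 4\<close>
          the count from two such progressions falls just short.\<close>
        have ext: "\<exists>b. ap b r (Suc q1) \<subseteq> \<Union>(E ` G) \<and> 0 < r" if r2: "card {u \<in> G. d u = r} = 2" for r
        proof -
          obtain u v where "{u \<in> G. d u = r} = {u, v}" "u \<noteq> v" using r2 by (meson card_2_iff)
          then have uv: "u \<in> G" "v \<in> G" "d u = r" "d v = r" "u \<noteq> v" by auto
          have one: "\<exists>b. ap b r (Suc q1) \<subseteq> \<Union>(E ` G) \<and> 0 < r" if "u \<in> G" "v \<in> G" "d u = r" "d v = r" "a u < a v" for u v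
          proof -
            have "ap (a u) r (Suc q1) \<subseteq> E u \<union> E v"
              using ap_Suc_subset_Un[of r "a u" q1 "a v"] ad[OF that(1)] ad[OF that(2)] that meet by metis
            then have "ap (a u) r (Suc q1) \<subseteq> \<Union>(E ` G)" using that(1,2) by blast
            moreover have "0 < r" using ad[OF that(1)] that(3) by blast
            ultimately show ?thesis by blast
          qed
          have "a u \<noteq> a v" using aneq uv by auto
          then show ?thesis using one[of u v] one[of v u] uv by (metis linorder_neqE_nat)
        qed
        obtain b where b: "ap b r (Suc q1) \<subseteq> \<Union>(E ` G)" "0 < r" using ext f2(1) by blast
        obtain c where c: "ap c t (Suc q1) \<subseteq> \<Union>(E ` G)" "0 < t" using ext f2(2) by blast
        have "card (ap b r (Suc q1) \<union> ap c t (Suc q1)) \<le> ?U" using b c by (intro mono) auto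
        moreover have "2 * card (ap b r (Suc q1) \<inter> ap c t (Suc q1)) \<le> Suc q1 + 1"
          using b c rt by (intro card_Int_distinct_diff) auto
        ultimately have "3 * q1 + 2 \<le> 2 * ?U"
          using card_Un_Int[of "ap b r (Suc q1)" "ap c t (Suc q1)"] b(2) c(2) by (simp add: card_ap)
        then have "q2 * (3 * q1 + 2) \<le> q2 * (2 * ?U)" by (rule mult_le_mono2)
        then have "3 * (q1 * q2) + 2 * q2 \<le> 2 * (q2 * ?U)" by (simp add: algebra_simps)
        moreover have "q1 * 4 \<le> q1 * q2" using G(2) unfolding 3 by (rule mult_le_mono2)
        ultimately show ?thesis unfolding 3 distrib_left using q by linarith
      qed
    qed
  qed
qed

section \<open>Counting edges\<close>

definition ap_edges :: "nat \<Rightarrow> nat \<Rightarrow> nat set set" where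
  "ap_edges n q = {e. e \<subseteq> {1..n} \<and> arith_prog q e}"

lemma finite_ap_edges [simp]: "finite (ap_edges n q)"
  by (rule finite_subset[of _ "Pow {1..n}"]) (auto simp: ap_edges_def)

lemma ap_edges_finite_edge: "e \<in> ap_edges n q \<Longrightarrow> finite e"
  by (auto simp: ap_edges_def intro: finite_subset)

lemma card_arith_prog: "arith_prog q e \<Longrightarrow> card e = q"
  by (auto simp: arith_prog_iff_ap card_ap)

lemma card_ap_edge: "e \<in> ap_edges n q \<Longrightarrow> card e = q"
  by (auto simp: ap_edges_def card_arith_prog)

lemma ap_edges_is_ap: "e \<in> ap_edges n q \<Longrightarrow> \<exists>a d. 0 < d \<and> e = ap a d q"
  by (auto simp: ap_edges_def arith_prog_iff_ap)

lemma ap_edgesE: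
  assumes "e \<in> ap_edges n q" "2 \<le> q"
  obtains a d where "0 < d" "d \<le> n" "1 \<le> a" "a \<le> n" "e = ap a d q"
proof -
  obtain a d where ad: "0 < d" "e = ap a d q" using assms by (auto simp: ap_edges_def arith_prog_iff_ap)
  have "a + i * d \<in> e" if "i < q" for i using ad(2) that unfolding ap_def by blast
  from this[of 0] this[of 1] have "a + 0 * d \<in> e" "a + 1 * d \<in> e" using assms(2) by simp_all
  then have "a \<in> {1..n}" "a + d \<in> {1..n}" using assms(1) by (auto simp: ap_edges_def)
  then show ?thesis using that ad by auto
qed

lemma card_ap_edges_le:
  assumes "2 \<le> q"
  shows "card (ap_edges n q) \<le> n * n"
proof -
  have "ap_edges n q \<subseteq> (\<lambda>(a, d). ap a d q) ` ({1..n} \<times> {1..n})"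
  proof
    fix e assume "e \<in> ap_edges n q"
    then show "e \<in> (\<lambda>(a, d). ap a d q) ` ({1..n} \<times> {1..n})"
      by (rule ap_edgesE[OF _ assms]) (auto intro!: image_eqI)
  qed
  then have "card (ap_edges n q) \<le> card ((\<lambda>(a, d). ap a d q) ` ({1..n} \<times> {1..n}))"
    by (intro card_mono) auto
  also have "\<dots> \<le> card ({1..n} \<times> {1..n})" by (intro card_image_le) auto
  finally show ?thesis by simp
qed

lemma card_ap_edges_through_le:
  assumes "2 \<le> q"
  shows "card {e \<in> ap_edges n q. x \<in> e} \<le> q * n"
proof -
  have "{e \<in> ap_edges n q. x \<in> e} \<subseteq> (\<lambda>(i, d). ap (x - i * d) d q) ` ({..<q} \<times> {1..n})"
  proof clarify
    fix e assume e: "e \<in> ap_edges n q" "x \<in> e"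
    obtain a d where ad: "0 < d" "d \<le> n" "e = ap a d q" using ap_edgesE[OF e(1) assms] by metis
    obtain i where "x = a + i * d" "i \<in> {..<q}" using e(2) ad(3) unfolding ap_def by blast
    then show "e \<in> (\<lambda>(i, d). ap (x - i * d) d q) ` ({..<q} \<times> {1..n})"
      using ad by (intro image_eqI[of _ _ "(i, d)"]) auto
  qed
  then have "card {e \<in> ap_edges n q. x \<in> e} \<le> card ((\<lambda>(i, d). ap (x - i * d) d q) ` ({..<q} \<times> {1..n}))"
    by (intro card_mono) auto
  also have "\<dots> \<le> card ({..<q} \<times> {1..n})" by (intro card_image_le) auto
  finally show ?thesis by simp
qed

text \<open>Counting through a relation: the positions that encode a progression are known only
  existentially, so a code is chosen for each element, and \<open>R\<close> makes the choice
  injective.\<close>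

lemma card_le_by_code:
  assumes "finite I" "\<And>e. e \<in> S \<Longrightarrow> \<exists>t\<in>I. R t e"
    and "\<And>t e f. t \<in> I \<Longrightarrow> R t e \<Longrightarrow> R t f \<Longrightarrow> e = f"
  shows "card S \<le> card I"
proof -
  define c where "c e = (SOME t. t \<in> I \<and> R t e)" for e
  have c: "c e \<in> I \<and> R (c e) e" if "e \<in> S" for e
    unfolding c_def by (rule someI_ex) (use assms(2)[OF that] in blast)
  have "inj_on c S"
  proof (rule inj_onI)
    fix e f assume "e \<in> S" "f \<in> S" "c e = c f"
    then show "e = f" using c[of e] c[of f] assms(3)[of "c e" e f] by simp
  qed
  moreover have "c ` S \<subseteq> I" using c by blast
  ultimately show ?thesis using assms(1) card_inj_on_le by blast
qed

text \<open>The code is the pair of positions of \<open>x\<close> and \<open>y\<close>; as these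
  differ, two linear equations determine the first term and the difference.\<close>

lemma card_ap_edges_through_two_le:
  assumes "x \<noteq> y"
  shows "card {e \<in> ap_edges n q. x \<in> e \<and> y \<in> e} \<le> q * q"
proof -
  let ?R = "\<lambda>t e. \<exists>a d. 0 < d \<and> e = ap a d q \<and> x = a + fst t * d \<and> y = a + snd t * d"
  have "card {e \<in> ap_edges n q. x \<in> e \<and> y \<in> e} \<le> card ({..<q} \<times> {..<q})"
  proof (rule card_le_by_code[where R = ?R])
    fix e assume e: "e \<in> {e \<in> ap_edges n q. x \<in> e \<and> y \<in> e}"
    then have "e \<in> ap_edges n q" by simp
    from ap_edges_is_ap[OF this] obtain a d where ad: "0 < d" "e = ap a d q" by blast
    have "x \<in> ap a d q" "y \<in> ap a d q" using e ad(2) by simp_all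
    then obtain i j where "x = a + i * d" "i \<in> {..<q}" "y = a + j * d" "j \<in> {..<q}"
      unfolding ap_def by blast
    then show "\<exists>t\<in>{..<q} \<times> {..<q}. ?R t e"
      using ad by (intro bexI[of _ "(i, j)"]) auto
  next
    fix t e f assume "?R t e" "?R t f"
    then obtain a d b D where e: "0 < d" "e = ap a d q" "x = a + fst t * d" "y = a + snd t * d"
      and f: "0 < D" "f = ap b D q" "x = b + fst t * D" "y = b + snd t * D" by auto
    have "int a + int (fst t) * int d = int b + int (fst t) * int D"
       "int a + int (snd t) * int d = int b + int (snd t) * int D"
      using e f by (metis of_nat_add of_nat_mult)+
    moreover from this have "(int (fst t) - int (snd t)) * (int d - int D) = 0"
      unfolding left_diff_distrib right_diff_distrib by linarith
    moreover have "fst t \<noteq> snd t" using e assms by auto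
    ultimately have "d = D" "a = b" by auto
    then show "e = f" using e f by simp
  qed simp
  then show ?thesis by simp
qed

text \<open>Given two distinct points \<open>u, v\<close>, a progression through \<open>u\<close> is determined, up to finitely many
  choices of positions, by meeting some progression through \<open>v\<close> twice.\<close>
lemma card_ap_edges_double_meet_le:
  assumes "u \<noteq> v"
  shows "card {e \<in> ap_edges n q. u \<in> e \<and> (\<exists>f \<in> ap_edges n q. v \<in> f \<and> 2 \<le> card (e \<inter> f))} \<le> q ^ 6"
proof -
  let ?I = "{..<q} \<times> {..<q} \<times> {..<q} \<times> {..<q} \<times> {..<q} \<times> {..<q}"
  let ?Q = "\<lambda>i j k i' j' k' e. \<exists>a d b D. 0 < d \<and> 0 < D \<and> e = ap a d q
      \<and> u = a + i * d \<and> v = b + i' * D \<and> a + j * d = b + j' * D \<and> a + k * d = b + k' * D \<and> j \<noteq> k"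
  let ?R = "\<lambda>(i, j, k, i', j', k'). ?Q i j k i' j' k'"
  have "card {e \<in> ap_edges n q. u \<in> e \<and> (\<exists>f \<in> ap_edges n q. v \<in> f \<and> 2 \<le> card (e \<inter> f))} \<le> card ?I"
  proof (rule card_le_by_code[where R = ?R])
    fix e assume e: "e \<in> {e \<in> ap_edges n q. u \<in> e \<and> (\<exists>f \<in> ap_edges n q. v \<in> f \<and> 2 \<le> card (e \<inter> f))}"
    then obtain f where f: "f \<in> ap_edges n q" "v \<in> f" "2 \<le> card (e \<inter> f)" by blast
    have "e \<in> ap_edges n q" "u \<in> e" using e by simp_all
    from ap_edges_is_ap[OF this(1)] obtain a d where ad: "0 < d" "e = ap a d q" by blast
    from ap_edges_is_ap[OF f(1)] obtain b D where bD: "0 < D" "f = ap b D q" by blast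
    obtain y z where yz: "y \<in> e \<inter> f" "z \<in> e \<inter> f" "y \<noteq> z"
    proof -
      obtain Y where "Y \<subseteq> e \<inter> f" "card Y = 2" using f(3) by (meson obtain_subset_with_card_n)
      then show ?thesis using that by (metis card_2_iff insert_subset)
    qed
    have "u \<in> ap a d q" "v \<in> ap b D q" "y \<in> ap a d q" "z \<in> ap a d q" "y \<in> ap b D q" "z \<in> ap b D q"
      using \<open>u \<in> e\<close> ad(2) bD(2) f yz by simp_all
    then obtain i i' j k j' k' where *: "u = a + i * d" "i \<in> {..<q}" "v = b + i' * D" "i' \<in> {..<q}"
      "y = a + j * d" "j \<in> {..<q}" "z = a + k * d" "k \<in> {..<q}"
      "y = b + j' * D" "j' \<in> {..<q}" "z = b + k' * D" "k' \<in> {..<q}"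
      unfolding ap_def by blast
    have "?Q i j k i' j' k' e"
    proof (intro exI conjI)
      show "0 < d" "0 < D" "e = ap a d q" "u = a + i * d" "v = b + i' * D" using ad bD * by blast+
      show "a + j * d = b + j' * D" "a + k * d = b + k' * D" "j \<noteq> k" using * yz(3) by auto
    qed
    then have "?R (i, j, k, i', j', k') e" by simp
    moreover have "(i, j, k, i', j', k') \<in> ?I" using * by simp
    ultimately show "\<exists>t\<in>?I. ?R t e" by (rule bexI)
  next
    fix t e f assume "?R t e" "?R t f"
    then obtain i j k i' j' k' where "?Q i j k i' j' k' e" "?Q i j k i' j' k' f" by (cases t) auto
    then obtain a d b D a2 d2 b2 D2 where e: "0 < d" "0 < D" "e = ap a d q"
        "u = a + i * d" "v = b + i' * D" "a + j * d = b + j' * D" "a + k * d = b + k' * D" "j \<noteq> k"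
      and f: "f = ap a2 d2 q" "u = a2 + i * d2" "v = b2 + i' * D2"
        "a2 + j * d2 = b2 + j' * D2" "a2 + k * d2 = b2 + k' * D2" by blast
    have E: "int u = int a + int i * int d" "int v = int b + int i' * int D"
        "int a + int j * int d = int b + int j' * int D" "int a + int k * int d = int b + int k' * int D"
      using e by (metis of_nat_add of_nat_mult)+
    have F: "int u = int a2 + int i * int d2" "int v = int b2 + int i' * int D2"
        "int a2 + int j * int d2 = int b2 + int j' * int D2" "int a2 + int k * int d2 = int b2 + int k' * int D2"
      using f by (metis of_nat_add of_nat_mult)+
    \<comment> \<open>The differences solve a linear system whose homogeneous solutions are proportional to
      \<open>(d, D)\<close>; a second solution would force \<open>u = v\<close>.\<close>
    have h1: "(int j - int i) * int d - (int j' - int i') * int D = int v - int u"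
        "(int j - int i) * int d2 - (int j' - int i') * int D2 = int v - int u"
      using E F unfolding left_diff_distrib by linarith+
    have h2: "(int j - int k) * int d = (int j' - int k') * int D"
        "(int j - int k) * int d2 = (int j' - int k') * int D2"
      using E F unfolding left_diff_distrib by linarith+
    have "(int j - int k) * (int d * int D2) = (int j' - int k') * int D * int D2"
      using h2(1) by (simp only: mult.assoc[symmetric])
    also have "\<dots> = (int j - int k) * (int d2 * int D)"
      using h2(2) by (simp only: mult.assoc[symmetric]) (simp only: mult.assoc mult.commute mult.left_commute)
    finally have proport: "int d * int D2 = int d2 * int D" using e(8) by simp
    have "(int v - int u) * int d2 = (int j - int i) * (int d * int d2) - (int j' - int i') * (int d2 * int D)"
      unfolding h1(1)[symmetric] by (simp add: algebra_simps)
    also have "\<dots> = (int j - int i) * (int d * int d2) - (int j' - int i') * (int d * int D2)"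
      unfolding proport ..
    also have "\<dots> = (int v - int u) * int d" unfolding h1(2)[symmetric] by (simp add: algebra_simps)
    finally have "int d2 = int d" using assms by simp
    then have "d = d2" "a = a2" using e(4) f(2) by simp_all
    then show "e = f" using e(3) f(1) by simp
  qed simp
  then show ?thesis by (simp add: eval_nat_numeral algebra_simps)
qed

section \<open>Critical families\<close>

lemma finite_minimal_subset:
  assumes "finite A" "P A"
  obtains B where "B \<subseteq> A" "P B" "\<And>C. C \<subset> B \<Longrightarrow> \<not> P C"
proof -
  have "\<exists>B\<subseteq>A. P B \<and> (\<forall>C. C \<subset> B \<longrightarrow> \<not> P C)"
    using assms
  proof (induction A rule: finite_psubset_induct)
    case (psubset A)
    show ?case
    proof (cases "\<exists>C\<subset>A. P C")
      case True
      then obtain C where "C \<subset> A" "P C" by blast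
      then show ?thesis using psubset.IH[of C] by (meson order_trans psubset_imp_subset)
    next
      case False
      then show ?thesis using psubset.prems by blast
    qed
  qed
  then show ?thesis using that by blast
qed

text \<open>The obstruction to colouring: in a minimal uncolourable family of long edges, recolouring any
  vertex \<open>v\<close> of any edge \<open>e\<close> creates a blue short edge \<open>s\<close> through \<open>v\<close>, each of whose
  vertices is the only blue vertex of some long edge.\<close>
lemma critical_family_exists:
  assumes fin: "finite V" "finite L" and sub: "\<And>e. e \<in> L \<Longrightarrow> e \<subseteq> V" and ne: "{} \<notin> S"
    and unc: "\<And>B. B \<subseteq> V \<Longrightarrow> (\<And>e. e \<in> L \<Longrightarrow> e \<inter> B \<noteq> {}) \<Longrightarrow> \<exists>s\<in>S. s \<subseteq> B"
  obtains M where "M \<subseteq> L" "M \<noteq> {}"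
    "\<And>e v. e \<in> M \<Longrightarrow> v \<in> e \<Longrightarrow> \<exists>s\<in>S. s \<inter> e = {v} \<and> s \<subseteq> V \<and> (\<exists>E. E v = e \<and> (\<forall>y\<in>s. E y \<in> M \<and> E y \<inter> s = {y}))"
proof -
  \<comment> \<open>\<open>B\<close> plays the set of blue vertices:
    \<open>e \<inter> B \<noteq> {}\<close> says that \<open>e\<close> is not entirely red, and
    \<open>s \<subseteq> B\<close> that \<open>s\<close> is entirely blue.\<close>
  define uncol where "uncol M \<longleftrightarrow> (\<forall>B\<subseteq>V. (\<forall>e\<in>M. e \<inter> B \<noteq> {}) \<longrightarrow> (\<exists>s\<in>S. s \<subseteq> B))" for M
  have "uncol L" using unc by (auto simp: uncol_def)
  then obtain M where M: "M \<subseteq> L" "uncol M" "\<And>C. C \<subset> M \<Longrightarrow> \<not> uncol C"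
    using finite_minimal_subset[OF fin(2), of uncol] by metis
  have "M \<noteq> {}"
  proof
    assume "M = {}"
    then obtain s where "s \<in> S" "s \<subseteq> {}" using M(2) unfolding uncol_def by blast
    then show False using ne by simp
  qed
  moreover have "\<exists>s\<in>S. s \<inter> e = {v} \<and> s \<subseteq> V \<and> (\<exists>E. E v = e \<and> (\<forall>y\<in>s. E y \<in> M \<and> E y \<inter> s = {y}))"
    if e: "e \<in> M" and v: "v \<in> e" for e v
  proof -
    have "\<not> uncol (M - {e})" by (rule M(3)) (use e in blast)
    then obtain B where B: "B \<subseteq> V" "\<forall>f\<in>M - {e}. f \<inter> B \<noteq> {}" "\<not> (\<exists>s\<in>S. s \<subseteq> B)"
      unfolding uncol_def by metis
    have eB: "e \<inter> B = {}"
    proof (rule ccontr)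
      assume "e \<inter> B \<noteq> {}"
      then have "\<forall>f\<in>M. f \<inter> B \<noteq> {}" using B(2) by (metis Diff_iff singletonD)
      then show False using M(2) B(1,3) unfolding uncol_def by metis
    qed
    have vV: "v \<in> V" using sub M(1) e v by blast
    \<comment> \<open>Adding \<open>v\<close> to the blue set repairs \<open>e\<close>. Passing to a
      minimal hitting set \<open>C\<close> gives every vertex of \<open>C\<close> a long edge on
      which it is the only blue one.\<close>
    let ?hit = "\<lambda>C. \<forall>f\<in>M. f \<inter> C \<noteq> {}"
    have "finite (insert v B)" using B(1) fin(1) finite_subset by auto
    moreover have "?hit (insert v B)" using B(2) v by blast
    ultimately obtain C where C: "C \<subseteq> insert v B" "?hit C" "\<And>D. D \<subset> C \<Longrightarrow> \<not> ?hit D"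
      by (rule finite_minimal_subset) blast
    have CV: "C \<subseteq> V" using C(1) vV B(1) by blast
    then obtain s where s: "s \<in> S" "s \<subseteq> C" using M(2) C(2) unfolding uncol_def by metis
    have vs: "v \<in> s" using B(3) s C(1) by blast
    have se: "s \<inter> e = {v}" using vs v s(2) C(1) eB by blast
    have "\<exists>f\<in>M. f \<inter> s = {y}" if y: "y \<in> s" for y
    proof -
      have "C - {y} \<subset> C" using y s(2) by blast
      then obtain f where "f \<in> M" "f \<inter> (C - {y}) = {}" using C(3)[of "C - {y}"] by metis
      moreover have "f \<inter> C \<noteq> {}" using C(2) \<open>f \<in> M\<close> by blast
      ultimately show ?thesis using y s(2) by blast
    qed
    then obtain F where F: "\<And>y. y \<in> s \<Longrightarrow> F y \<in> M \<and> F y \<inter> s = {y}" by metis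
    \<comment> \<open>At \<open>v\<close> the edge \<open>e\<close> itself serves as private edge,
      because \<open>s\<close> meets \<open>e\<close> only in \<open>v\<close>.\<close>
    have "\<forall>y\<in>s. (F(v := e)) y \<in> M \<and> (F(v := e)) y \<inter> s = {y}"
      using F e se by (auto simp: Int_commute)
    moreover have "(F(v := e)) v = e" by simp
    ultimately have "\<exists>E. E v = e \<and> (\<forall>y\<in>s. E y \<in> M \<and> E y \<inter> s = {y})"
      by (intro exI[of _ "F(v := e)"] conjI)
    then show ?thesis using s CV se by (intro bexI[of _ s] conjI) auto
  qed
  ultimately show ?thesis by (rule that[OF M(1)])
qed

section \<open>Weights of attached long edges\<close>

lemma sum_UN_le:
  fixes f :: "'b \<Rightarrow> real"
  assumes "finite I" "\<And>i. i \<in> I \<Longrightarrow> finite (A i)" "\<And>x. 0 \<le> f x"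
  shows "sum f (\<Union>i\<in>I. A i) \<le> (\<Sum>i\<in>I. sum f (A i))"
  using assms(1,2)
proof (induction I rule: finite_induct)
  case (insert i I)
  have "sum f (\<Union>j\<in>insert i I. A j) = sum f (A i \<union> (\<Union>j\<in>I. A j))" by simp
  also have "\<dots> \<le> sum f (A i) + sum f (\<Union>j\<in>I. A j)"
  proof -
    have "sum f (A i \<union> (\<Union>j\<in>I. A j)) + sum f (A i \<inter> (\<Union>j\<in>I. A j)) = sum f (A i) + sum f (\<Union>j\<in>I. A j)"
      using insert by (intro sum.union_inter) auto
    moreover have "0 \<le> sum f (A i \<inter> (\<Union>j\<in>I. A j))" by (intro sum_nonneg assms)
    ultimately show ?thesis by linarith
  qed
  also have "\<dots> \<le> sum f (A i) + (\<Sum>i\<in>I. sum f (A i))" using insert by simp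
  finally show ?case using insert by simp
qed simp

lemma sum_le_card_times:
  fixes f :: "'a \<Rightarrow> real"
  assumes "finite B" "A \<subseteq> B" "card B \<le> N" "\<And>x. x \<in> A \<Longrightarrow> f x \<le> c" "0 \<le> c"
  shows "sum f A \<le> real N * c"
proof -
  have "sum f A \<le> real (card A) * c" using assms(4) by (rule sum_bounded_above)
  also have "\<dots> \<le> real N * c"
    using card_mono[OF assms(1,2)] assms(3,5) by (intro mult_right_mono) linarith+
  finally show ?thesis .
qed

locale ap_pair =
  fixes q1 q2 n :: nat and P :: real
  assumes q12: "q2 < q1" and q2: "3 \<le> q2" and P: "0 < P" "P \<le> 1"
begin

abbreviation "long \<equiv> ap_edges n q1"
abbreviation "short \<equiv> ap_edges n q2"

text \<open>Contacts are counted against \<open>W\<close> and all the other attached edges, not only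
  the earlier ones. This is symmetric in \<open>Y\<close>, so any chosen edge may be exposed last.
  Extensional functions keep the family finite and determined by a restriction together with one
  value.\<close>

definition attach :: "nat \<Rightarrow> nat set \<Rightarrow> nat set \<Rightarrow> (nat \<Rightarrow> nat set) set" where
  "attach b Y W = {E \<in> Pi\<^sub>E Y (\<lambda>y. {e \<in> long. y \<in> e}). \<forall>y\<in>Y. card (E y \<inter> (W \<union> \<Union>(E ` (Y - {y})))) \<le> b}"

lemma finite_attach [simp]: "finite Y \<Longrightarrow> finite (attach b Y W)"
  unfolding attach_def by (rule finite_subset[of _ "Pi\<^sub>E Y (\<lambda>y. {e \<in> long. y \<in> e})"]) (auto intro: finite_PiE)

lemma attachD:
  assumes "E \<in> attach b Y W" "y \<in> Y"
  shows "E y \<in> long" "y \<in> E y" "card (E y \<inter> (W \<union> \<Union>(E ` (Y - {y})))) \<le> b"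
proof -
  show "card (E y \<inter> (W \<union> \<Union>(E ` (Y - {y})))) \<le> b" using assms by (simp add: attach_def)
  have "E y \<in> {e \<in> long. y \<in> e}" using assms unfolding attach_def by (blast dest: PiE_mem)
  then show "E y \<in> long" "y \<in> E y" by simp_all
qed

lemma finite_Un_attach:
  assumes "E \<in> attach b Y W" "finite Y" "finite W" "Z \<subseteq> Y"
  shows "finite (W \<union> \<Union>(E ` Z))"
proof -
  have "finite Z" using assms(2,4) finite_subset by blast
  moreover have "finite (E y)" if "y \<in> Z" for y
    using attachD(1)[OF assms(1)] that assms(4) ap_edges_finite_edge by blast
  ultimately show ?thesis using assms(3) by simp
qed

lemma card_Un_attach_le:
  assumes "E \<in> attach b Y W" "finite Y" "finite W"
  shows "card (W \<union> \<Union>(E ` Y)) \<le> card W + q1 * card Y"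
proof -
  have "card (\<Union>(E ` Y)) \<le> (\<Sum>y\<in>Y. card (E y))" using assms(2) by (rule card_UN_le)
  also have "\<dots> = (\<Sum>y\<in>Y. q1)" by (intro sum.cong refl) (use attachD(1)[OF assms(1)] card_ap_edge in blast)
  finally have "card (\<Union>(E ` Y)) \<le> q1 * card Y" by (simp add: mult.commute)
  then show ?thesis using card_Un_le[of W "\<Union>(E ` Y)"] by linarith
qed

lemma attach_restrict:
  assumes "E \<in> attach b (insert y Y) W" "y \<notin> Y" "finite Y" "finite W"
  shows "restrict E Y \<in> attach b Y W"
proof -
  have "restrict E Y \<in> Pi\<^sub>E Y (\<lambda>y. {e \<in> long. y \<in> e})" using attachD[OF assms(1)] by auto
  moreover have "card (restrict E Y z \<inter> (W \<union> \<Union>(restrict E Y ` (Y - {z})))) \<le> b" if z: "z \<in> Y" for z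
  proof -
    have "card (E z \<inter> (W \<union> \<Union>(E ` (Y - {z})))) \<le> card (E z \<inter> (W \<union> \<Union>(E ` (insert y Y - {z}))))"
    proof (rule card_mono)
      show "finite (E z \<inter> (W \<union> \<Union>(E ` (insert y Y - {z}))))"
        using finite_Un_attach[OF assms(1) _ assms(4), of "insert y Y - {z}"] assms(3) by blast
    qed auto
    also have "\<dots> \<le> b" using attachD(3)[OF assms(1)] z by blast
    finally have "card (E z \<inter> (W \<union> \<Union>(E ` (Y - {z})))) \<le> b" .
    moreover have "restrict E Y ` (Y - {z}) = E ` (Y - {z})" by auto
    ultimately show ?thesis using z by simp
  qed
  ultimately show ?thesis by (simp add: attach_def)
qed

text \<open>Exposing the edge at \<open>y\<close> last splits the weight into
  \<open>P ^ card X\<close> for the union \<open>X\<close> so far and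
  \<open>P ^ card (e - X)\<close> for the new points, so a uniform bound \<open>c\<close> on the sum
  over the last edge factors out. \<open>T\<close> can encode further restrictions on that
  edge.\<close>

lemma attach_insert_sum_le:
  assumes y: "y \<notin> Y" and fin: "finite Y" "finite W" and A: "A \<subseteq> attach b (insert y Y) W"
    and T: "\<And>E. E \<in> A \<Longrightarrow> E y \<in> T (W \<union> \<Union>(E ` Y))"
    and Tfin: "\<And>X. finite (T X)"
    and lam: "\<And>E. E \<in> attach b Y W \<Longrightarrow>
      (\<Sum>e\<in>T (W \<union> \<Union>(E ` Y)). P ^ card (e - (W \<union> \<Union>(E ` Y)))) \<le> c"
  shows "(\<Sum>E\<in>A. P ^ card (W \<union> \<Union>(E ` insert y Y))) \<le> (\<Sum>E\<in>attach b Y W. P ^ card (W \<union> \<Union>(E ` Y))) * c"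
proof -
  let ?X = "\<lambda>E. W \<union> \<Union>(E ` Y)"
  let ?phi = "\<lambda>E. (restrict E Y, E y)"
  let ?g = "\<lambda>(E, e). P ^ card (?X E) * P ^ card (e - ?X E)"
  have Xr: "?X (restrict E Y) = ?X E" for E by (intro arg_cong[of _ _ "\<lambda>Z. W \<union> \<Union>Z"]) auto
  have inj: "inj_on ?phi A"
  proof (rule inj_onI)
    fix E F assume EF: "E \<in> A" "F \<in> A" "?phi E = ?phi F"
    have "E \<in> Pi\<^sub>E (insert y Y) (\<lambda>y. {e \<in> long. y \<in> e})" "F \<in> Pi\<^sub>E (insert y Y) (\<lambda>y. {e \<in> long. y \<in> e})"
      using EF A by (auto simp: attach_def)
    moreover have "E z = F z" if "z \<in> insert y Y" for z
    proof (cases "z = y")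
      case False
      then have "z \<in> Y" using that by simp
      then show ?thesis using EF(3) by (metis prod.inject restrict_apply')
    qed (use EF(3) in simp)
    ultimately show "E = F" by (rule PiE_ext)
  qed
  have img: "?phi ` A \<subseteq> Sigma (attach b Y W) (\<lambda>E. T (?X E))"
  proof (rule image_subsetI)
    fix E assume E: "E \<in> A"
    then have "restrict E Y \<in> attach b Y W" using attach_restrict[OF _ y fin] A by blast
    then show "?phi E \<in> Sigma (attach b Y W) (\<lambda>E. T (?X E))" using T[OF E] unfolding mem_Sigma_iff Xr by blast
  qed
  have eq: "P ^ card (W \<union> \<Union>(E ` insert y Y)) = ?g (?phi E)" if E: "E \<in> A" for E
  proof -
    have Ea: "E \<in> attach b (insert y Y) W" using A E by blast
    have f: "finite (?X E)" by (rule finite_Un_attach[OF Ea _ fin(2)]) (use fin in auto)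
    have fe: "finite (E y)" using attachD(1)[OF Ea] ap_edges_finite_edge by blast
    have "W \<union> \<Union>(E ` insert y Y) = ?X E \<union> (E y - ?X E)" by auto
    then have "card (W \<union> \<Union>(E ` insert y Y)) = card (?X E) + card (E y - ?X E)"
      using f fe by (metis card_Un_disjoint Diff_disjoint finite_Diff)
    then show ?thesis by (simp add: Xr[unfolded restrict_def] Xr power_add)
  qed
  have "(\<Sum>E\<in>A. P ^ card (W \<union> \<Union>(E ` insert y Y))) = (\<Sum>E\<in>A. ?g (?phi E))"
    by (rule sum.cong) (use eq in auto)
  also have "\<dots> = sum ?g (?phi ` A)" using sum.reindex[OF inj, of ?g] by (simp add: o_def)
  also have "\<dots> \<le> sum ?g (Sigma (attach b Y W) (\<lambda>E. T (?X E)))"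
    using P fin Tfin by (intro sum_mono2[OF _ img]) auto
  also have "\<dots> = (\<Sum>E\<in>attach b Y W. \<Sum>e\<in>T (?X E). P ^ card (?X E) * P ^ card (e - ?X E))"
    using fin Tfin by (subst sum.Sigma) auto
  also have "\<dots> = (\<Sum>E\<in>attach b Y W. P ^ card (?X E) * (\<Sum>e\<in>T (?X E). P ^ card (e - ?X E)))"
    by (simp add: sum_distrib_left)
  also have "\<dots> \<le> (\<Sum>E\<in>attach b Y W. P ^ card (?X E) * c)"
    using P by (intro sum_mono mult_left_mono lam) auto
  finally show ?thesis by (simp add: sum_distrib_right)
qed

text \<open>The first term counts the at most \<open>q1 * n\<close> long edges through a vertex,
  with \<open>q1 - 1\<close> new points each; the second counts those pinned by one of
  \<open>M\<close> explored points, at most \<open>q1 * q1\<close> for each, with at least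
  \<open>q1 - b\<close> new points.\<close>

definition edge_wt :: "nat \<Rightarrow> nat \<Rightarrow> real" where
  "edge_wt b M = real (q1 * n) * P ^ (q1 - 1) + (if b \<le> 1 then 0 else real (M * q1\<^sup>2) * P ^ (q1 - b))"

lemma edge_wt_nonneg: "0 \<le> edge_wt b M"
  using P by (simp add: edge_wt_def)

lemma card_Diff_edge_ge:
  assumes "e \<in> long" "card (e \<inter> X) \<le> b"
  shows "P ^ card (e - X) \<le> P ^ (q1 - b)"
proof -
  have "card (e - X) = q1 - card (e \<inter> X)"
    using card_Diff_subset_Int[of e X] ap_edges_finite_edge[OF assms(1)] card_ap_edge[OF assms(1)] by simp
  then have "q1 - b \<le> card (e - X)" using assms(2) by linarith
  then show ?thesis using P by (intro power_decreasing) auto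
qed

lemma card_through_and_meeting_le:
  assumes "finite Z"
  shows "card {e \<in> long. y \<in> e \<and> (e - {y}) \<inter> Z \<noteq> {}} \<le> card Z * q1\<^sup>2"
proof -
  have "{e \<in> long. y \<in> e \<and> (e - {y}) \<inter> Z \<noteq> {}} \<subseteq> (\<Union>z\<in>Z - {y}. {e \<in> long. y \<in> e \<and> z \<in> e})" by auto
  then have "card {e \<in> long. y \<in> e \<and> (e - {y}) \<inter> Z \<noteq> {}} \<le> card (\<Union>z\<in>Z - {y}. {e \<in> long. y \<in> e \<and> z \<in> e})"
    using assms by (intro card_mono) auto
  also have "\<dots> \<le> (\<Sum>z\<in>Z - {y}. card {e \<in> long. y \<in> e \<and> z \<in> e})" using assms by (intro card_UN_le) auto
  also have "\<dots> \<le> (\<Sum>z\<in>Z - {y}. q1 * q1)" by (intro sum_mono card_ap_edges_through_two_le) auto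
  also have "\<dots> \<le> card Z * q1\<^sup>2" using card_mono[OF assms, of "Z - {y}"] by (simp add: power2_eq_square)
  finally show ?thesis .
qed

lemma touch_edge_sum_le:
  assumes "finite X" "card X \<le> M" "y \<in> X"
  shows "(\<Sum>e | e \<in> long \<and> y \<in> e \<and> 2 \<le> card (e \<inter> X) \<and> card (e \<inter> X) \<le> b. P ^ card (e - X)) \<le> real (M * q1\<^sup>2) * P ^ (q1 - b)"
proof (rule sum_le_card_times)
  show "finite {e \<in> long. y \<in> e \<and> (e - {y}) \<inter> X \<noteq> {}}" by simp
  show "{e. e \<in> long \<and> y \<in> e \<and> 2 \<le> card (e \<inter> X) \<and> card (e \<inter> X) \<le> b} \<subseteq> {e \<in> long. y \<in> e \<and> (e - {y}) \<inter> X \<noteq> {}}"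
  proof clarify
    fix e assume e: "2 \<le> card (e \<inter> X)" "(e - {y}) \<inter> X = {}"
    then have "e \<inter> X \<subseteq> {y}" by blast
    then have "card (e \<inter> X) \<le> 1" using card_mono[of "{y}"] by simp
    then show False using e by simp
  qed
  show "card {e \<in> long. y \<in> e \<and> (e - {y}) \<inter> X \<noteq> {}} \<le> M * q1\<^sup>2"
    using card_through_and_meeting_le[OF assms(1), of y] assms(2) by (meson le_trans mult_le_mono1)
qed (use card_Diff_edge_ge P in auto)

lemma pin_edge_sum_le:
  assumes "finite Z" "card Z \<le> M"
  shows "(\<Sum>e | e \<in> long \<and> y \<in> e \<and> (e - {y}) \<inter> Z \<noteq> {} \<and> card (e \<inter> X) \<le> b. P ^ card (e - X)) \<le> real (M * q1\<^sup>2) * P ^ (q1 - b)"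
proof (rule sum_le_card_times)
  show "card {e \<in> long. y \<in> e \<and> (e - {y}) \<inter> Z \<noteq> {}} \<le> M * q1\<^sup>2"
    using card_through_and_meeting_le[OF assms(1), of y] assms(2) by (meson le_trans mult_le_mono1)
qed (use card_Diff_edge_ge P in auto)

lemma edge_sum_le:
  assumes "finite X" "card X \<le> M" "y \<in> X"
  shows "(\<Sum>e | e \<in> long \<and> y \<in> e \<and> card (e \<inter> X) \<le> b. P ^ card (e - X)) \<le> edge_wt b M"
proof -
  let ?A = "{e. e \<in> long \<and> y \<in> e \<and> card (e \<inter> X) \<le> min b 1}"
  let ?B = "{e. e \<in> long \<and> y \<in> e \<and> 2 \<le> card (e \<inter> X) \<and> card (e \<inter> X) \<le> b}"
  have "{e. e \<in> long \<and> y \<in> e \<and> card (e \<inter> X) \<le> b} = ?A \<union> ?B" "?A \<inter> ?B = {}" by auto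
  then have split: "(\<Sum>e | e \<in> long \<and> y \<in> e \<and> card (e \<inter> X) \<le> b. P ^ card (e - X))
     = (\<Sum>e\<in>?A. P ^ card (e - X)) + (\<Sum>e\<in>?B. P ^ card (e - X))"
    by (simp add: sum.union_disjoint)
  have "(\<Sum>e\<in>?A. P ^ card (e - X)) \<le> real (q1 * n) * P ^ (q1 - 1)"
  proof (rule sum_le_card_times)
    show "card {e \<in> long. y \<in> e} \<le> q1 * n" using q12 q2 by (intro card_ap_edges_through_le) simp
  qed (use card_Diff_edge_ge[of _ X 1] P in auto)
  moreover have "(\<Sum>e\<in>?B. P ^ card (e - X)) \<le> (if b \<le> 1 then 0 else real (M * q1\<^sup>2) * P ^ (q1 - b))"
  proof (cases "b \<le> 1")
    case True
    then have "?B = {}" by auto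
    then show ?thesis using True by (simp only: sum.empty if_True)
  qed (use touch_edge_sum_le[OF assms] in simp)
  ultimately show ?thesis unfolding split edge_wt_def by linarith
qed

lemma attach_sum_le:
  assumes "finite Y" "finite W" "Y \<subseteq> W" "card W + q1 * card Y \<le> M"
  shows "(\<Sum>E\<in>attach b Y W. P ^ card (W \<union> \<Union>(E ` Y))) \<le> P ^ card W * edge_wt b M ^ card Y"
  using assms
proof (induction Y rule: finite_induct)
  case empty
  have "attach b {} W \<subseteq> {\<lambda>_. undefined}" by (auto simp: attach_def)
  then have "(\<Sum>E\<in>attach b {} W. P ^ card (W \<union> \<Union>(E ` {}))) \<le> (\<Sum>E\<in>{\<lambda>_::nat. undefined::nat set}. P ^ card (W \<union> \<Union>(E ` {})))"
    using P by (intro sum_mono2) auto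
  then show ?case by simp
next
  case (insert y Y)
  let ?T = "\<lambda>X. {e. e \<in> long \<and> y \<in> e \<and> card (e \<inter> X) \<le> b}"
  have "(\<Sum>E\<in>attach b (insert y Y) W. P ^ card (W \<union> \<Union>(E ` insert y Y)))
     \<le> (\<Sum>E\<in>attach b Y W. P ^ card (W \<union> \<Union>(E ` Y))) * edge_wt b M"
  proof (rule attach_insert_sum_le[where T = ?T])
    fix E assume E: "E \<in> attach b (insert y Y) W"
    have "insert y Y - {y} = Y" using insert.hyps by auto
    then show "E y \<in> ?T (W \<union> \<Union>(E ` Y))" using attachD[OF E, of y] by simp
  next
    fix E assume E: "E \<in> attach b Y W"
    have "card (W \<union> \<Union>(E ` Y)) \<le> M"
      using card_Un_attach_le[OF E] insert by (simp add: distrib_left)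
    then show "(\<Sum>e\<in>?T (W \<union> \<Union>(E ` Y)). P ^ card (e - (W \<union> \<Union>(E ` Y)))) \<le> edge_wt b M"
      using insert.prems finite_Un_attach[OF E insert.hyps(1) insert.prems(1)] by (intro edge_sum_le) auto
  qed (use insert in auto)
  also have "\<dots> \<le> (P ^ card W * edge_wt b M ^ card Y) * edge_wt b M"
    using insert by (intro mult_right_mono insert.IH edge_wt_nonneg) (auto simp: distrib_left)
  finally show ?case using insert by (simp add: mult.assoc mult.commute mult.left_commute)
qed

text \<open>A union bound over the vertex \<open>y\<close> carrying the special edge, which is then
  exposed last. \<open>T\<close> receives \<open>y\<close> and the remaining union, since being
  special depends on both.\<close>

lemma attach_special_sum_le:
  assumes "finite Y" "finite W" "Y \<subseteq> W" "card W + q1 * card Y \<le> M" "0 \<le> c"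
    and T: "\<And>X. finite (T X)" "\<And>y E. y \<in> Y \<Longrightarrow> E \<in> attach b (Y - {y}) W \<Longrightarrow>
      (\<Sum>e | e \<in> long \<and> y \<in> e \<and> e \<in> T (y, W \<union> \<Union>(E ` (Y - {y}))) \<and> card (e \<inter> (W \<union> \<Union>(E ` (Y - {y})))) \<le> b.
         P ^ card (e - (W \<union> \<Union>(E ` (Y - {y}))))) \<le> c"
  shows "(\<Sum>E | E \<in> attach b Y W \<and> (\<exists>y\<in>Y. E y \<in> T (y, W \<union> \<Union>(E ` (Y - {y})))). P ^ card (W \<union> \<Union>(E ` Y)))
    \<le> real (card Y) * (P ^ card W * edge_wt b M ^ (card Y - 1) * c)"
proof -
  let ?A = "\<lambda>y. {E. E \<in> attach b Y W \<and> E y \<in> T (y, W \<union> \<Union>(E ` (Y - {y})))}"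
  have A: "(\<Sum>E\<in>?A y. P ^ card (W \<union> \<Union>(E ` Y))) \<le> P ^ card W * edge_wt b M ^ (card Y - 1) * c" if y: "y \<in> Y" for y
  proof -
    have Y: "insert y (Y - {y}) = Y" using y by auto
    let ?T = "\<lambda>X. {e. e \<in> long \<and> y \<in> e \<and> e \<in> T (y, X) \<and> card (e \<inter> X) \<le> b}"
    have "(\<Sum>E\<in>?A y. P ^ card (W \<union> \<Union>(E ` insert y (Y - {y}))))
       \<le> (\<Sum>E\<in>attach b (Y - {y}) W. P ^ card (W \<union> \<Union>(E ` (Y - {y})))) * c"
    proof (rule attach_insert_sum_le[where T = ?T])
      show "?A y \<subseteq> attach b (insert y (Y - {y})) W" unfolding Y by blast
    next
      fix E assume "E \<in> ?A y"
      then show "E y \<in> ?T (W \<union> \<Union>(E ` (Y - {y})))" using attachD[of E b Y W y] y by simp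
    qed (use assms y in auto)
    also have "\<dots> \<le> (P ^ card W * edge_wt b M ^ card (Y - {y})) * c"
    proof (intro mult_right_mono attach_sum_le)
      have "card W + q1 * card (Y - {y}) \<le> card W + q1 * card Y" using assms(1) by (simp add: card_mono)
      then show "card W + q1 * card (Y - {y}) \<le> M" using assms(4) by linarith
    qed (use assms in auto)
    finally show ?thesis using y assms(1) by (simp only: Y card_Diff_singleton)
  qed
  have "{E. E \<in> attach b Y W \<and> (\<exists>y\<in>Y. E y \<in> T (y, W \<union> \<Union>(E ` (Y - {y}))))} = (\<Union>y\<in>Y. ?A y)" by blast
  then have "(\<Sum>E | E \<in> attach b Y W \<and> (\<exists>y\<in>Y. E y \<in> T (y, W \<union> \<Union>(E ` (Y - {y})))). P ^ card (W \<union> \<Union>(E ` Y)))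
    \<le> (\<Sum>y\<in>Y. \<Sum>E\<in>?A y. P ^ card (W \<union> \<Union>(E ` Y)))"
    using assms(1) P by (simp only:) (intro sum_UN_le, auto)
  also have "\<dots> \<le> (\<Sum>y\<in>Y. P ^ card W * edge_wt b M ^ (card Y - 1) * c)" by (intro sum_mono A)
  finally show ?thesis by simp
qed

end

lemma card_UN_le_mult:
  assumes "finite I" "card I \<le> m" "\<And>i. i \<in> I \<Longrightarrow> card (A i) \<le> c"
  shows "card (\<Union>i\<in>I. A i) \<le> m * c"
proof -
  have "card (\<Union>i\<in>I. A i) \<le> (\<Sum>i\<in>I. card (A i))" using assms(1) by (rule card_UN_le)
  also have "\<dots> \<le> (\<Sum>i\<in>I. c)" using assms(3) by (rule sum_mono)
  also have "\<dots> \<le> m * c" using assms(2) by simp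
  finally show ?thesis .
qed

text \<open>The scale \<open>y = n powr (- 1 / (q1 * (q2 - 1)))\<close> makes all relevant exponents integral.\<close>
locale ap_scaled = ap_pair +
  fixes y c :: real
  assumes y: "0 < y" "y \<le> 1" and c: "0 < c" "c \<le> 1"
    and ny: "real n * y ^ (q1 * (q2 - 1)) = 1" and Py: "P = c * y ^ q2"
begin

text \<open>Each factor \<open>n\<close> consumes \<open>q1 * (q2 - 1)\<close> factors
  \<open>y\<close>. All later estimates thereby become inequalities between natural
  exponents.\<close>

lemma n_pow_y_pow_le:
  assumes "i * (q1 * (q2 - 1)) + k \<le> j"
  shows "real n ^ i * y ^ j \<le> y ^ k"
proof -
  have "y ^ j \<le> y ^ (i * (q1 * (q2 - 1)) + k)" using assms y by (intro power_decreasing) auto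
  then have "real n ^ i * y ^ j \<le> real n ^ i * y ^ (i * (q1 * (q2 - 1)) + k)" by (intro mult_left_mono) auto
  also have "\<dots> = (real n * y ^ (q1 * (q2 - 1))) ^ i * y ^ k"
    by (simp add: power_add power_mult power_mult_distrib mult.commute[of i] mult.assoc)
  finally show ?thesis using ny by simp
qed

lemma P_le: "P \<le> y ^ q2"
  unfolding Py using c y by (simp add: mult_left_le_one_le)

lemma P_pow_le: "P ^ k \<le> y ^ (q2 * k)"
  using power_mono[OF P_le, of k] P by (simp add: power_mult)

text \<open>The main term has exponent \<open>q2 * (q1 - 1) - q1 * (q2 - 1) = q1 - q2\<close>. Edges
  with up to \<open>q2\<close> contacts still have at least \<open>q1 - q2\<close> new points, so
  they are no more frequent once \<open>M\<close> is absorbed.\<close>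

lemma edge_wt_le:
  assumes "b \<le> q2" "1 \<le> M"
  shows "edge_wt b M \<le> real (2 * M * q1\<^sup>2) * y ^ (q1 - q2)"
proof -
  have "real n * P ^ (q1 - 1) \<le> real n ^ 1 * y ^ (q2 * (q1 - 1))"
    using P_pow_le[of "q1 - 1"] by (simp add: mult_left_mono)
  also have "\<dots> \<le> y ^ (q1 - q2)"
    using q12 q2 by (intro n_pow_y_pow_le) (simp add: diff_mult_distrib2 mult.commute)
  finally have "real q1 * (real n * P ^ (q1 - 1)) \<le> real q1 * y ^ (q1 - q2)" by (rule mult_left_mono) simp
  also have "\<dots> \<le> real (M * q1\<^sup>2) * y ^ (q1 - q2)"
  proof (rule mult_right_mono)
    have "q1 * 1 \<le> q1\<^sup>2 * M" unfolding power2_eq_square mult.assoc using assms(2) q12 by (intro mult_le_mono) auto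
    then show "real q1 \<le> real (M * q1\<^sup>2)" by (metis of_nat_mono mult.commute mult.right_neutral)
  qed (use y in auto)
  finally have 1: "real (q1 * n) * P ^ (q1 - 1) \<le> real (M * q1\<^sup>2) * y ^ (q1 - q2)" by (simp add: mult.assoc)
  have "P ^ (q1 - b) \<le> y ^ (q2 * (q1 - b))" by (rule P_pow_le)
  also have "\<dots> \<le> y ^ (q1 - q2)"
  proof (rule power_decreasing)
    have "1 * (q1 - q2) \<le> q2 * (q1 - b)" using assms(1) q2 by (intro mult_le_mono) auto
    then show "q1 - q2 \<le> q2 * (q1 - b)" by simp
  qed (use y in auto)
  finally have "real (M * q1\<^sup>2) * P ^ (q1 - b) \<le> real (M * q1\<^sup>2) * y ^ (q1 - q2)" by (rule mult_left_mono) simp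
  then have "(if b \<le> 1 then 0 else real (M * q1\<^sup>2) * P ^ (q1 - b)) \<le> real (M * q1\<^sup>2) * y ^ (q1 - q2)"
    using y by auto
  with 1 show ?thesis unfolding edge_wt_def by (simp add: algebra_simps)
qed

lemma edge_wt_pow_le:
  assumes "b \<le> q2" "1 \<le> M"
  shows "edge_wt b M ^ r \<le> real (2 * M * q1\<^sup>2) ^ r * y ^ ((q1 - q2) * r)"
  using power_mono[OF edge_wt_le[OF assms] edge_wt_nonneg, of r] by (simp add: power_mult power_mult_distrib)

lemma attach_family_sum_le:
  assumes I: "finite I" "card I \<le> N"
    and WY: "\<And>W Y. (W, Y) \<in> I \<Longrightarrow> finite W \<and> Y \<subseteq> W \<and> card W + q1 * card Y \<le> M \<and> P ^ card W * edge_wt b M ^ card Y \<le> z"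
    and z: "0 \<le> z"
  shows "(\<Sum>X\<in>(\<Union>(W, Y)\<in>I. (\<lambda>E. W \<union> \<Union>(E ` Y)) ` attach b Y W). P ^ card X) \<le> real N * z"
proof -
  have fin: "finite Y" if "(W, Y) \<in> I" for W Y using WY[OF that] finite_subset by blast
  have "(\<Sum>X\<in>(\<Union>i\<in>I. (\<lambda>E. fst i \<union> \<Union>(E ` snd i)) ` attach b (snd i) (fst i)). P ^ card X)
    \<le> (\<Sum>i\<in>I. \<Sum>X\<in>(\<lambda>E. fst i \<union> \<Union>(E ` snd i)) ` attach b (snd i) (fst i). P ^ card X)"
    using I P by (intro sum_UN_le) (auto intro!: finite_imageI finite_attach fin)
  also have "\<dots> \<le> real N * z"
  proof (rule sum_le_card_times[OF I(1) subset_refl I(2) _ z])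
    fix i assume i: "i \<in> I"
    obtain W Y where WYi: "i = (W, Y)" by (cases i)
    have "(\<Sum>X\<in>(\<lambda>E. W \<union> \<Union>(E ` Y)) ` attach b Y W. P ^ card X) \<le> sum ((\<lambda>X. P ^ card X) \<circ> (\<lambda>E. W \<union> \<Union>(E ` Y))) (attach b Y W)"
      using P fin i WYi by (intro sum_image_le finite_attach) auto
    also have "\<dots> \<le> P ^ card W * edge_wt b M ^ card Y"
      using WY[of W Y] fin[of W Y] i WYi attach_sum_le[of Y W M b] by (simp add: o_def)
    also have "\<dots> \<le> z" using WY[of W Y] i WYi by simp
    finally show "(\<Sum>X\<in>(\<lambda>E. fst i \<union> \<Union>(E ` snd i)) ` attach b (snd i) (fst i). P ^ card X) \<le> z"
      using WYi by simp
  qed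
  finally show ?thesis by (simp add: case_prod_beta')
qed

section \<open>Tangled clusters\<close>

definition clusters :: "nat set \<Rightarrow> (nat \<Rightarrow> nat set) set" where
  "clusters s = {E. \<forall>u\<in>s. E u \<in> long \<and> E u \<inter> s = {u}}"

definition tangled :: "nat set set" where
  "tangled = {s \<union> \<Union>(E ` s) | s E. s \<in> short \<and> E \<in> clusters s \<and> (\<exists>u\<in>s. \<exists>v\<in>s. u \<noteq> v \<and> E u \<inter> E v \<noteq> {})}"

text \<open>If no two progressions of a tangled cluster share two points, one crossing pair is exposed first;
  otherwise all those sharing two points with another one, to which \<open>private_ap_union_card\<close> applies.\<close>
definition single_starts :: "(nat set \<times> nat set) set" where
  "single_starts = {(s \<union> e \<union> f, s - {u, v}) | s u v e f. s \<in> short \<and> u \<in> s \<and> v \<in> s \<and> e \<in> long \<and> f \<in> long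
     \<and> e \<inter> s = {u} \<and> f \<inter> s = {v} \<and> u \<noteq> v \<and> card (e \<inter> f) = 1}"

definition double_starts :: "(nat set \<times> nat set) set" where
  "double_starts = {(s \<union> \<Union>(F ` G), s - G) | s F G. s \<in> short \<and> G \<subseteq> s \<and> 2 \<le> card G
     \<and> F \<in> Pi\<^sub>E G (\<lambda>u. {e \<in> long. e \<inter> s = {u} \<and> (\<exists>v\<in>s. v \<noteq> u \<and> (\<exists>f\<in>long. v \<in> f \<and> 2 \<le> card (e \<inter> f)))})}"

lemma short_finite: "s \<in> short \<Longrightarrow> finite s" and long_finite: "s \<in> long \<Longrightarrow> finite s"
  by (auto intro: ap_edges_finite_edge)

lemma short_card: "s \<in> short \<Longrightarrow> card s = q2" and long_card: "s \<in> long \<Longrightarrow> card s = q1"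
  by (auto intro: card_ap_edge)

lemma cluster_meet_rest_le:
  assumes s: "s \<in> short" and E: "E \<in> clusters s" and w: "w \<in> s"
    and le1: "\<And>z. z \<in> s \<Longrightarrow> z \<noteq> w \<Longrightarrow> card (E w \<inter> E z) \<le> 1"
  shows "card (E w \<inter> (s \<union> \<Union>(E ` (s - {w})))) \<le> q2"
proof -
  have "E w \<inter> (s \<union> \<Union>(E ` (s - {w}))) \<subseteq> {w} \<union> (\<Union>z\<in>s - {w}. E w \<inter> E z)"
    using E w unfolding clusters_def by blast
  moreover have "finite ({w} \<union> (\<Union>z\<in>s - {w}. E w \<inter> E z))"
    using E w short_finite[OF s] long_finite unfolding clusters_def by blast
  ultimately have "card (E w \<inter> (s \<union> \<Union>(E ` (s - {w})))) \<le> card ({w} \<union> (\<Union>z\<in>s - {w}. E w \<inter> E z))"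
    by (intro card_mono)
  also have "\<dots> \<le> card {w} + card (\<Union>z\<in>s - {w}. E w \<inter> E z)" by (rule card_Un_le)
  also have "card (\<Union>z\<in>s - {w}. E w \<inter> E z) \<le> card (s - {w}) * 1"
    using short_finite[OF s] le1 by (intro card_UN_le_mult) auto
  also have "card (s - {w}) = q2 - 1" using short_card[OF s] w short_finite[OF s] by simp
  finally show ?thesis using q2 by simp
qed

lemma cluster_attach:
  assumes s: "s \<in> short" and E: "E \<in> clusters s" and H: "H \<subseteq> s"
    and le1: "\<And>w z. w \<in> s - H \<Longrightarrow> z \<in> s \<Longrightarrow> z \<noteq> w \<Longrightarrow> card (E w \<inter> E z) \<le> 1"
  shows "restrict E (s - H) \<in> attach q2 (s - H) (s \<union> \<Union>(E ` H))"
proof -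
  have "restrict E (s - H) \<in> Pi\<^sub>E (s - H) (\<lambda>y. {e \<in> long. y \<in> e})" using E by (auto simp: clusters_def)
  moreover have "card (restrict E (s - H) w \<inter> (s \<union> \<Union>(E ` H) \<union> \<Union>(restrict E (s - H) ` (s - H - {w})))) \<le> q2"
    if w: "w \<in> s - H" for w
  proof -
    have "restrict E (s - H) ` (s - H - {w}) = E ` (s - H - {w})" by auto
    moreover have "s \<union> \<Union>(E ` H) \<union> \<Union>(E ` (s - H - {w})) = s \<union> \<Union>(E ` (s - {w}))" using w H by auto
    moreover have "card (E w \<inter> (s \<union> \<Union>(E ` (s - {w})))) \<le> q2"
      using w by (intro cluster_meet_rest_le[OF s E] le1) auto
    ultimately show ?thesis using w by simp
  qed
  ultimately show ?thesis by (simp add: attach_def)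
qed

lemma tangled_subset:
  "tangled \<subseteq> (\<Union>(W, Y)\<in>single_starts \<union> double_starts. (\<lambda>E. W \<union> \<Union>(E ` Y)) ` attach q2 Y W)"
proof
  fix X assume "X \<in> tangled"
  then obtain s E u0 v0 where s: "s \<in> short" and E: "E \<in> clusters s" and uv0: "u0 \<in> s" "v0 \<in> s" "u0 \<noteq> v0" "E u0 \<inter> E v0 \<noteq> {}"
    and X: "X = s \<union> \<Union>(E ` s)" unfolding tangled_def by blast
  define G where "G = {u \<in> s. \<exists>v\<in>s. v \<noteq> u \<and> 2 \<le> card (E u \<inter> E v)}"
  \<comment> \<open>Any \<open>H\<close> containing \<open>G\<close> may be exposed first: an edge
    outside \<open>H\<close> meets each other edge in at most one point, hence everything else in at
    most \<open>q2\<close> points, its own vertex included.\<close>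
  have *: "X \<in> (\<lambda>F. (s \<union> \<Union>(E ` H)) \<union> \<Union>(F ` (s - H))) ` attach q2 (s - H) (s \<union> \<Union>(E ` H))"
    if H: "H \<subseteq> s" "G \<subseteq> H" for H
  proof (rule image_eqI)
    show "restrict E (s - H) \<in> attach q2 (s - H) (s \<union> \<Union>(E ` H))"
    proof (rule cluster_attach[OF s E H(1)])
      fix w z assume "w \<in> s - H" "z \<in> s" "z \<noteq> w"
      then have "\<not> 2 \<le> card (E w \<inter> E z)" using H(2) unfolding G_def by blast
      then show "card (E w \<inter> E z) \<le> 1" by simp
    qed
    have "restrict E (s - H) ` (s - H) = E ` (s - H)" by auto
    then show "X = s \<union> \<Union>(E ` H) \<union> \<Union>(restrict E (s - H) ` (s - H))" using H(1) X by auto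
  qed
  show "X \<in> (\<Union>(W, Y)\<in>single_starts \<union> double_starts. (\<lambda>E. W \<union> \<Union>(E ` Y)) ` attach q2 Y W)"
  proof (cases "G = {}")
    case True
    have "\<not> 2 \<le> card (E u0 \<inter> E v0)"
    proof
      assume "2 \<le> card (E u0 \<inter> E v0)"
      then have "u0 \<in> G" unfolding G_def mem_Collect_eq using uv0(1,2,3) by metis
      then show False using True by simp
    qed
    moreover have "finite (E u0)" using E uv0 long_finite unfolding clusters_def by blast
    ultimately have "card (E u0 \<inter> E v0) = 1"
      using uv0(4) by (metis One_nat_def Suc_leI card_gt_0_iff finite_Int le_antisym not_less_eq_eq numeral_2_eq_2)
    then have "(s \<union> E u0 \<union> E v0, s - {u0, v0}) \<in> single_starts"
    proof -
      have "E u0 \<in> long" "E v0 \<in> long" "E u0 \<inter> s = {u0}" "E v0 \<inter> s = {v0}"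
        using E uv0(1,2) by (simp_all add: clusters_def)
      then show ?thesis unfolding single_starts_def mem_Collect_eq
        using s uv0(1-3) \<open>card (E u0 \<inter> E v0) = 1\<close> by (intro exI conjI) (rule refl | assumption)+
    qed
    moreover have "X \<in> (\<lambda>F. (s \<union> E u0 \<union> E v0) \<union> \<Union>(F ` (s - {u0, v0}))) ` attach q2 (s - {u0, v0}) (s \<union> E u0 \<union> E v0)"
      using *[of "{u0, v0}"] uv0 True by (simp add: Un_assoc)
    ultimately show ?thesis by (intro UN_I[of "(s \<union> E u0 \<union> E v0, s - {u0, v0})"]) simp_all
  next
    case False
    then obtain u v where uv: "u \<in> s" "v \<in> s" "v \<noteq> u" "2 \<le> card (E u \<inter> E v)" unfolding G_def by blast
    then have "{u, v} \<subseteq> G" unfolding G_def using uv by (auto simp: Int_commute)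
    moreover have "finite G" using short_finite[OF s] by (simp add: G_def)
    ultimately have "2 \<le> card G" using card_mono[of G "{u, v}"] uv(3) by auto
    moreover have "restrict E G \<in> Pi\<^sub>E G (\<lambda>u. {e \<in> long. e \<inter> s = {u} \<and> (\<exists>v\<in>s. v \<noteq> u \<and> (\<exists>f\<in>long. v \<in> f \<and> 2 \<le> card (e \<inter> f)))})"
      using E unfolding G_def clusters_def by (auto; blast)
    moreover have "restrict E G ` G = E ` G" by auto
    moreover have "G \<subseteq> s" by (auto simp: G_def)
    ultimately have "(s \<union> \<Union>(E ` G), s - G) \<in> double_starts"
      using s unfolding double_starts_def mem_Collect_eq
      by (intro exI[of _ s] exI[of _ "restrict E G"] exI[of _ G]) simp
    then show ?thesis using *[OF \<open>G \<subseteq> s\<close> subset_refl] by (intro UN_I[of "(s \<union> \<Union>(E ` G), s - G)"]) simp_all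
  qed
qed

text \<open>A common bound for \<open>card W + q1 * card Y\<close> over both kinds of starts:
  \<open>W\<close> has at most \<open>q2 + 2 * q1\<close> or \<open>q2 + q1 * q2\<close> points, and
  the edges still to be attached add at most \<open>q1 * q2\<close>.\<close>

definition cluster_size :: nat where
  "cluster_size = q2 + 2 * q1 + 2 * (q1 * q2)"

definition tangle_const :: real where
  "tangle_const = real (2 * cluster_size * q1\<^sup>2) ^ q2"

lemma cluster_size_pos: "1 \<le> cluster_size"
  using q12 by (simp add: cluster_size_def)

text \<open>Each explored point is worth \<open>q2\<close> factors \<open>y\<close> and each
  attached edge \<open>q1 - q2\<close>; \<open>tangle_const\<close> absorbs the constants of at most
  \<open>q2\<close> attached edges.\<close>

lemma weight_le_scale:
  assumes "r \<le> q2" "j \<le> q2 * k + (q1 - q2) * r"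
  shows "P ^ k * edge_wt q2 cluster_size ^ r \<le> tangle_const * y ^ j"
proof -
  have "P ^ k * edge_wt q2 cluster_size ^ r \<le> y ^ (q2 * k) * (real (2 * cluster_size * q1\<^sup>2) ^ r * y ^ ((q1 - q2) * r))"
    using P y by (intro mult_mono P_pow_le edge_wt_pow_le cluster_size_pos zero_le_power edge_wt_nonneg) auto
  also have "\<dots> = real (2 * cluster_size * q1\<^sup>2) ^ r * y ^ (q2 * k + (q1 - q2) * r)"
    by (simp add: power_add)
  also have "\<dots> \<le> tangle_const * y ^ j"
  proof (rule mult_mono)
    have "1 \<le> 2 * cluster_size * q1\<^sup>2" using cluster_size_pos q12 by (simp add: Suc_le_eq)
    then have "1 \<le> real (2 * cluster_size * q1\<^sup>2)" by linarith
    then show "real (2 * cluster_size * q1\<^sup>2) ^ r \<le> tangle_const"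
      unfolding tangle_const_def using assms(1) by (rule power_increasing[rotated])
    show "y ^ (q2 * k + (q1 - q2) * r) \<le> y ^ j" using assms(2) y by (intro power_decreasing) auto
  qed (use y in \<open>auto simp: tangle_const_def\<close>)
  finally show ?thesis .
qed

lemma n_scale_eq: "real n ^ i * y ^ (i * (q1 * (q2 - 1)) + 1) \<le> y"
  using n_pow_y_pow_le[of i 1 "i * (q1 * (q2 - 1)) + 1"] by simp

lemma card_short_le: "card short \<le> n * n"
  using q2 by (intro card_ap_edges_le) simp

lemma single_startsE:
  assumes "i \<in> single_starts"
  obtains s u v e f where "i = (s \<union> e \<union> f, s - {u, v})" "s \<in> short" "u \<in> s" "v \<in> s" "e \<in> long" "f \<in> long"
    "e \<inter> s = {u}" "f \<inter> s = {v}" "u \<noteq> v" "card (e \<inter> f) = 1"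
  using assms unfolding single_starts_def mem_Collect_eq by (elim exE conjE) (rule that)

lemma double_startsE:
  assumes "i \<in> double_starts"
  obtains s F G where "i = (s \<union> \<Union>(F ` G), s - G)" "s \<in> short" "G \<subseteq> s" "2 \<le> card G"
    "F \<in> Pi\<^sub>E G (\<lambda>u. {e \<in> long. e \<inter> s = {u} \<and> (\<exists>v\<in>s. v \<noteq> u \<and> (\<exists>f\<in>long. v \<in> f \<and> 2 \<le> card (e \<inter> f)))})"
  using assms unfolding double_starts_def mem_Collect_eq by (elim exE conjE) (rule that)

lemma single_starts_subset:
  "single_starts \<subseteq> (\<Union>s\<in>short. \<Union>u\<in>s. \<Union>v\<in>s. \<Union>e\<in>{e \<in> long. u \<in> e}.
     (\<lambda>f. (s \<union> e \<union> f, s - {u, v})) ` {f \<in> long. v \<in> f \<and> (f - {v}) \<inter> e \<noteq> {}})"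
proof
  fix i assume "i \<in> single_starts"
  then obtain s u v e f where *: "i = (s \<union> e \<union> f, s - {u, v})" "s \<in> short" "u \<in> s" "v \<in> s" "e \<in> long" "f \<in> long"
    "e \<inter> s = {u}" "f \<inter> s = {v}" "u \<noteq> v" "card (e \<inter> f) = 1" by (rule single_startsE)
  have "e \<inter> f \<noteq> {}" using *(10) by auto
  moreover have "v \<notin> e"
  proof
    assume "v \<in> e"
    then have "v \<in> e \<inter> s" using *(4) by simp
    then show False using *(7,9) by simp
  qed
  ultimately have "(f - {v}) \<inter> e \<noteq> {}" by blast
  moreover have "u \<in> e" "v \<in> f" using *(7,8) by blast+
  ultimately show "i \<in> (\<Union>s\<in>short. \<Union>u\<in>s. \<Union>v\<in>s. \<Union>e\<in>{e \<in> long. u \<in> e}.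
     (\<lambda>f. (s \<union> e \<union> f, s - {u, v})) ` {f \<in> long. v \<in> f \<and> (f - {v}) \<inter> e \<noteq> {}})"
    using * by (intro UN_I[OF *(2)] UN_I[OF *(3)] UN_I[OF *(4)] UN_I[of e] image_eqI[of _ _ f]) (use *(1) in simp_all)
qed

lemma finite_single_starts: "finite single_starts"
  by (rule finite_subset[OF single_starts_subset]) (auto intro!: finite_UN_I dest: short_finite)

text \<open>There are \<open>n * n\<close> choices for \<open>s\<close> and \<open>q1 * n\<close>
  for \<open>e\<close>; then \<open>f\<close> joins \<open>v\<close> to one of the \<open>q1\<close>
  points of \<open>e\<close>, so no further \<open>n\<close> arises.\<close>

lemma card_single_starts_le:
  "card single_starts \<le> n ^ 3 * (q2 * q2 * q1 * (q1 * q1\<^sup>2))"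
proof -
  have 1: "card ((\<lambda>f. (s \<union> e \<union> f, s - {u, v})) ` {f \<in> long. v \<in> f \<and> (f - {v}) \<inter> e \<noteq> {}}) \<le> q1 * q1\<^sup>2"
    if "e \<in> long" for s u v e
  proof -
    have "card {f \<in> long. v \<in> f \<and> (f - {v}) \<inter> e \<noteq> {}} \<le> card e * q1\<^sup>2"
      using that long_finite by (intro card_through_and_meeting_le)
    then show ?thesis using card_image_le[of "{f \<in> long. v \<in> f \<and> (f - {v}) \<inter> e \<noteq> {}}" "\<lambda>f. (s \<union> e \<union> f, s - {u, v})"]
      long_card[OF that] by simp
  qed
  have 2: "card {e \<in> long. u \<in> e} \<le> q1 * n" for u using q12 q2 by (intro card_ap_edges_through_le) simp
  have "card single_starts \<le> card (\<Union>s\<in>short. \<Union>u\<in>s. \<Union>v\<in>s. \<Union>e\<in>{e \<in> long. u \<in> e}.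
     (\<lambda>f. (s \<union> e \<union> f, s - {u, v})) ` {f \<in> long. v \<in> f \<and> (f - {v}) \<inter> e \<noteq> {}})"
    by (intro card_mono single_starts_subset) (auto intro!: finite_UN_I dest: short_finite)
  also have "\<dots> \<le> (n * n) * (q2 * (q2 * (q1 * n * (q1 * q1\<^sup>2))))"
    by (intro card_UN_le_mult card_short_le 1 2 short_finite) (auto simp: short_card)
  finally show ?thesis by (simp add: algebra_simps eval_nat_numeral)
qed

text \<open>With \<open>card W = q2 + 2 * q1 - 3\<close> and \<open>card Y = q2 - 2\<close> the
  available exponent is \<open>3 * q1 * q2 - 2 * q1 - q2\<close>. It exceeds the cost
  \<open>3 * q1 * (q2 - 1)\<close> of the starts by \<open>q1 - q2\<close>, so
  \<open>q2 < q1\<close> is just enough for a spare factor \<open>y\<close>.\<close>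

lemma single_starts_weight:
  assumes "(W, Y) \<in> single_starts"
  shows "finite W \<and> Y \<subseteq> W \<and> card W + q1 * card Y \<le> cluster_size
    \<and> P ^ card W * edge_wt q2 cluster_size ^ card Y \<le> tangle_const * y ^ (3 * (q1 * (q2 - 1)) + 1)"
proof -
  obtain s u v e f where WY: "(W, Y) = (s \<union> e \<union> f, s - {u, v})" and **: "s \<in> short" "u \<in> s" "v \<in> s" "e \<in> long" "f \<in> long"
    "e \<inter> s = {u}" "f \<inter> s = {v}" "u \<noteq> v" "card (e \<inter> f) = 1"
    using assms by (rule single_startsE)
  have W: "W = s \<union> e \<union> f" "Y = s - {u, v}" using WY by simp_all
  note * = W **
  have fin: "finite s" "finite e" "finite f" using * by (auto dest: short_finite long_finite)
  have cards: "card s = q2" "card e = q1" "card f = q1" using * by (auto dest: short_card long_card)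
  obtain z where z: "e \<inter> f = {z}" using *(11) card_1_singletonE by blast
  have "s \<inter> e = {u}" using *(8) by blast
  then have c1: "card (s \<union> e) + 1 = q2 + q1" using card_Un_Int[OF fin(1,2)] cards by simp
  have "(s \<union> e) \<inter> f = {v, z}" using z *(9) by blast
  moreover have "v \<noteq> z"
  proof
    assume "v = z"
    then have "v \<in> e \<inter> s" using z **(3) by blast
    then show False using **(6,8) by simp
  qed
  ultimately have "card ((s \<union> e) \<inter> f) = 2" by simp
  then have c2: "card W + 3 = q2 + 2 * q1" using card_Un_Int[of "s \<union> e" f] fin cards c1 *(1) by simp
  have cY: "card Y = q2 - 2" using * fin cards by (simp add: card_Diff_subset)
  have "card W + q1 * card Y \<le> cluster_size"
  proof -
    have "q1 * card Y \<le> q1 * q2" using cY by simp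
    then show ?thesis using c2 unfolding cluster_size_def by linarith
  qed
  moreover have "P ^ card W * edge_wt q2 cluster_size ^ card Y \<le> tangle_const * y ^ (3 * (q1 * (q2 - 1)) + 1)"
  proof (rule weight_le_scale)
    \<comment> \<open>Writing \<open>q2 = a + 3\<close> and \<open>q1 = a + 4 + d\<close> removes
      the truncated subtractions.\<close>
    define a d where "a = q2 - 3" and "d = q1 - (a + 4)"
    then have a: "q2 = a + 3" and d: "q1 = a + 4 + d" using q2 q12 by simp_all
    have "card W = 2 * q1 + a" using c2 a by simp
    then show "3 * (q1 * (q2 - 1)) + 1 \<le> q2 * card W + (q1 - q2) * card Y"
      unfolding cY a d by (simp add: algebra_simps)
  qed (use cY in auto)
  ultimately show ?thesis using fin *(1,2) by auto
qed

lemma double_starts_subset: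
  "double_starts \<subseteq> (\<Union>s\<in>short. \<Union>G\<in>Pow s. (\<lambda>F. (s \<union> \<Union>(F ` G), s - G)) `
     Pi\<^sub>E G (\<lambda>u. \<Union>v\<in>s - {u}. {e \<in> long. u \<in> e \<and> (\<exists>f\<in>long. v \<in> f \<and> 2 \<le> card (e \<inter> f))}))"
proof
  fix i assume "i \<in> double_starts"
  then obtain s F G where *: "i = (s \<union> \<Union>(F ` G), s - G)" "s \<in> short" "G \<subseteq> s"
    "F \<in> Pi\<^sub>E G (\<lambda>u. {e \<in> long. e \<inter> s = {u} \<and> (\<exists>v\<in>s. v \<noteq> u \<and> (\<exists>f\<in>long. v \<in> f \<and> 2 \<le> card (e \<inter> f)))})"
    by (rule double_startsE)
  have "F \<in> Pi\<^sub>E G (\<lambda>u. \<Union>v\<in>s - {u}. {e \<in> long. u \<in> e \<and> (\<exists>f\<in>long. v \<in> f \<and> 2 \<le> card (e \<inter> f))})"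
    by (rule subsetD[OF PiE_mono *(4)]) blast
  then show "i \<in> (\<Union>s\<in>short. \<Union>G\<in>Pow s. (\<lambda>F. (s \<union> \<Union>(F ` G), s - G)) `
     Pi\<^sub>E G (\<lambda>u. \<Union>v\<in>s - {u}. {e \<in> long. u \<in> e \<and> (\<exists>f\<in>long. v \<in> f \<and> 2 \<le> card (e \<inter> f))}))"
    by (intro UN_I[OF *(2)] UN_I[of G] image_eqI[of _ _ F]) (use *(1,3) in simp_all)
qed

lemma finite_double_family:
  "s \<in> short \<Longrightarrow> G \<subseteq> s \<Longrightarrow> finite (Pi\<^sub>E G (\<lambda>u. \<Union>v\<in>s - {u}. {e \<in> long. u \<in> e \<and> (\<exists>f\<in>long. v \<in> f \<and> 2 \<le> card (e \<inter> f))}))"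
  using short_finite finite_subset by (intro finite_PiE) (auto intro!: finite_UN_I)

lemma finite_double_starts: "finite double_starts"
  by (rule finite_subset[OF double_starts_subset]) (auto intro!: finite_UN_I finite_imageI finite_double_family dest: short_finite)

text \<open>Only \<open>s\<close> costs powers of \<open>n\<close>: once it is fixed, each edge of
  \<open>F\<close> shares two points with a long edge through another vertex of \<open>s\<close>,
  which leaves at most \<open>q2 * q1 ^ 6\<close> choices.\<close>

lemma card_double_starts_le:
  "card double_starts \<le> n ^ 2 * (2 ^ q2 * (q2 * q1 ^ 6) ^ q2)"
proof -
  have 1: "card ((\<lambda>F. (s \<union> \<Union>(F ` G), s - G)) ` Pi\<^sub>E G (\<lambda>u. \<Union>v\<in>s - {u}. {e \<in> long. u \<in> e \<and> (\<exists>f\<in>long. v \<in> f \<and> 2 \<le> card (e \<inter> f))}))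
     \<le> (q2 * q1 ^ 6) ^ q2" (is "card (?h ` ?S) \<le> _") if s: "s \<in> short" and G: "G \<in> Pow s" for s G
  proof -
    have "card (?h ` ?S) \<le> card ?S" using s G by (intro card_image_le finite_double_family) auto
    also have "\<dots> = (\<Prod>u\<in>G. card (\<Union>v\<in>s - {u}. {e \<in> long. u \<in> e \<and> (\<exists>f\<in>long. v \<in> f \<and> 2 \<le> card (e \<inter> f))}))"
      using G short_finite[OF s] finite_subset by (intro card_PiE) auto
    also have "\<dots> \<le> (\<Prod>u\<in>G. q2 * q1 ^ 6)"
    proof (rule prod_mono, rule conjI)
      fix u assume "u \<in> G"
      have "card (s - {u}) \<le> q2" using short_card[OF s] short_finite[OF s] by (metis card_Diff1_le)
      then show "card (\<Union>v\<in>s - {u}. {e \<in> long. u \<in> e \<and> (\<exists>f\<in>long. v \<in> f \<and> 2 \<le> card (e \<inter> f))}) \<le> q2 * q1 ^ 6"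
        using short_finite[OF s] by (intro card_UN_le_mult card_ap_edges_double_meet_le) auto
    qed simp
    also have "\<dots> = (q2 * q1 ^ 6) ^ card G" by simp
    also have "\<dots> \<le> (q2 * q1 ^ 6) ^ q2"
    proof (rule power_increasing)
      show "card G \<le> q2" using G short_card[OF s] short_finite[OF s] by (metis Pow_iff card_mono)
      show "1 \<le> q2 * q1 ^ 6" using q12 q2 by (simp add: Suc_le_eq)
    qed
    finally show ?thesis .
  qed
  have "card double_starts \<le> card (\<Union>s\<in>short. \<Union>G\<in>Pow s. (\<lambda>F. (s \<union> \<Union>(F ` G), s - G)) `
     Pi\<^sub>E G (\<lambda>u. \<Union>v\<in>s - {u}. {e \<in> long. u \<in> e \<and> (\<exists>f\<in>long. v \<in> f \<and> 2 \<le> card (e \<inter> f))}))"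
    by (intro card_mono double_starts_subset) (auto intro!: finite_UN_I finite_imageI finite_double_family dest: short_finite)
  also have "\<dots> \<le> (n * n) * (2 ^ q2 * (q2 * q1 ^ 6) ^ q2)"
  proof (intro card_UN_le_mult card_short_le 1)
    fix s assume "s \<in> short"
    then show "finite (Pow s)" "card (Pow s) \<le> 2 ^ q2" using short_finite[of s] short_card[of s] by (auto simp: card_Pow)
  qed auto
  finally show ?thesis by (simp add: power2_eq_square)
qed

text \<open>For the union \<open>U\<close> of the exposed edges the exponent is
  \<open>q1 * card Y + q2 * card U\<close>, with \<open>card Y = q2 - card G\<close>. Asking for
  more than \<open>2 * q1 * (q2 - 1)\<close> is precisely the inequality of
  \<open>private_ap_union_card\<close>, which explains the shape of that lemma.\<close>

lemma double_starts_weight: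
  assumes "(W, Y) \<in> double_starts"
  shows "finite W \<and> Y \<subseteq> W \<and> card W + q1 * card Y \<le> cluster_size
    \<and> P ^ card W * edge_wt q2 cluster_size ^ card Y \<le> tangle_const * y ^ (2 * (q1 * (q2 - 1)) + 1)"
proof -
  obtain s F G where WY: "(W, Y) = (s \<union> \<Union>(F ` G), s - G)" and **: "s \<in> short" "G \<subseteq> s" "2 \<le> card G"
    "F \<in> Pi\<^sub>E G (\<lambda>u. {e \<in> long. e \<inter> s = {u} \<and> (\<exists>v\<in>s. v \<noteq> u \<and> (\<exists>f\<in>long. v \<in> f \<and> 2 \<le> card (e \<inter> f)))})"
    using assms by (rule double_startsE)
  have W: "W = s \<union> \<Union>(F ` G)" "Y = s - G" using WY by simp_all
  note * = W **
  have F: "F u \<in> long" "F u \<inter> s = {u}" if "u \<in> G" for u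
    using PiE_mem[OF *(6) that] by auto
  have fs: "finite s" and cs: "card s = q2" using *(3) short_finite short_card by auto
  have fG: "finite G" using *(4) fs finite_subset by blast
  let ?U = "\<Union>(F ` G)"
  have fU: "finite ?U" using fG F(1) long_finite by auto
  have rq: "card G \<le> q2" using card_mono[OF fs *(4)] cs by simp
  have nt: "q1 * (q2 + card G) < q2 * card ?U + 2 * q1"
  proof (rule private_ap_union_card[OF q12 q2 *(5) rq])
    fix u assume u: "u \<in> G"
    show "arith_prog q1 (F u)" using F(1)[OF u] by (simp add: ap_edges_def)
    show "u \<in> F u" using F(2)[OF u] by blast
    fix v assume "v \<in> G" "u \<noteq> v"
    then show "u \<notin> F v" using F(2)[of v] u *(4) by blast
  qed
  have "G \<subseteq> ?U" using F(2) by blast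
  then have "W = (s - G) \<union> ?U" using *(1) by blast
  moreover have "(s - G) \<inter> ?U = {}"
  proof (rule ccontr)
    assume "(s - G) \<inter> ?U \<noteq> {}"
    then obtain x u where xu: "x \<in> s" "x \<notin> G" "u \<in> G" "x \<in> F u" by blast
    then have "x \<in> F u \<inter> s" by simp
    then show False using F(2)[OF xu(3)] xu(2,3) by simp
  qed
  ultimately have cW: "card W = card Y + card ?U" using fs fU *(2) by (simp add: card_Un_disjoint)
  have cY: "card Y + card G = q2" using *(2,4) fG fs cs card_mono[OF fs *(4)] by (simp add: card_Diff_subset)
  have "card ?U \<le> card G * q1" using fG F(1) long_card by (intro card_UN_le_mult) auto
  then have "card W + q1 * card Y \<le> cluster_size"
  proof -
    assume a: "card ?U \<le> card G * q1"
    have "card G * q1 \<le> q1 * q2" "q1 * card Y \<le> q1 * q2" using cY by auto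
    then show ?thesis using a cW cY unfolding cluster_size_def by linarith
  qed
  moreover have "P ^ card W * edge_wt q2 cluster_size ^ card Y \<le> tangle_const * y ^ (2 * (q1 * (q2 - 1)) + 1)"
  proof (rule weight_le_scale)
    obtain k where k: "q1 = q2 + k" using q12 by (metis less_imp_add_positive)
    obtain r where r: "q2 = Suc r" using q2 by (cases q2) auto
    have "2 * (q1 * r) + 1 \<le> q2 * (card Y + card ?U) + k * card Y"
    proof -
      have "q1 * (card Y + card G) = q1 * q2" using cY by simp
      then have "q1 * card Y + q1 * card G = q1 * q2" by (simp only: distrib_left)
      moreover have "q1 * card Y = q2 * card Y + k * card Y" unfolding k distrib_right ..
      moreover have "q1 * q2 + q1 * card G < q2 * card ?U + 2 * q1" using nt by (simp only: distrib_left)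
      moreover have "q1 * q2 = q1 * r + q1" unfolding r by simp
      ultimately show ?thesis unfolding distrib_left by linarith
    qed
    then show "2 * (q1 * (q2 - 1)) + 1 \<le> q2 * card W + (q1 - q2) * card Y"
      unfolding cW using k r by simp
  qed (use cY in auto)
  ultimately show ?thesis using fs fU *(1,2) by auto
qed

definition tangled_const :: real where
  "tangled_const = tangle_const * (real (q2 * q2 * q1 * (q1 * q1\<^sup>2)) + real (2 ^ q2 * (q2 * q1 ^ 6) ^ q2))"

text \<open>Up to constants there are \<open>n ^ i\<close> starts of weight
  \<open>y ^ (i * (q1 * (q2 - 1)) + 1)\<close> each, with \<open>i = 3\<close> for single and
  \<open>i = 2\<close> for double starts; one factor \<open>y\<close> survives.\<close>

lemma tangled_weight_le: "(\<Sum>X\<in>tangled. P ^ card X) \<le> tangled_const * y"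
proof -
  let ?U = "\<lambda>I. (\<Union>(W, Y)\<in>I. (\<lambda>E. W \<union> \<Union>(E ` Y)) ` attach q2 Y W)"
  have fin: "finite (?U I)" if "finite I" "\<And>W Y. (W, Y) \<in> I \<Longrightarrow> finite W \<and> Y \<subseteq> W" for I
    using that by (auto intro!: finite_UN_I finite_imageI finite_attach) (metis finite_subset)
  have tc: "0 \<le> tangle_const" by (simp add: tangle_const_def)
  have step: "real N * (tangle_const * y ^ (i * (q1 * (q2 - 1)) + 1)) \<le> tangle_const * real k * y"
    if "N = n ^ i * k" for N i k
  proof -
    have "real N * (tangle_const * y ^ (i * (q1 * (q2 - 1)) + 1))
       = tangle_const * real k * (real n ^ i * y ^ (i * (q1 * (q2 - 1)) + 1))" using that by (simp add: mult_ac)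
    also have "\<dots> \<le> tangle_const * real k * y" using tc by (intro mult_left_mono n_scale_eq) auto
    finally show ?thesis .
  qed
  have "(\<Sum>X\<in>tangled. P ^ card X) \<le> (\<Sum>X\<in>?U single_starts \<union> ?U double_starts. P ^ card X)"
  proof (rule sum_mono2)
    show "finite (?U single_starts \<union> ?U double_starts)"
      using fin[OF finite_single_starts] fin[OF finite_double_starts] single_starts_weight double_starts_weight by blast
    show "tangled \<subseteq> ?U single_starts \<union> ?U double_starts" using tangled_subset by (simp add: UN_Un)
  qed (use P in auto)
  also have "\<dots> \<le> (\<Sum>X\<in>?U single_starts. P ^ card X) + (\<Sum>X\<in>?U double_starts. P ^ card X)"
  proof -
    have "finite (?U single_starts)" "finite (?U double_starts)"
      using fin[OF finite_single_starts] fin[OF finite_double_starts] single_starts_weight double_starts_weight by blast+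
    then show ?thesis using P by (simp add: sum_Un sum_nonneg)
  qed
  also have "\<dots> \<le> tangle_const * real (q2 * q2 * q1 * (q1 * q1\<^sup>2)) * y + tangle_const * real (2 ^ q2 * (q2 * q1 ^ 6) ^ q2) * y"
  proof (rule add_mono)
    have "(\<Sum>X\<in>?U single_starts. P ^ card X) \<le> real (n ^ 3 * (q2 * q2 * q1 * (q1 * q1\<^sup>2))) * (tangle_const * y ^ (3 * (q1 * (q2 - 1)) + 1))"
      using tc y by (intro attach_family_sum_le[OF finite_single_starts card_single_starts_le single_starts_weight]) auto
    also have "\<dots> \<le> tangle_const * real (q2 * q2 * q1 * (q1 * q1\<^sup>2)) * y" by (rule step) simp
    finally show "(\<Sum>X\<in>?U single_starts. P ^ card X) \<le> tangle_const * real (q2 * q2 * q1 * (q1 * q1\<^sup>2)) * y" .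
    have "(\<Sum>X\<in>?U double_starts. P ^ card X) \<le> real (n ^ 2 * (2 ^ q2 * (q2 * q1 ^ 6) ^ q2)) * (tangle_const * y ^ (2 * (q1 * (q2 - 1)) + 1))"
      using tc y by (intro attach_family_sum_le[OF finite_double_starts card_double_starts_le double_starts_weight]) auto
    also have "\<dots> \<le> tangle_const * real (2 ^ q2 * (q2 * q1 ^ 6) ^ q2) * y" by (rule step) simp
    finally show "(\<Sum>X\<in>?U double_starts. P ^ card X) \<le> tangle_const * real (2 ^ q2 * (q2 * q1 ^ 6) ^ q2) * y" .
  qed
  finally show ?thesis unfolding tangled_const_def by (simp only: distrib_left distrib_right)
qed

end

context ap_pair
begin

section \<open>Exploration of a critical family\<close>

text \<open>A single round of adding edges, so the size stays polynomial. It will be applied twice: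
  one round captures a vertex of a short edge through its long edge, the next captures the short
  edge itself.\<close>

definition closure2 :: "nat set \<Rightarrow> nat set" where
  "closure2 X = X \<union> \<Union>{f \<in> long \<union> short. 2 \<le> card (f \<inter> X)}"

lemma closure2_superset: "X \<subseteq> closure2 X"
  by (auto simp: closure2_def)

lemma edge_subset_closure2: "f \<in> long \<union> short \<Longrightarrow> 2 \<le> card (f \<inter> X) \<Longrightarrow> f \<subseteq> closure2 X"
  by (auto simp: closure2_def)

lemma finite_edge: "f \<in> long \<union> short \<Longrightarrow> finite f"
  using ap_edges_finite_edge by blast

lemma closure2_mono:
  assumes "X \<subseteq> Y"
  shows "closure2 X \<subseteq> closure2 Y"
proof -
  have "card (f \<inter> X) \<le> card (f \<inter> Y)" if "f \<in> long \<union> short" for f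
    using assms finite_edge[OF that] by (intro card_mono) auto
  then have "2 \<le> card (f \<inter> Y)" if "f \<in> long \<union> short" "2 \<le> card (f \<inter> X)" for f
    using that by (meson le_trans)
  then show ?thesis using assms unfolding closure2_def by blast
qed

lemma card_ge_2E:
  assumes "2 \<le> card A"
  obtains x y where "x \<in> A" "y \<in> A" "x \<noteq> y"
proof -
  obtain Y where "Y \<subseteq> A" "card Y = 2" using assms by (meson obtain_subset_with_card_n)
  then show ?thesis using that by (metis card_2_iff insert_subset)
qed

lemma card_edges_meeting_twice_le:
  assumes "finite X"
  shows "card {f \<in> ap_edges n q. 2 \<le> card (f \<inter> X)} \<le> (card X)\<^sup>2 * q\<^sup>2"
proof -
  let ?D = "{z \<in> X \<times> X. fst z \<noteq> snd z}"
  have "{f \<in> ap_edges n q. 2 \<le> card (f \<inter> X)} \<subseteq> (\<Union>z\<in>?D. {f \<in> ap_edges n q. fst z \<in> f \<and> snd z \<in> f})"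
    by (auto elim!: card_ge_2E)
  then have "card {f \<in> ap_edges n q. 2 \<le> card (f \<inter> X)} \<le> card (\<Union>z\<in>?D. {f \<in> ap_edges n q. fst z \<in> f \<and> snd z \<in> f})"
    using assms by (intro card_mono) auto
  also have "\<dots> \<le> (card X)\<^sup>2 * q\<^sup>2"
  proof (rule card_UN_le_mult)
    have "card ?D \<le> card (X \<times> X)" using assms by (intro card_mono) auto
    then show "card ?D \<le> (card X)\<^sup>2" by (simp add: card_cartesian_product power2_eq_square)
    show "card {f \<in> ap_edges n q. fst z \<in> f \<and> snd z \<in> f} \<le> q\<^sup>2" if "z \<in> ?D" for z
      using card_ap_edges_through_two_le[of "fst z" "snd z" n q] that by (simp add: power2_eq_square)
  qed (use assms in auto)
  finally show ?thesis .
qed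

lemma finite_closure2: "finite X \<Longrightarrow> finite (closure2 X)"
  unfolding closure2_def using finite_edge by auto

lemma card_closure2_le:
  assumes "finite X"
  shows "card (closure2 X) \<le> 3 * (card X)\<^sup>2 * q1 ^ 3"
proof -
  let ?S = "\<lambda>q. {f \<in> ap_edges n q. 2 \<le> card (f \<inter> X)}"
  have q: "card (\<Union>(?S q)) \<le> (card X)\<^sup>2 * q1 ^ 3" if "q \<le> q1" for q
  proof -
    have "card (\<Union>f\<in>?S q. f) \<le> ((card X)\<^sup>2 * q\<^sup>2) * q"
      by (intro card_UN_le_mult card_edges_meeting_twice_le assms) (auto simp: card_ap_edge)
    also have "\<dots> = (card X)\<^sup>2 * q ^ 3" by (simp add: eval_nat_numeral)
    also have "\<dots> \<le> (card X)\<^sup>2 * q1 ^ 3" using that by (intro mult_le_mono power_mono) auto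
    finally show ?thesis by simp
  qed
  have "closure2 X = X \<union> \<Union>(?S q1) \<union> \<Union>(?S q2)" by (auto simp: closure2_def)
  then have "card (closure2 X) \<le> card X + card (\<Union>(?S q1)) + card (\<Union>(?S q2))"
    by (metis (no_types, lifting) add_le_mono1 card_Un_le le_trans)
  also have "\<dots> \<le> (card X)\<^sup>2 * q1 ^ 3 + (card X)\<^sup>2 * q1 ^ 3 + (card X)\<^sup>2 * q1 ^ 3"
  proof (intro add_mono q)
    have "card X * 1 \<le> card X * (card X * q1 ^ 3)"
    proof (cases "card X = 0")
      case False
      have "0 < q1" using q12 by simp
      then have "0 < card X * q1 ^ 3" using False by simp
      then show ?thesis by (intro mult_le_mono2) simp
    qed simp
    then show "card X \<le> (card X)\<^sup>2 * q1 ^ 3" by (simp add: power2_eq_square mult.assoc)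
  qed (use q12 in auto)
  finally show ?thesis by simp
qed

lemma card_closure2_closure2_le:
  assumes "finite X" "card X \<le> M"
  shows "card (closure2 (closure2 X)) \<le> 27 * M ^ 4 * q1 ^ 9"
proof -
  have "card (closure2 (closure2 X)) \<le> 3 * (3 * (card X)\<^sup>2 * q1 ^ 3)\<^sup>2 * q1 ^ 3"
    by (rule order_trans[OF card_closure2_le[OF finite_closure2[OF assms(1)]]])
      (intro mult_le_mono order_refl power_mono card_closure2_le assms; simp)
  also have "\<dots> \<le> 3 * (3 * M\<^sup>2 * q1 ^ 3)\<^sup>2 * q1 ^ 3"
    using assms(2) by (intro mult_le_mono order_refl power_mono) auto
  also have "\<dots> = 27 * M ^ 4 * (q1 ^ 6 * q1 ^ 3)" by (simp add: power_mult_distrib mult.assoc flip: power_mult)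
  finally show ?thesis by (simp flip: power_add)
qed

definition clean_starts :: "nat set \<Rightarrow> nat set \<Rightarrow> nat set set" where
  "clean_starts W e = {s \<in> short. \<exists>v\<in>e. s \<inter> W = {v}}"

text \<open>Larger intersections are ruled out for generic states in
  \<open>exploration_step\<close>.\<close>

definition double_hits :: "nat set \<Rightarrow> nat set set" where
  "double_hits W = {s \<in> short. card (s \<inter> W) = 2}"

text \<open>With bound 1 every new long edge meets all the rest only in its own vertex. Each of the
  new edges is offered as the newest one, at the cost of a factor at most \<open>q2\<close> in the
  count.\<close>

definition extensions :: "nat set set \<Rightarrow> nat set \<Rightarrow> (nat set \<times> nat set \<times> nat) set" where
  "extensions S W = (\<Union>s\<in>S. \<Union>E\<in>attach 1 (s - W) (W \<union> s). \<Union>y\<in>s - W. {(W \<union> s \<union> \<Union>(E ` (s - W)), E y, y)})"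

text \<open>An attached edge meeting the explored set again, or producing a non-generic state, is pinned: it
  contains one of boundedly many points besides its point of attachment.\<close>
definition pinned :: "nat set set \<Rightarrow> nat set \<Rightarrow> nat set set" where
  "pinned S W = (\<Union>s\<in>S. (\<lambda>E. W \<union> s \<union> \<Union>(E ` (s - W))) ` {E \<in> attach 2 (s - W) (W \<union> s).
     \<exists>y\<in>s - W. (E y - {y}) \<inter> closure2 (closure2 (W \<union> s \<union> \<Union>(E ` (s - W - {y})))) \<noteq> {}})"

text \<open>An edge \<open>f\<close> sharing two points with \<open>W\<close> is determined by \<open>W\<close> up to few choices, and so then is the
  short edge joining it to \<open>v\<close>.\<close>
definition crossing_starts :: "nat set \<Rightarrow> (nat set \<times> nat set) set" where
  "crossing_starts W = {(W \<union> s \<union> f, s - W - {y}) | s f y v. s \<in> short \<and> f \<in> long \<and> 2 \<le> card (f \<inter> W)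
     \<and> y \<in> f \<and> y \<in> s \<and> y \<notin> W \<and> v \<in> W \<and> s \<inter> W = {v}}"

definition crossing :: "nat set \<Rightarrow> nat set set" where
  "crossing W = (\<Union>(W', Y)\<in>crossing_starts W. (\<lambda>E. W' \<union> \<Union>(E ` Y)) ` attach 2 Y W')"

text \<open>In a state \<open>(W, e, u)\<close> the edge \<open>e\<close> is the newest one and was attached at \<open>u\<close>.\<close>
definition generic :: "nat set \<times> nat set \<times> nat \<Rightarrow> bool" where
  "generic = (\<lambda>(W, e, u). finite W \<and> e \<subseteq> W \<and> (e - {u}) \<inter> closure2 (closure2 (W - (e - {u}))) = {})"

definition bad :: "nat set \<Rightarrow> nat set \<Rightarrow> nat set set" where
  "bad W e = pinned (clean_starts W e) W \<union> pinned (double_hits W) W \<union> crossing W"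

lemma card_clean_starts_le:
  assumes "finite e"
  shows "card (clean_starts W e) \<le> card e * (q2 * n)"
proof -
  have "card (clean_starts W e) \<le> card (\<Union>v\<in>e. {s \<in> short. v \<in> s})"
    using assms by (intro card_mono) (auto simp: clean_starts_def)
  also have "\<dots> \<le> card e * (q2 * n)"
    using assms q2 by (intro card_UN_le_mult card_ap_edges_through_le) auto
  finally show ?thesis .
qed

lemma card_double_hits_le: "finite W \<Longrightarrow> card (double_hits W) \<le> (card W)\<^sup>2 * q2\<^sup>2"
  by (rule order_trans[OF card_mono card_edges_meeting_twice_le[of W q2]]) (auto simp: double_hits_def)

lemma finite_starts [simp]: "finite (clean_starts W e)" "finite (double_hits W)"
  by (auto simp: clean_starts_def double_hits_def)

text \<open>If \<open>s\<close> had a second point in \<open>W\<close> and \<open>y \<in> s\<close> with \<open>E y\<close> meeting \<open>W\<close> twice, or two points of the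
  same kind, then two points of \<open>s\<close> would lie in the closure of the old part of \<open>W\<close> (cluster edges
  other than \<open>e\<close> miss \<open>e\<close>), and \<open>v\<close> in its double closure, against genericity.\<close>
lemma exploration_step:
  assumes gen: "generic (W, e, u)" and WV: "W \<subseteq> V" and M: "M \<subseteq> long" "\<And>f. f \<in> M \<Longrightarrow> f \<subseteq> V" and e: "e \<in> M"
    and crit: "\<And>e v. e \<in> M \<Longrightarrow> v \<in> e \<Longrightarrow>
      \<exists>s\<in>short. s \<inter> e = {v} \<and> s \<subseteq> V \<and> (\<exists>E. E v = e \<and> (\<forall>y\<in>s. E y \<in> M \<and> E y \<inter> s = {y}))"
    and disj: "\<And>s E x z. s \<in> short \<Longrightarrow> s \<subseteq> V \<Longrightarrow> (\<And>y. y \<in> s \<Longrightarrow> E y \<in> M \<and> E y \<inter> s = {y}) \<Longrightarrow>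
      x \<in> s \<Longrightarrow> z \<in> s \<Longrightarrow> x \<noteq> z \<Longrightarrow> E x \<inter> E z = {}"
  shows "(\<exists>X\<in>bad W e. X \<subseteq> V) \<or> (\<exists>S\<in>{clean_starts W e, double_hits W}. \<exists>(W', e', u')\<in>extensions S W.
    generic (W', e', u') \<and> W' \<subseteq> V \<and> e' \<in> M)"
proof -
  have finW: "finite W" and eW: "e \<subseteq> W" and avoid: "(e - {u}) \<inter> closure2 (closure2 (W - (e - {u}))) = {}"
    using gen by (auto simp: generic_def)
  let ?R = "W - (e - {u})"
  have "card e = q1" using e M(1) card_ap_edge by blast
  then have "2 \<le> card e" using q12 q2 by simp
  \<comment> \<open>\<open>v\<close> has to differ from \<open>u\<close>, since genericity keeps
    only \<open>e - {u}\<close> out of the double closure.\<close>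
  then obtain v where v: "v \<in> e" "v \<noteq> u" by (metis card_ge_2E)
  obtain s E where s: "s \<in> short" "s \<inter> e = {v}" "s \<subseteq> V" and Ev: "E v = e" and E: "\<And>y. y \<in> s \<Longrightarrow> E y \<in> M \<and> E y \<inter> s = {y}"
    using crit[OF e v(1)] by blast
  have fs: "finite s" and cs: "card s = q2" using s(1) ap_edges_finite_edge card_ap_edge by blast+
  have vW: "v \<in> s \<inter> W" using s(2) eW by blast
  have disjE: "E x \<inter> E z = {}" if "x \<in> s" "z \<in> s" "x \<noteq> z" for x z
    using disj[OF s(1,3) E that] by blast
  have vR: "v \<notin> closure2 (closure2 ?R)" using avoid v by blast
  \<comment> \<open>Two such points would pull \<open>s\<close>, and with it \<open>v\<close>, into
    the double closure of the old part.\<close>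
  have one: "x = z" if "x \<in> s" "z \<in> s" "x \<in> closure2 ?R" "z \<in> closure2 ?R" for x z
  proof (rule ccontr)
    assume "x \<noteq> z"
    then have "card {x, z} \<le> card (s \<inter> closure2 ?R)" using that fs by (intro card_mono) auto
    then have "2 \<le> card (s \<inter> closure2 ?R)" using \<open>x \<noteq> z\<close> by simp
    then have "s \<subseteq> closure2 (closure2 ?R)" using s(1) by (intro edge_subset_closure2) auto
    then show False using vR vW by blast
  qed
  have sW: "s \<inter> W - {v} \<subseteq> closure2 ?R" using s(2) closure2_superset[of ?R] by blast
  have EyW: "y \<in> closure2 ?R" if y: "y \<in> s - W" and c: "2 \<le> card (E y \<inter> W)" for y
  proof -
    have "E y \<inter> e = {}" using disjE[of y v] y vW Ev by blast
    then have "E y \<inter> W = E y \<inter> ?R" by blast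
    then have "E y \<subseteq> closure2 ?R" using c E[of y] y M(1) by (intro edge_subset_closure2) auto
    then show ?thesis using E[of y] y by blast
  qed
  define X where "X = W \<union> s \<union> \<Union>(E ` (s - W))"
  have finE: "finite (E y)" "E y \<in> long" "E y \<subseteq> V" "y \<in> E y" if "y \<in> s" for y
    using E[OF that] M ap_edges_finite_edge by blast+
  have XV: "X \<subseteq> V" using WV s(3) finE(3) unfolding X_def by blast
  show ?thesis
  proof (cases "\<exists>y\<in>s - W. 2 \<le> card (E y \<inter> W)")
    case True
    then obtain y where y: "y \<in> s - W" "2 \<le> card (E y \<inter> W)" by blast
    have yR: "y \<in> closure2 ?R" using EyW y by blast
    have sWv: "s \<inter> W = {v}"
    proof (rule ccontr)
      assume "s \<inter> W \<noteq> {v}"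
      then obtain w where "w \<in> s \<inter> W" "w \<noteq> v" using vW by blast
      then show False using one[of w y] sW yR y(1) by blast
    qed
    let ?Y = "s - W - {y}" and ?W = "W \<union> s \<union> E y"
    have st: "(?W, ?Y) \<in> crossing_starts W"
      unfolding crossing_starts_def mem_Collect_eq using s(1) finE[of y] y sWv vW by blast
    have other: "card (E z \<inter> W) \<le> 1" if "z \<in> ?Y" for z
    proof (rule ccontr)
      assume "\<not> ?thesis"
      then have "z \<in> closure2 ?R" using EyW[of z] that by simp
      then show False using one[of z y] yR y that by blast
    qed
    have "restrict E ?Y \<in> attach 2 ?Y ?W"
    proof -
      have "card (E z \<inter> (?W \<union> \<Union>(E ` (?Y - {z})))) \<le> 2" if z: "z \<in> ?Y" for z
      proof -
        have "E z \<inter> E y = {}" "E z \<inter> \<Union>(E ` (?Y - {z})) = {}" using disjE[of z] z y by blast+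
        then have "E z \<inter> (?W \<union> \<Union>(E ` (?Y - {z}))) \<subseteq> {z} \<union> (E z \<inter> W)" using E[of z] z by blast
        then have "card (E z \<inter> (?W \<union> \<Union>(E ` (?Y - {z})))) \<le> card ({z} \<union> (E z \<inter> W))"
          using finW by (intro card_mono) auto
        also have "\<dots> \<le> card {z} + card (E z \<inter> W)" by (rule card_Un_le)
        finally show ?thesis using other[OF z] by simp
      qed
      moreover have "restrict E ?Y ` (?Y - {z}) = E ` (?Y - {z})" for z by auto
      ultimately show ?thesis using finE by (auto simp: attach_def)
    qed
    moreover have "X = ?W \<union> \<Union>(restrict E ?Y ` ?Y)" using y by (auto simp: X_def)
    ultimately have "X \<in> (\<lambda>F. ?W \<union> \<Union>(F ` ?Y)) ` attach 2 ?Y ?W" by blast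
    then have "X \<in> crossing W" unfolding crossing_def by (intro UN_I[OF st]) simp
    then show ?thesis using XV unfolding bad_def by blast
  next
    case False
    define Y where "Y = s - W"
    define F where "F = restrict E Y"
    have FE: "F y = E y" if "y \<in> Y" for y using that by (simp add: F_def)
    have F_im: "F ` Z = E ` Z" if "Z \<subseteq> Y" for Z using that FE by (force simp: image_iff)
    have XF: "X = W \<union> s \<union> \<Union>(F ` Y)" using F_im[of Y] by (simp add: X_def Y_def)
    have le1: "card (E y \<inter> W) \<le> 1" if "y \<in> Y" for y
    proof -
      have "\<not> 2 \<le> card (E y \<inter> W)" using False that unfolding Y_def by blast
      then show ?thesis by simp
    qed
    have rest: "F y \<inter> (W \<union> s \<union> \<Union>(F ` (Y - {y}))) = {y} \<union> (E y \<inter> W)" if y: "y \<in> Y" for y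
    proof -
      have "E y \<inter> \<Union>(E ` (Y - {y})) = {}" using disjE[of y] y unfolding Y_def by blast
      then show ?thesis using E[of y] y F_im[of "Y - {y}"] FE[OF y] unfolding Y_def by auto
    qed
    have att: "F \<in> attach b Y (W \<union> s)" if "\<And>y. y \<in> Y \<Longrightarrow> card ({y} \<union> (E y \<inter> W)) \<le> b" for b
    proof -
      have "F \<in> Pi\<^sub>E Y (\<lambda>y. {e \<in> long. y \<in> e})" using finE by (auto simp: F_def Y_def)
      then show ?thesis using that by (simp add: attach_def rest)
    qed
    have att2: "F \<in> attach 2 Y (W \<union> s)"
    proof (rule att)
      fix y assume "y \<in> Y"
      then show "card ({y} \<union> (E y \<inter> W)) \<le> 2" using le1[of y] card_Un_le[of "{y}" "E y \<inter> W"] by simp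
    qed
    obtain S where S: "S \<in> {clean_starts W e, double_hits W}" "s \<in> S"
    proof (cases "s \<inter> W = {v}")
      case True
      then have "s \<in> clean_starts W e" using s(1) v(1) by (auto simp: clean_starts_def)
      then show ?thesis using that by blast
    next
      case False
      then obtain w where w: "w \<in> s \<inter> W" "w \<noteq> v" using vW by blast
      have "x = w" if "x \<in> s \<inter> W" "x \<noteq> v" for x using one[of x w] sW that w by blast
      then have "s \<inter> W = {v, w}" using w vW by blast
      then have "s \<in> double_hits W" using s(1) w by (simp add: double_hits_def)
      then show ?thesis using that by blast
    qed
    \<comment> \<open>As \<open>q2 \<ge> 3\<close>, some vertex of \<open>s\<close> is new, and its
      edge can become the newest one.\<close>
    have "card (s \<inter> W) \<le> 2" using S by (auto simp: clean_starts_def double_hits_def)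
    then have "card Y \<noteq> 0" using card_Diff_subset_Int[of s W] fs cs q2 by (simp add: Y_def)
    then obtain y where y: "y \<in> Y" by fastforce
    show ?thesis
    proof (cases "\<exists>y\<in>Y. (F y - {y}) \<inter> closure2 (closure2 (W \<union> s \<union> \<Union>(F ` (Y - {y})))) \<noteq> {}")
      case True
      then have "X \<in> pinned S W"
        unfolding pinned_def XF Y_def[symmetric]
        by (intro UN_I[OF S(2)]) (use att2 in \<open>auto simp: Y_def[symmetric]\<close>)
      then show ?thesis using S(1) XV unfolding bad_def by blast
    next
      case False
      have sub: "W \<union> s \<union> \<Union>(F ` (Y - {z})) \<subseteq> closure2 (closure2 (W \<union> s \<union> \<Union>(F ` (Y - {z}))))" for z
        using closure2_superset by (meson order_trans)
      have EW: "E z \<inter> W = {}" if z: "z \<in> Y" for z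
        using False sub[of z] FE[OF z] z unfolding Y_def by blast
      have "F \<in> attach 1 Y (W \<union> s)" using EW by (intro att) simp
      then have "(X, F y, y) \<in> extensions S W"
        unfolding extensions_def XF Y_def[symmetric]
        using S(2) y by (auto simp: Y_def)
      \<comment> \<open>The old part of the new state lies inside the set whose double closure is
        tested in \<open>pinned\<close>, so by monotonicity a failed test yields genericity.\<close>
      moreover have "generic (X, F y, y)"
      proof -
        have "finite X" using finW fs finE by (auto simp: X_def)
        moreover have "F y \<subseteq> X" using y FE XF by auto
        moreover have "y \<in> s" using y by (simp add: Y_def)
        then have "X - (F y - {y}) \<subseteq> W \<union> s \<union> \<Union>(F ` (Y - {y}))" using XF by auto
        then have "closure2 (closure2 (X - (F y - {y}))) \<subseteq> closure2 (closure2 (W \<union> s \<union> \<Union>(F ` (Y - {y}))))"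
          by (intro closure2_mono)
        ultimately show ?thesis using False y by (auto simp: generic_def)
      qed
      moreover have "F y \<in> M" using E[of y] y FE by (auto simp: Y_def)
      ultimately show ?thesis using S(1) XV by blast
    qed
  qed
qed

text \<open>Each of the \<open>q2 - j\<close> new vertices of \<open>s\<close> contributes
  \<open>P\<close> for itself and \<open>edge_wt b M\<close> for its long edge.\<close>

lemma attach_weight_le:
  assumes s: "s \<in> short" "card (s \<inter> W) = j" and W: "finite W" "card W + q2 + q1 * q2 \<le> M"
  shows "(\<Sum>E\<in>attach b (s - W) (W \<union> s). P ^ card (W \<union> s \<union> \<Union>(E ` (s - W)))) \<le> P ^ card W * (P * edge_wt b M) ^ (q2 - j)"
    and "card (s - W) = q2 - j" "card (W \<union> s) = card W + (q2 - j)" "card (W \<union> s) + q1 * card (s - W) \<le> M"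
    and "finite (s - W)" "finite (W \<union> s)" "s - W \<subseteq> W \<union> s"
proof -
  have fs: "finite s" and cs: "card s = q2" using s(1) ap_edges_finite_edge card_ap_edge by blast+
  show cY: "card (s - W) = q2 - j" using card_Diff_subset_Int[of s W] fs cs s(2) by simp
  have "W \<union> s = W \<union> (s - W)" by blast
  then show cW: "card (W \<union> s) = card W + (q2 - j)" using W(1) fs cY by (metis card_Un_disjoint Diff_disjoint finite_Diff)
  have "q1 * (q2 - j) \<le> q1 * q2" by simp
  then show le: "card (W \<union> s) + q1 * card (s - W) \<le> M" using W(2) unfolding cY cW by linarith
  show "finite (s - W)" "finite (W \<union> s)" "s - W \<subseteq> W \<union> s" using fs W by auto
  then have "(\<Sum>E\<in>attach b (s - W) (W \<union> s). P ^ card (W \<union> s \<union> \<Union>(E ` (s - W)))) \<le> P ^ card (W \<union> s) * edge_wt b M ^ card (s - W)"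
    using le by (intro attach_sum_le)
  then show "(\<Sum>E\<in>attach b (s - W) (W \<union> s). P ^ card (W \<union> s \<union> \<Union>(E ` (s - W)))) \<le> P ^ card W * (P * edge_wt b M) ^ (q2 - j)"
    by (simp add: cY cW power_add power_mult_distrib mult.assoc)
qed

lemma extensions_weight_le:
  assumes S: "finite S" "S \<subseteq> short" "card S \<le> K" "\<And>s. s \<in> S \<Longrightarrow> card (s \<inter> W) = j"
    and W: "finite W" "card W + q2 + q1 * q2 \<le> M"
  shows "(\<Sum>(W', e, u)\<in>extensions S W. P ^ card W') \<le> real K * (real q2 * (P ^ card W * (P * edge_wt 1 M) ^ (q2 - j)))"
proof -
  let ?f = "\<lambda>(W', e :: nat set, u :: nat). P ^ card W'"
  let ?A = "\<lambda>s. attach 1 (s - W) (W \<union> s)"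
  let ?X = "\<lambda>s E. W \<union> s \<union> \<Union>(E ` (s - W))"
  have f0: "0 \<le> ?f x" for x using P by (cases x) simp
  note aw = attach_weight_le[OF subsetD[OF S(2)] S(4) W]
  have "sum ?f (extensions S W) \<le> (\<Sum>s\<in>S. sum ?f (\<Union>E\<in>?A s. \<Union>y\<in>s - W. {(?X s E, E y, y)}))"
    unfolding extensions_def using S(1) aw(5) f0 by (intro sum_UN_le) auto
  also have "\<dots> \<le> (\<Sum>s\<in>S. \<Sum>E\<in>?A s. sum ?f (\<Union>y\<in>s - W. {(?X s E, E y, y)}))"
    using aw(5) f0 by (intro sum_mono sum_UN_le) auto
  also have "\<dots> \<le> (\<Sum>s\<in>S. \<Sum>E\<in>?A s. \<Sum>y\<in>s - W. sum ?f {(?X s E, E y, y)})"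
    using aw(5) f0 by (intro sum_mono sum_UN_le) auto
  also have "\<dots> = (\<Sum>s\<in>S. real (card (s - W)) * (\<Sum>E\<in>?A s. P ^ card (?X s E)))"
    by (simp add: sum_distrib_left)
  also have "\<dots> \<le> real K * (real q2 * (P ^ card W * (P * edge_wt 1 M) ^ (q2 - j)))"
  proof (rule sum_le_card_times[OF S(1) subset_refl S(3)])
    show "real (card (s - W)) * (\<Sum>E\<in>?A s. P ^ card (?X s E)) \<le> real q2 * (P ^ card W * (P * edge_wt 1 M) ^ (q2 - j))"
      if "s \<in> S" for s
      using aw(1,2) that P by (intro mult_mono) (auto intro!: sum_nonneg)
  qed (use P edge_wt_nonneg in auto)
  finally show ?thesis .
qed

text \<open>The pinned edge passes through one of at most \<open>27 * M ^ 4 * q1 ^ 9\<close> points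
  besides its vertex and has at least \<open>q1 - 2\<close> new points; with the factor
  \<open>P\<close> of its vertex this gives \<open>P ^ (q1 - 1)\<close>. The other new vertices
  contribute as usual.\<close>

lemma pinned_weight_le:
  assumes S: "finite S" "S \<subseteq> short" "card S \<le> K" "\<And>s. s \<in> S \<Longrightarrow> card (s \<inter> W) = j"
    and W: "finite W" "card W + q2 + q1 * q2 \<le> M" and j: "j < q2"
  shows "(\<Sum>X\<in>pinned S W. P ^ card X) \<le>
    real K * (real q2 * (P ^ card W * (P * edge_wt 2 M) ^ (q2 - j - 1) * (real (27 * M ^ 4 * q1 ^ 9 * q1\<^sup>2) * P ^ (q1 - 1))))"
proof -
  let ?X = "\<lambda>s E. W \<union> s \<union> \<Union>(E ` (s - W))"
  define Z where "Z = (\<lambda>X. closure2 (closure2 X))"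
  define T where "T = (\<lambda>(y, X). {e \<in> long. (e - {y}) \<inter> Z X \<noteq> {}})"
  define A where "A s = {E. E \<in> attach 2 (s - W) (W \<union> s) \<and> (\<exists>y\<in>s - W. E y \<in> T (y, W \<union> s \<union> \<Union>(E ` (s - W - {y}))))}" for s
  let ?c = "real (27 * M ^ 4 * q1 ^ 9 * q1\<^sup>2) * P ^ (q1 - 2)"
  let ?w = "P ^ card W * (P * edge_wt 2 M) ^ (q2 - j - 1) * (real (27 * M ^ 4 * q1 ^ 9 * q1\<^sup>2) * P ^ (q1 - 1))"
  note aw = attach_weight_le[OF subsetD[OF S(2)] S(4) W]
  have finA: "finite (A s)" if "s \<in> S" for s
    using finite_attach[OF aw(5)[OF that that], of 2 "W \<union> s"] unfolding A_def by (rule rev_finite_subset) blast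
  have "pinned S W = (\<Union>s\<in>S. ?X s ` A s)"
  proof -
    have "{E \<in> attach 2 (s - W) (W \<union> s). \<exists>y\<in>s - W. (E y - {y}) \<inter> closure2 (closure2 (W \<union> s \<union> \<Union>(E ` (s - W - {y})))) \<noteq> {}} = A s" for s
      unfolding A_def T_def Z_def by (auto dest: attachD(1))
    then show ?thesis unfolding pinned_def by simp
  qed
  then have "(\<Sum>X\<in>pinned S W. P ^ card X) \<le> (\<Sum>s\<in>S. \<Sum>X\<in>?X s ` A s. P ^ card X)"
    using P S(1) finA by (simp only:) (intro sum_UN_le; auto)
  also have "\<dots> \<le> real K * (real q2 * ?w)"
  proof (rule sum_le_card_times[OF S(1) subset_refl S(3)])
    fix s assume s: "s \<in> S"
    note as = aw(2-)[OF s s]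
    have "(\<Sum>X\<in>?X s ` A s. P ^ card X) \<le> (\<Sum>E\<in>A s. P ^ card (?X s E))"
      using sum_image_le[OF finA[OF s], of "\<lambda>X. P ^ card X" "?X s"] P by (simp add: o_def)
    also have "\<dots> \<le> real (card (s - W)) * (P ^ card (W \<union> s) * edge_wt 2 M ^ (card (s - W) - 1) * ?c)"
      unfolding A_def
    proof (rule attach_special_sum_le)
      fix y E assume y: "y \<in> s - W" and E: "E \<in> attach 2 (s - W - {y}) (W \<union> s)"
      let ?X' = "W \<union> s \<union> \<Union>(E ` (s - W - {y}))"
      have fX: "finite ?X'" using finite_Un_attach[OF E] as(4,5) by blast
      have "card ?X' \<le> card (W \<union> s) + q1 * card (s - W - {y})" using card_Un_attach_le[OF E] as(4,5) by blast
      also have "\<dots> \<le> M"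
      proof -
        have "q1 * card (s - W - {y}) \<le> q1 * card (s - W)" using as(4) by (intro mult_le_mono2 card_mono) auto
        then show ?thesis using as(3) by linarith
      qed
      finally have cX: "card ?X' \<le> M" .
      have "(\<Sum>e | e \<in> long \<and> y \<in> e \<and> (e - {y}) \<inter> Z ?X' \<noteq> {} \<and> card (e \<inter> ?X') \<le> 2. P ^ card (e - ?X')) \<le> ?c"
        unfolding Z_def by (intro pin_edge_sum_le finite_closure2 fX card_closure2_closure2_le cX)
      moreover have "{e. e \<in> long \<and> y \<in> e \<and> e \<in> T (y, ?X') \<and> card (e \<inter> ?X') \<le> 2}
         = {e. e \<in> long \<and> y \<in> e \<and> (e - {y}) \<inter> Z ?X' \<noteq> {} \<and> card (e \<inter> ?X') \<le> 2}"
        by (auto simp: T_def)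
      ultimately show "(\<Sum>e | e \<in> long \<and> y \<in> e \<and> e \<in> T (y, ?X') \<and> card (e \<inter> ?X') \<le> 2. P ^ card (e - ?X')) \<le> ?c"
        by (simp only:)
    next
      show "finite (T X)" for X unfolding T_def by (cases X) simp
    qed (use as P in auto)
    also have "\<dots> \<le> real q2 * ?w"
    proof (rule mult_mono)
      have "q2 - j + (q1 - 2) = q2 - j - 1 + (q1 - 1)" using j q12 q2 by simp
      then have pow: "P ^ (q2 - j) * P ^ (q1 - 2) = P ^ (q2 - j - 1) * P ^ (q1 - 1)" by (simp flip: power_add)
      let ?C = "real (27 * M ^ 4 * q1 ^ 9 * q1\<^sup>2)"
      have "P ^ card (W \<union> s) * edge_wt 2 M ^ (card (s - W) - 1) * ?c
         = P ^ card W * edge_wt 2 M ^ (q2 - j - 1) * ?C * (P ^ (q2 - j) * P ^ (q1 - 2))"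
        unfolding as(1,2) power_add by (simp only: mult_ac)
      also have "\<dots> = ?w" unfolding pow power_mult_distrib by (simp only: mult_ac)
      finally show "P ^ card (W \<union> s) * edge_wt 2 M ^ (card (s - W) - 1) * ?c \<le> ?w" by (rule eq_refl)
    qed (use as(1) P edge_wt_nonneg in \<open>auto\<close>)
    finally show "(\<Sum>X\<in>?X s ` A s. P ^ card X) \<le> real q2 * ?w" .
  qed (use P edge_wt_nonneg in auto)
  finally show ?thesis .
qed

lemma crossing_starts_subset:
  "crossing_starts W \<subseteq> (\<Union>f\<in>{f \<in> long. 2 \<le> card (f \<inter> W)}. \<Union>y\<in>f - W. \<Union>v\<in>W. (\<lambda>s. (W \<union> s \<union> f, s - W - {y})) ` {s \<in> short. y \<in> s \<and> v \<in> s})"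
proof
  fix i assume "i \<in> crossing_starts W"
  then obtain s f y v where *: "i = (W \<union> s \<union> f, s - W - {y})" "s \<in> short" "f \<in> long" "2 \<le> card (f \<inter> W)"
    "y \<in> f" "y \<in> s" "y \<notin> W" "v \<in> W" "s \<inter> W = {v}" unfolding crossing_starts_def mem_Collect_eq by metis
  then have "v \<in> s" by blast
  then show "i \<in> (\<Union>f\<in>{f \<in> long. 2 \<le> card (f \<inter> W)}. \<Union>y\<in>f - W. \<Union>v\<in>W. (\<lambda>s. (W \<union> s \<union> f, s - W - {y})) ` {s \<in> short. y \<in> s \<and> v \<in> s})"
    using * by (intro UN_I[of f] UN_I[of y] UN_I[of v] image_eqI[of _ _ s]) simp_all
qed

lemma finite_crossing_cover:
  assumes "finite W"
  shows "finite (\<Union>f\<in>{f \<in> long. 2 \<le> card (f \<inter> W)}. \<Union>y\<in>f - W. \<Union>v\<in>W. (\<lambda>s. (W \<union> s \<union> f, s - W - {y})) ` {s \<in> short. y \<in> s \<and> v \<in> s})"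
proof (intro finite_UN_I)
  show "finite (f - W)" if "f \<in> {f \<in> long. 2 \<le> card (f \<inter> W)}" for f
    using that ap_edges_finite_edge by blast
qed (use assms in simp_all)

lemma finite_crossing_starts: "finite W \<Longrightarrow> finite (crossing_starts W)"
  by (rule finite_subset[OF crossing_starts_subset finite_crossing_cover])

text \<open>No factor \<open>n\<close> arises: \<open>f\<close> passes through two points of
  \<open>W\<close>, \<open>y\<close> is one of its points, and \<open>s\<close> passes through
  \<open>y\<close> and some \<open>v\<close> in \<open>W\<close>.\<close>

lemma card_crossing_starts_le:
  assumes "finite W" "card W \<le> M"
  shows "card (crossing_starts W) \<le> M\<^sup>2 * q1\<^sup>2 * (q1 * (M * q2\<^sup>2))"
proof -
  let ?g = "\<lambda>f y s. (W \<union> s \<union> f, s - W - {y})"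
  have "card (crossing_starts W) \<le> card (\<Union>f\<in>{f \<in> long. 2 \<le> card (f \<inter> W)}. \<Union>y\<in>f - W. \<Union>v\<in>W. ?g f y ` {s \<in> short. y \<in> s \<and> v \<in> s})"
    using assms by (intro card_mono crossing_starts_subset finite_crossing_cover)
  also have "\<dots> \<le> M\<^sup>2 * q1\<^sup>2 * (q1 * (M * q2\<^sup>2))"
  proof (intro card_UN_le_mult)
    show "card {f \<in> long. 2 \<le> card (f \<inter> W)} \<le> M\<^sup>2 * q1\<^sup>2"
      by (rule order_trans[OF card_edges_meeting_twice_le[OF assms(1)]]) (use assms(2) in \<open>intro mult_le_mono power_mono; simp\<close>)
    fix f assume f: "f \<in> {f \<in> long. 2 \<le> card (f \<inter> W)}"
    then have "finite f" "card f = q1" using ap_edges_finite_edge card_ap_edge by blast+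
    then show "finite (f - W)" "card (f - W) \<le> q1" using card_mono[of f "f - W"] by auto
    fix y v assume "y \<in> f - W" "v \<in> W"
    then have "y \<noteq> v" by blast
    have "card (?g f y ` {s \<in> short. y \<in> s \<and> v \<in> s}) \<le> card {s \<in> short. y \<in> s \<and> v \<in> s}" by (intro card_image_le) simp
    also have "\<dots> \<le> q2\<^sup>2" using card_ap_edges_through_two_le[OF \<open>y \<noteq> v\<close>] by (simp add: power2_eq_square)
    finally show "card (?g f y ` {s \<in> short. y \<in> s \<and> v \<in> s}) \<le> q2\<^sup>2" .
  qed (use assms in auto)
  finally show ?thesis .
qed

lemma crossing_starts_card:
  assumes "(W', Y) \<in> crossing_starts W" "finite W" "card W + q2 + q1 * q2 \<le> M"
  shows "finite W'" "Y \<subseteq> W'" "card W' + q1 * card Y \<le> M" "card Y = q2 - 2" "card W + (q2 - 1) \<le> card W'"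
proof -
  obtain s f y v where *: "W' = W \<union> s \<union> f" "Y = s - W - {y}" "s \<in> short" "f \<in> long" "2 \<le> card (f \<inter> W)" "y \<in> f" "y \<in> s" "y \<notin> W" "s \<inter> W = {v}"
    using assms(1) unfolding crossing_starts_def by auto
  have fs: "finite s" "card s = q2" "finite f" "card f = q1" using *(3,4) ap_edges_finite_edge card_ap_edge by blast+
  show fW: "finite W'" "Y \<subseteq> W'" using * fs assms(2) by auto
  have cs: "card (s - W) = q2 - 1" using card_Diff_subset_Int[of s W] fs *(9) by simp
  then show cY: "card Y = q2 - 2" using *(2,7,8) fs by simp
  have "card (W \<union> (s - W)) \<le> card W'" using fW *(1) by (intro card_mono) auto
  moreover have "card (W \<union> (s - W)) = card W + card (s - W)" using fs assms(2) by (intro card_Un_disjoint) auto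
  ultimately show "card W + (q2 - 1) \<le> card W'" using cs by linarith
  have "card W' \<le> card (W \<union> s) + card f" unfolding *(1) by (rule card_Un_le)
  also have "\<dots> \<le> card W + q2 + q1" using card_Un_le[of W s] fs by simp
  finally have "card W' \<le> card W + q2 + q1" .
  moreover have "q1 + q1 * card Y \<le> q1 * q2"
  proof -
    have "q1 * (1 + card Y) \<le> q1 * q2" using cY q2 by (intro mult_le_mono2) simp
    then show ?thesis by simp
  qed
  ultimately show "card W' + q1 * card Y \<le> M" using assms(3) by linarith
qed

end

context ap_scaled
begin

section \<open>Expected numbers at the threshold\<close>

text \<open>\<open>27 * M ^ 4 * q1 ^ 9\<close> bounds a double closure and \<open>q1\<^sup>2\<close> the long edges through two points.\<close>
definition size_const :: "nat \<Rightarrow> real" where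
  "size_const M = 27 * real M ^ 4 * real q1 ^ 11"

lemma monomial_le_size_const:
  assumes "1 \<le> M" "a \<le> 27" "i \<le> 4" "j \<le> 11"
  shows "real a * real M ^ i * real q1 ^ j \<le> size_const M"
  unfolding size_const_def using assms q12 by (intro mult_mono power_increasing) auto

lemma size_const_ge_1: "1 \<le> M \<Longrightarrow> 1 \<le> size_const M"
  using monomial_le_size_const[of M 1 0 0] by simp

text \<open>A new vertex together with its long edge: the exponents \<open>q2\<close> and
  \<open>q1 - q2\<close> add up to \<open>q1\<close>.\<close>

lemma P_edge_wt_le:
  assumes "b \<le> 2" "1 \<le> M"
  shows "P * edge_wt b M \<le> size_const M * y ^ q1"
proof -
  have "P * edge_wt b M \<le> y ^ q2 * (real (2 * M * q1\<^sup>2) * y ^ (q1 - q2))"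
    using assms q2 P y by (intro mult_mono P_le edge_wt_le edge_wt_nonneg) auto
  also have "\<dots> = real 2 * real M ^ 1 * real q1 ^ 2 * y ^ (q2 + (q1 - q2))" by (simp add: power_add)
  also have "\<dots> \<le> size_const M * y ^ (q2 + (q1 - q2))"
    using assms y by (intro mult_right_mono monomial_le_size_const) auto
  finally show ?thesis using q12 by simp
qed

lemma P_edge_wt_pow_le:
  assumes "b \<le> 2" "1 \<le> M"
  shows "(P * edge_wt b M) ^ r \<le> size_const M ^ r * y ^ (q1 * r)"
  using power_mono[OF P_edge_wt_le[OF assms], of r] P edge_wt_nonneg by (simp add: power_mult power_mult_distrib)

text \<open>Here the powers of \<open>n\<close> and \<open>y\<close> cancel exactly, and only
  \<open>c\<close> can make the remaining constant small. Bound 1 matters: without a second contact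
  \<open>edge_wt\<close> does not involve \<open>M\<close>, so the factor 1/2 holds however large
  the explored set has become.\<close>

lemma clean_extensions_weight_le:
  assumes W: "finite W" "card W + q2 + q1 * q2 \<le> M" and e: "finite e" "card e = q1"
    and c_small: "2 * real q1 ^ q2 * (real q2)\<^sup>2 * c \<le> 1"
  shows "(\<Sum>(W', f, u)\<in>extensions (clean_starts W e) W. P ^ card W') \<le> P ^ card W / 2"
proof -
  have sing: "card (s \<inter> W) = 1" if "s \<in> clean_starts W e" for s using that by (auto simp: clean_starts_def)
  have sub: "clean_starts W e \<subseteq> short" by (auto simp: clean_starts_def)
  have K: "card (clean_starts W e) \<le> q1 * (q2 * n)" using card_clean_starts_le[OF e(1)] e(2) by simp
  have q1_eq: "q1 = Suc (q1 - 1)" using q12 by simp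
  have "P * edge_wt 1 M = real q1 * (real n * P ^ q1)"
    unfolding edge_wt_def by (subst (4) q1_eq) simp
  then have Pe: "P * edge_wt 1 M = real q1 * real n * c ^ q1 * y ^ (q2 * q1)"
    by (simp add: Py power_mult_distrib power_mult)
  have "q2 * q1 = q1 * (q2 - 1) + q1" using q2 by (cases q2) simp_all
  then have "real n * y ^ (q2 * q1) = y ^ q1" using ny by (simp add: power_add flip: mult.assoc)
  then have Pe': "P * edge_wt 1 M = real q1 * c ^ q1 * y ^ q1" unfolding Pe by (simp add: mult.assoc mult.left_commute)
  have "(\<Sum>(W', f, u)\<in>extensions (clean_starts W e) W. P ^ card W')
     \<le> real (q1 * (q2 * n)) * (real q2 * (P ^ card W * (P * edge_wt 1 M) ^ (q2 - 1)))"
    by (intro extensions_weight_le sub K sing W) auto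
  also have "\<dots> = (real q1 * real q1 ^ (q2 - 1)) * (real q2)\<^sup>2 * c ^ (q1 * (q2 - 1)) * (real n * y ^ (q1 * (q2 - 1))) * P ^ card W"
    unfolding Pe' power_mult_distrib by (simp add: power2_eq_square mult_ac flip: power_mult)
  also have "\<dots> = real q1 ^ q2 * (real q2)\<^sup>2 * c ^ (q1 * (q2 - 1)) * P ^ card W"
  proof -
    have "real q1 * real q1 ^ (q2 - 1) = real q1 ^ q2" using q2 by (cases q2) simp_all
    then show ?thesis unfolding ny by simp
  qed
  also have "\<dots> \<le> (real q1 ^ q2 * (real q2)\<^sup>2 * c ^ 1) * P ^ card W"
  proof (intro mult_right_mono mult_left_mono power_decreasing)
    have "1 * 1 \<le> q1 * (q2 - 1)" using q12 q2 by (intro mult_le_mono) auto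
    then show "1 \<le> q1 * (q2 - 1)" by simp
  qed (use c P in auto)
  also have "\<dots> \<le> (1 / 2) * P ^ card W" using c_small P by (intro mult_right_mono) (auto simp: mult_ac)
  finally show ?thesis by simp
qed

text \<open>Two old points determine \<open>s\<close> up to boundedly many choices, so no
  \<open>n\<close> occurs, and each of the \<open>q2 - 2\<close> new vertices is worth
  \<open>y ^ q1\<close>.\<close>

lemma double_extensions_weight_le:
  assumes W: "finite W" "card W + q2 + q1 * q2 \<le> M"
  shows "(\<Sum>(W', f, u)\<in>extensions (double_hits W) W. P ^ card W') \<le> size_const M ^ q2 * y ^ (q1 * (q2 - 2)) * P ^ card W"
proof -
  have M: "1 \<le> M" using W(2) q2 by linarith
  have cW: "card W \<le> M" using W(2) by simp
  note k1 = size_const_ge_1[OF M]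
  have "(\<Sum>(W', f, u)\<in>extensions (double_hits W) W. P ^ card W')
     \<le> real (M\<^sup>2 * q2\<^sup>2) * (real q2 * (P ^ card W * (P * edge_wt 1 M) ^ (q2 - 2)))"
  proof (intro extensions_weight_le W)
    show "card (double_hits W) \<le> M\<^sup>2 * q2\<^sup>2"
      by (rule order_trans[OF card_double_hits_le[OF W(1)]]) (intro mult_le_mono power_mono cW; simp)
  qed (auto simp: double_hits_def)
  also have "\<dots> \<le> real (M\<^sup>2 * q2\<^sup>2) * (real q2 * (P ^ card W * (size_const M ^ (q2 - 2) * y ^ (q1 * (q2 - 2)))))"
    using M P by (intro mult_left_mono P_edge_wt_pow_le) auto
  also have "\<dots> = (real 1 * real M ^ 2 * real q2 ^ 3) * size_const M ^ (q2 - 2) * (y ^ (q1 * (q2 - 2)) * P ^ card W)"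
    by (simp add: eval_nat_numeral mult_ac)
  also have "\<dots> \<le> size_const M ^ q2 * (y ^ (q1 * (q2 - 2)) * P ^ card W)"
  proof (rule mult_right_mono)
    have "real 1 * real M ^ 2 * real q2 ^ 3 \<le> real 1 * real M ^ 2 * real q1 ^ 3"
      using q12 by (intro mult_left_mono power_mono) auto
    also have "\<dots> \<le> size_const M" using M by (intro monomial_le_size_const) auto
    finally have "real 1 * real M ^ 2 * real q2 ^ 3 * size_const M ^ (q2 - 2) \<le> size_const M * size_const M ^ (q2 - 2)"
      using k1 by (intro mult_right_mono) auto
    also have "\<dots> = size_const M ^ Suc (q2 - 2)" by simp
    also have "\<dots> \<le> size_const M ^ q2" using k1 q2 by (intro power_increasing) auto
    finally show "real 1 * real M ^ 2 * real q2 ^ 3 * size_const M ^ (q2 - 2) \<le> size_const M ^ q2" .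
  qed (use y P in auto)
  finally show ?thesis by (simp add: mult.assoc)
qed

text \<open>\<open>i\<close> is the power of \<open>n\<close> in the number of short edges: 1 if
  only one old point is prescribed, 0 if two are. The vertex with the pinned edge contributes
  \<open>y ^ (q2 * (q1 - 1))\<close> in place of \<open>y ^ q1\<close>.\<close>

lemma pinned_scaled_le:
  assumes S: "finite S" "S \<subseteq> short" "card S \<le> K" "\<And>s. s \<in> S \<Longrightarrow> card (s \<inter> W) = j"
    and W: "finite W" "card W + q2 + q1 * q2 \<le> M" and j: "j < q2" "1 \<le> j"
    and K: "real K * real q2 \<le> size_const M * real n ^ i"
    and exps: "i * (q1 * (q2 - 1)) + (q1 * (q2 - 2) + 1) \<le> q1 * (q2 - j - 1) + q2 * (q1 - 1)"
  shows "(\<Sum>X\<in>pinned S W. P ^ card X) \<le> size_const M ^ q2 * y ^ (q1 * (q2 - 2) + 1) * P ^ card W"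
proof -
  have M: "1 \<le> M" using W(2) q2 by linarith
  note k1 = size_const_ge_1[OF M]
  let ?k = "size_const M" and ?r = "q2 - j - 1"
  have "real (27 * M ^ 4 * q1 ^ 9 * q1\<^sup>2) = ?k" by (simp add: size_const_def mult.assoc flip: power_add)
  then have "(\<Sum>X\<in>pinned S W. P ^ card X) \<le> real K * (real q2 * (P ^ card W * (P * edge_wt 2 M) ^ ?r * (?k * P ^ (q1 - 1))))"
    using pinned_weight_le[OF S W j(1)] by simp
  also have "\<dots> = (real K * real q2) * ((P * edge_wt 2 M) ^ ?r * (?k * P ^ (q1 - 1)) * P ^ card W)" by simp
  also have "\<dots> \<le> (?k * real n ^ i) * ((?k ^ ?r * y ^ (q1 * ?r)) * (?k * y ^ (q2 * (q1 - 1))) * P ^ card W)"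
    using k1 P y M by (intro mult_mono K P_edge_wt_pow_le P_pow_le mult_nonneg_nonneg edge_wt_nonneg zero_le_power order_refl) auto
  also have "\<dots> = ?k ^ (?r + 2) * (real n ^ i * y ^ (q1 * ?r + q2 * (q1 - 1))) * P ^ card W"
    by (simp add: power_add power2_eq_square mult_ac)
  also have "\<dots> \<le> ?k ^ q2 * y ^ (q1 * (q2 - 2) + 1) * P ^ card W"
    using k1 P y j exps q2 by (intro mult_mono power_increasing n_pow_y_pow_le zero_le_power mult_nonneg_nonneg order_refl) auto
  finally show ?thesis .
qed

text \<open>The \<open>q2 - 1\<close> new points of \<open>s\<close> give one \<open>P\<close> more
  than there are edges left to attach. That \<open>P \<le> y ^ q2\<close> supplies the spare factor
  \<open>y\<close>.\<close>

lemma crossing_weight_le: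
  assumes W: "finite W" "card W + q2 + q1 * q2 \<le> M"
  shows "(\<Sum>X\<in>crossing W. P ^ card X) \<le> size_const M ^ q2 * y ^ (q1 * (q2 - 2) + 1) * P ^ card W"
proof -
  have M: "1 \<le> M" using W(2) q2 by linarith
  note k1 = size_const_ge_1[OF M]
  let ?k = "size_const M" and ?N = "M\<^sup>2 * q1\<^sup>2 * (q1 * (M * q2\<^sup>2))"
  have "(\<Sum>X\<in>crossing W. P ^ card X) \<le> real ?N * (?k ^ (q2 - 2) * y ^ (q1 * (q2 - 2) + 1) * P ^ card W)"
    unfolding crossing_def
  proof (rule attach_family_sum_le[where M = M])
    show "finite (crossing_starts W)" using W(1) by (rule finite_crossing_starts)
    show "card (crossing_starts W) \<le> ?N" using W by (intro card_crossing_starts_le) auto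
    fix W' Y assume *: "(W', Y) \<in> crossing_starts W"
    note cs = crossing_starts_card[OF * W]
    have "P ^ card W' * edge_wt 2 M ^ card Y \<le> P ^ (card W + (q2 - 1)) * edge_wt 2 M ^ (q2 - 2)"
      unfolding cs(4) using P cs(5) by (intro mult_right_mono power_decreasing zero_le_power edge_wt_nonneg) auto
    also have "q2 - 1 = Suc (q2 - 2)" using q2 by simp
    then have "P ^ (card W + (q2 - 1)) * edge_wt 2 M ^ (q2 - 2) = P * ((P * edge_wt 2 M) ^ (q2 - 2)) * P ^ card W"
      by (simp only: power_add power_Suc power_mult_distrib mult_ac)
    also have "\<dots> \<le> y ^ q2 * (?k ^ (q2 - 2) * y ^ (q1 * (q2 - 2))) * P ^ card W"
      using k1 P y M by (intro mult_mono P_le P_edge_wt_pow_le mult_nonneg_nonneg edge_wt_nonneg zero_le_power order_refl) auto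
    also have "\<dots> = ?k ^ (q2 - 2) * y ^ (q1 * (q2 - 2) + q2) * P ^ card W" by (simp add: power_add)
    also have "\<dots> \<le> ?k ^ (q2 - 2) * y ^ (q1 * (q2 - 2) + 1) * P ^ card W"
      using k1 P y q2 by (intro mult_right_mono mult_left_mono power_decreasing) auto
    finally show "finite W' \<and> Y \<subseteq> W' \<and> card W' + q1 * card Y \<le> M \<and>
      P ^ card W' * edge_wt 2 M ^ card Y \<le> ?k ^ (q2 - 2) * y ^ (q1 * (q2 - 2) + 1) * P ^ card W"
      using cs by blast
  qed (use k1 P y in auto)
  also have "\<dots> = (real 1 * real M ^ 3 * (real q1 ^ 3 * real q2 ^ 2)) * ?k ^ (q2 - 2) * (y ^ (q1 * (q2 - 2) + 1) * P ^ card W)"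
    by (simp add: eval_nat_numeral mult_ac)
  also have "\<dots> \<le> ?k ^ q2 * (y ^ (q1 * (q2 - 2) + 1) * P ^ card W)"
  proof (rule mult_right_mono)
    have "real 1 * real M ^ 3 * (real q1 ^ 3 * real q2 ^ 2) \<le> real 1 * real M ^ 3 * (real q1 ^ 3 * real q1 ^ 2)"
      using q12 by (intro mult_left_mono power_mono) auto
    also have "\<dots> = real 1 * real M ^ 3 * real q1 ^ 5" by (simp flip: power_add)
    also have "\<dots> \<le> ?k" using M by (intro monomial_le_size_const) auto
    finally have "real 1 * real M ^ 3 * (real q1 ^ 3 * real q2 ^ 2) * ?k ^ (q2 - 2) \<le> ?k * ?k ^ (q2 - 2)"
      using k1 by (intro mult_right_mono) auto
    also have "\<dots> = ?k ^ Suc (q2 - 2)" by simp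
    also have "\<dots> \<le> ?k ^ q2" using k1 q2 by (intro power_increasing) auto
    finally show "real 1 * real M ^ 3 * (real q1 ^ 3 * real q2 ^ 2) * ?k ^ (q2 - 2) \<le> ?k ^ q2" .
  qed (use y P in auto)
  finally show ?thesis by (simp add: mult.assoc)
qed

end

section \<open>States reached by the exploration and their total weight\<close>

lemma sum_Un_le:
  fixes f :: "'a \<Rightarrow> real"
  assumes "finite A" "finite B" "\<And>x. 0 \<le> f x"
  shows "sum f (A \<union> B) \<le> sum f A + sum f B"
proof -
  have "0 \<le> sum f (A \<inter> B)" using assms(3) by (rule sum_nonneg)
  then show ?thesis using sum.union_inter[OF assms(1,2), of f] by linarith
qed

context ap_pair
begin

lemma finite_pinned: "finite S \<Longrightarrow> S \<subseteq> short \<Longrightarrow> finite (pinned S W)"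
  unfolding pinned_def
proof (intro finite_UN_I finite_imageI)
  fix s assume "S \<subseteq> short" "s \<in> S"
  then have "finite s" using ap_edges_finite_edge by blast
  then have "finite (attach 2 (s - W) (W \<union> s))" by (intro finite_attach) simp
  then show "finite {E \<in> attach 2 (s - W) (W \<union> s).
     \<exists>y\<in>s - W. (E y - {y}) \<inter> closure2 (closure2 (W \<union> s \<union> \<Union>(E ` (s - W - {y})))) \<noteq> {}}"
    by (rule rev_finite_subset) blast
qed

lemma finite_crossing:
  assumes "finite W"
  shows "finite (crossing W)"
proof -
  have Y: "finite Y" if "(W', Y) \<in> crossing_starts W" for W' Y
    using crossing_starts_card[OF that assms order_refl] finite_subset by blast
  then have "finite ((\<lambda>E. W' \<union> \<Union>(E ` Y)) ` attach 2 Y W')" if "(W', Y) \<in> crossing_starts W" for W' Y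
    using Y[OF that] by (intro finite_imageI finite_attach)
  then show ?thesis unfolding crossing_def by (intro finite_UN_I finite_crossing_starts assms) auto
qed

lemma starts_subset_short: "clean_starts W e \<subseteq> short" "double_hits W \<subseteq> short"
  by (auto simp: clean_starts_def double_hits_def)

lemma finite_bad: "finite W \<Longrightarrow> finite (bad W e)"
  unfolding bad_def by (intro finite_UnI finite_pinned finite_crossing finite_starts starts_subset_short)

lemma finite_extensions: "finite S \<Longrightarrow> S \<subseteq> short \<Longrightarrow> finite (extensions S W)"
  unfolding extensions_def by (intro finite_UN_I finite_attach) (auto dest: ap_edges_finite_edge)

lemma extensions_state:
  assumes "(W', e, u) \<in> extensions S W" "S \<subseteq> short" "finite W"
  shows "finite W' \<and> e \<subseteq> W' \<and> e \<in> long \<and> card W' \<le> card W + (q2 + q1 * q2)"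
proof -
  obtain s E where sE: "s \<in> S" "E \<in> attach 1 (s - W) (W \<union> s)" "u \<in> s - W" "W' = W \<union> s \<union> \<Union>(E ` (s - W))" "e = E u"
    using assms(1) unfolding extensions_def by auto
  have fs: "finite s" "card s = q2" using sE(1) assms(2) ap_edges_finite_edge card_ap_edge by blast+
  have "finite W'" unfolding sE(4) using fs assms(3) by (intro finite_Un_attach[OF sE(2)]) auto
  moreover have "card W' \<le> card (W \<union> s) + q1 * card (s - W)"
    unfolding sE(4) using fs assms(3) by (intro card_Un_attach_le[OF sE(2)]) auto
  moreover have "card (W \<union> s) \<le> card W + q2" using card_Un_le[of W s] fs by simp
  moreover have "q1 * card (s - W) \<le> q1 * q2" using fs card_mono[of s "s - W"] by simp
  moreover have "e \<in> long" using attachD(1)[OF sE(2,3)] sE(5) by simp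
  moreover have "e \<subseteq> W'" using sE(3,4,5) by blast
  ultimately show ?thesis by linarith
qed

text \<open>\<open>states t k\<close> collects the results of \<open>t\<close> exploration steps, \<open>k\<close> of which hit the explored set twice.\<close>
primrec states :: "nat \<Rightarrow> nat \<Rightarrow> (nat set \<times> nat set \<times> nat) set" where
  "states 0 k = (if k = 0 then \<Union>e\<in>long. \<Union>u\<in>e. {(e, e, u)} else {})"
| "states (Suc t) k = (\<Union>(W, e, u)\<in>states t k. extensions (clean_starts W e) W) \<union>
     (if k = 0 then {} else \<Union>(W, e, u)\<in>states t (k - 1). extensions (double_hits W) W)"

lemma states_invariant:
  "(W, e, u) \<in> states t k \<Longrightarrow> finite W \<and> e \<subseteq> W \<and> e \<in> long \<and> card W \<le> q1 + t * (q2 + q1 * q2)"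
proof (induction t arbitrary: W e u k)
  case 0
  then show ?case by (auto split: if_splits simp: card_ap_edge ap_edges_finite_edge)
next
  case (Suc t)
  have "\<exists>W0 e0 u0 k0. (W0, e0, u0) \<in> states t k0 \<and> (W, e, u) \<in> extensions (clean_starts W0 e0) W0 \<union> extensions (double_hits W0) W0"
    using Suc.prems by (cases "k = 0") (simp_all, blast+)
  then obtain W0 e0 u0 k0 S where *: "(W0, e0, u0) \<in> states t k0" "S \<in> {clean_starts W0 e0, double_hits W0}"
    "(W, e, u) \<in> extensions S W0" by blast
  have "S \<subseteq> short" using *(2) starts_subset_short by blast
  then show ?case using extensions_state[OF *(3)] Suc.IH[OF *(1)] by fastforce
qed

lemma finite_states: "finite (states t k)"
proof (induction t arbitrary: k)
  case 0
  then show ?case by (auto simp: ap_edges_finite_edge)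
next
  case (Suc t)
  then show ?case by (auto simp: finite_extensions starts_subset_short)
qed

definition state_wt :: "nat \<Rightarrow> nat \<Rightarrow> real" where
  "state_wt t k = (\<Sum>(W, e, u)\<in>states t k. P ^ card W)"

lemma state_wt_nonneg: "0 \<le> state_wt t k"
  unfolding state_wt_def using P by (intro sum_nonneg) auto

end

context ap_scaled
begin

lemma bad_weight_le:
  assumes W: "finite W" "card W + q2 + q1 * q2 \<le> M" and e: "finite e" "card e = q1"
  shows "(\<Sum>X\<in>bad W e. P ^ card X) \<le> 3 * (size_const M ^ q2 * y ^ (q1 * (q2 - 2) + 1)) * P ^ card W"
proof -
  have M: "1 \<le> M" using W(2) q2 by linarith
  obtain r where r: "q2 = r + 3" using q2 by (metis le_add_diff_inverse2)
  obtain d where "q1 = Suc (q2 + d)" using q12 less_imp_Suc_add by blast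
  then have d: "q1 = r + 4 + d" using r by simp
  let ?b = "size_const M ^ q2 * y ^ (q1 * (q2 - 2) + 1) * P ^ card W"
  have 1: "(\<Sum>X\<in>pinned (clean_starts W e) W. P ^ card X) \<le> ?b"
  proof (rule pinned_scaled_le[where i = 1 and j = 1])
    show "card (clean_starts W e) \<le> q1 * (q2 * n)" using card_clean_starts_le[OF e(1)] e(2) by simp
    show "card (s \<inter> W) = 1" if "s \<in> clean_starts W e" for s using that by (auto simp: clean_starts_def)
    have "real 1 * real M ^ 0 * (real q1 * real q2 ^ 2) \<le> real 1 * real M ^ 0 * (real q1 * real q1 ^ 2)"
      using q12 by (intro mult_left_mono power_mono) auto
    also have "\<dots> = real 1 * real M ^ 0 * real q1 ^ 3" by (simp add: eval_nat_numeral)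
    also have "\<dots> \<le> size_const M" using M by (intro monomial_le_size_const) auto
    finally have "(real q1 * real q2 ^ 2) * real n \<le> size_const M * real n" by (intro mult_right_mono) auto
    then show "real (q1 * (q2 * n)) * real q2 \<le> size_const M * real n ^ 1" by (simp add: power2_eq_square mult_ac)
    \<comment> \<open>For clean starts the comparison of exponents amounts to
      \<open>q2 + 1 \<le> q1\<close>, so it is tight.\<close>
    show "1 * (q1 * (q2 - 1)) + (q1 * (q2 - 2) + 1) \<le> q1 * (q2 - 1 - 1) + q2 * (q1 - 1)"
      unfolding r d by (simp add: algebra_simps)
  qed (use q2 W in \<open>auto simp: clean_starts_def\<close>)
  have 2: "(\<Sum>X\<in>pinned (double_hits W) W. P ^ card X) \<le> ?b"
  proof (rule pinned_scaled_le[where i = 0 and j = 2])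
    have "(card W)\<^sup>2 * q2\<^sup>2 \<le> M\<^sup>2 * q2\<^sup>2" using W(2) by (intro mult_le_mono1 power_mono) auto
    then show "card (double_hits W) \<le> M\<^sup>2 * q2\<^sup>2" using card_double_hits_le[OF W(1)] by linarith
    have "real 1 * real M ^ 2 * real q2 ^ 3 \<le> real 1 * real M ^ 2 * real q1 ^ 3"
      using q12 by (intro mult_left_mono power_mono) auto
    also have "\<dots> \<le> size_const M" using M by (intro monomial_le_size_const) auto
    finally show "real (M\<^sup>2 * q2\<^sup>2) * real q2 \<le> size_const M * real n ^ 0" by (simp add: eval_nat_numeral mult_ac)
    show "0 * (q1 * (q2 - 1)) + (q1 * (q2 - 2) + 1) \<le> q1 * (q2 - 2 - 1) + q2 * (q1 - 1)"
      unfolding r d by (simp add: algebra_simps)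
  qed (use q2 W in \<open>auto simp: double_hits_def\<close>)
  let ?A = "pinned (clean_starts W e) W" and ?B = "pinned (double_hits W) W"
  have fin: "finite ?A" "finite ?B" "finite (crossing W)"
    using W(1) by (simp_all add: finite_pinned finite_crossing starts_subset_short)
  have "(\<Sum>X\<in>bad W e. P ^ card X) \<le> ?b + ?b + ?b"
    unfolding bad_def using P fin
    by (intro order_trans[OF sum_Un_le] add_mono 1 2 crossing_weight_le[OF W]) auto
  also have "\<dots> = 3 * (size_const M ^ q2 * y ^ (q1 * (q2 - 2) + 1)) * P ^ card W" by (simp only: mult.assoc)
  finally show ?thesis .
qed

lemma sum_UN_case_le:
  fixes f :: "'c \<Rightarrow> real"
  assumes "finite I" "\<And>W e u. (W, e, u) \<in> I \<Longrightarrow> finite (A W e u)" "\<And>x. 0 \<le> f x"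
    "\<And>W e u. (W, e, u) \<in> I \<Longrightarrow> sum f (A W e u) \<le> K * g W"
  shows "sum f (\<Union>(W, e, u)\<in>I. A W e u) \<le> K * (\<Sum>(W, e, u)\<in>I. g W)"
proof -
  have "sum f (\<Union>(W, e, u)\<in>I. A W e u) \<le> (\<Sum>i\<in>I. sum f (case i of (W, e, u) \<Rightarrow> A W e u))"
    using assms(1-3) by (intro sum_UN_le) auto
  also have "\<dots> \<le> (\<Sum>i\<in>I. K * (case i of (W, e, u) \<Rightarrow> g W))"
    using assms(4) by (intro sum_mono) auto
  finally show ?thesis unfolding sum_distrib_left .
qed

text \<open>\<open>T + 1\<close> in place of \<open>T\<close> leaves room for one further step from
  any state reached by time \<open>T\<close>.\<close>

definition explored_size :: "nat \<Rightarrow> nat" where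
  "explored_size T = q1 + (T + 1) * (q2 + q1 * q2)"

definition step_const :: "nat \<Rightarrow> real" where
  "step_const T = size_const (explored_size T) ^ q2"

lemma states_size:
  assumes "(W, e, u) \<in> states t k" "t \<le> T"
  shows "finite W" "finite e" "card e = q1" "card W + q2 + q1 * q2 \<le> explored_size T"
proof -
  note inv = states_invariant[OF assms(1)]
  show "finite W" "finite e" "card e = q1" using inv ap_edges_finite_edge card_ap_edge by blast+
  have "t * (q2 + q1 * q2) \<le> T * (q2 + q1 * q2)" using assms(2) by (rule mult_le_mono1)
  moreover have "explored_size T = q1 + T * (q2 + q1 * q2) + (q2 + q1 * q2)" by (simp add: explored_size_def)
  ultimately show "card W + q2 + q1 * q2 \<le> explored_size T" using inv by linarith
qed

lemma step_const_ge_1: "1 \<le> step_const T"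
proof -
  have "1 \<le> explored_size T" using q12 by (simp add: explored_size_def)
  then show ?thesis unfolding step_const_def by (intro one_le_power size_const_ge_1)
qed

text \<open>The identity \<open>q1 * (q2 - 2) + q2 * q1 = 2 * (q1 * (q2 - 1))\<close> cancels the
  \<open>n * n\<close> possible first edges; \<open>q1\<close> counts the choices of
  \<open>u\<close>.\<close>

lemma state_wt_0_le: "y ^ (q1 * (q2 - 2)) * state_wt 0 0 \<le> real q1"
proof -
  have "state_wt 0 0 \<le> (\<Sum>e\<in>long. \<Sum>u\<in>e. P ^ q1)"
  proof -
    have "state_wt 0 0 \<le> (\<Sum>e\<in>long. sum (\<lambda>(W, e, u). P ^ card W) (\<Union>u\<in>e. {(e, e, u)}))"
      unfolding state_wt_def states.simps using P by (simp, intro sum_UN_le) (auto dest: long_finite)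
    also have "\<dots> \<le> (\<Sum>e\<in>long. \<Sum>u\<in>e. sum (\<lambda>(W, e, u). P ^ card W) {(e, e, u)})"
      using P by (intro sum_mono sum_UN_le) (auto dest: long_finite)
    also have "\<dots> = (\<Sum>e\<in>long. \<Sum>u\<in>e. P ^ q1)" by (intro sum.cong refl) (simp add: long_card)
    finally show ?thesis .
  qed
  also have "\<dots> = real (card long) * (real q1 * P ^ q1)" by (simp add: long_card)
  also have "\<dots> \<le> real (n * n) * (real q1 * y ^ (q2 * q1))"
    using q12 q2 P by (intro mult_mono of_nat_mono card_ap_edges_le P_pow_le mult_nonneg_nonneg zero_le_power) auto
  finally have "y ^ (q1 * (q2 - 2)) * state_wt 0 0 \<le> y ^ (q1 * (q2 - 2)) * (real (n * n) * (real q1 * y ^ (q2 * q1)))"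
    using y by (intro mult_left_mono) auto
  also have "\<dots> = real q1 * (real n ^ 2 * y ^ (q1 * (q2 - 2) + q2 * q1))"
    by (simp add: power_add power2_eq_square)
  also have "\<dots> \<le> real q1 * y ^ 0"
  proof (intro mult_left_mono n_pow_y_pow_le)
    obtain r where "q2 = r + 3" using q2 by (metis le_add_diff_inverse2)
    then show "2 * (q1 * (q2 - 1)) + 0 \<le> q1 * (q2 - 2) + q2 * q1" by (simp add: algebra_simps)
  qed simp
  finally show ?thesis by simp
qed

lemma state_wt_Suc_le:
  assumes c_small: "2 * real q1 ^ q2 * (real q2)\<^sup>2 * c \<le> 1" and t: "t \<le> T"
  shows "state_wt (Suc t) 0 \<le> state_wt t 0 / 2"
    and "state_wt (Suc t) (Suc k) \<le> state_wt t (Suc k) / 2 + step_const T * y ^ (q1 * (q2 - 2)) * state_wt t k"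
proof -
  let ?f = "\<lambda>(W, e :: nat set, u :: nat). P ^ card W"
  let ?C = "\<lambda>k. \<Union>(W, e, u)\<in>states t k. extensions (clean_starts W e) W"
  let ?D = "\<lambda>k. \<Union>(W, e, u)\<in>states t k. extensions (double_hits W) W"
  have f0: "0 \<le> ?f x" for x using P by (cases x) simp
  have C: "sum ?f (?C k) \<le> 1 / 2 * state_wt t k" for k
    unfolding state_wt_def
  proof (rule sum_UN_case_le[OF finite_states _ f0])
    fix W e u assume st: "(W, e, u) \<in> states t k"
    note * = states_size[OF st t]
    show "sum ?f (extensions (clean_starts W e) W) \<le> 1 / 2 * P ^ card W"
      using clean_extensions_weight_le[OF *(1,4,2,3) c_small] by simp
  qed (simp add: finite_extensions starts_subset_short)
  have D: "sum ?f (?D k) \<le> (step_const T * y ^ (q1 * (q2 - 2))) * state_wt t k" for k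
    unfolding state_wt_def step_const_def
  proof (rule sum_UN_case_le[OF finite_states _ f0])
    fix W e u assume st: "(W, e, u) \<in> states t k"
    note * = states_size[OF st t]
    show "sum ?f (extensions (double_hits W) W) \<le> (size_const (explored_size T) ^ q2 * y ^ (q1 * (q2 - 2))) * P ^ card W"
      using double_extensions_weight_le[OF *(1,4)] by simp
  qed (simp add: finite_extensions starts_subset_short)
  show "state_wt (Suc t) 0 \<le> state_wt t 0 / 2" using C[of 0] by (simp add: state_wt_def)
  have fin: "finite (?C k)" "finite (?D k)" for k
    by (auto intro!: finite_UN_I finite_states finite_extensions dest: subsetD[OF starts_subset_short(1)] subsetD[OF starts_subset_short(2)])
  have "state_wt (Suc t) (Suc k) = sum ?f (?C (Suc k) \<union> ?D k)" by (simp add: state_wt_def)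
  also have "\<dots> \<le> sum ?f (?C (Suc k)) + sum ?f (?D k)"
    using fin f0 by (intro sum_Un_le) auto
  finally show "state_wt (Suc t) (Suc k) \<le> state_wt t (Suc k) / 2 + step_const T * y ^ (q1 * (q2 - 2)) * state_wt t k"
    using C[of "Suc k"] D[of k] by simp
qed

text \<open>Multiplying by \<open>2 ^ t\<close> cancels the halving and leaves a Pascal recursion
  with weight \<open>A\<close> per double hit. Its solution is of order \<open>A ^ k\<close> times a
  binomial coefficient, dominated by \<open>(A * (t + 1)) ^ k\<close>.\<close>

lemma state_wt_le:
  assumes c_small: "2 * real q1 ^ q2 * (real q2)\<^sup>2 * c \<le> 1" and t: "t \<le> T"
  shows "2 ^ t * y ^ (q1 * (q2 - 2)) * state_wt t k \<le> real q1 * (2 * step_const T * y ^ (q1 * (q2 - 2)) * real (t + 1)) ^ k"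
  using t
proof (induction t arbitrary: k)
  case 0
  show ?case
  proof (cases k)
    case 0
    then show ?thesis using state_wt_0_le by simp
  next
    case (Suc k')
    then show ?thesis using step_const_ge_1[of T] y by (simp add: state_wt_def)
  qed
next
  case (Suc t)
  let ?b = "y ^ (q1 * (q2 - 2))"
  define A where "A = 2 * step_const T * ?b"
  have A0: "0 \<le> A" using step_const_ge_1[of T] y by (simp add: A_def)
  have IH: "2 ^ t * ?b * state_wt t k \<le> real q1 * (A * real (t + 1)) ^ k" for k
    using Suc by (simp add: A_def)
  have b: "0 \<le> 2 ^ Suc t * ?b" using y by simp
  show ?case
  proof (cases k)
    case 0
    have "2 ^ Suc t * ?b * state_wt (Suc t) 0 \<le> 2 ^ Suc t * ?b * (state_wt t 0 / 2)"
      using state_wt_Suc_le(1)[OF c_small, of t T] Suc.prems b by (intro mult_left_mono) auto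
    also have "\<dots> = 2 ^ t * ?b * state_wt t 0" by simp
    also have "\<dots> \<le> real q1" using IH[of 0] by simp
    finally show ?thesis using 0 by simp
  next
    case (Suc k')
    have "2 ^ Suc t * ?b * state_wt (Suc t) (Suc k')
      \<le> 2 ^ Suc t * ?b * (state_wt t (Suc k') / 2 + step_const T * ?b * state_wt t k')"
      using state_wt_Suc_le(2)[OF c_small, of t T] Suc.prems b by (intro mult_left_mono) auto
    also have "\<dots> = 2 ^ t * ?b * state_wt t (Suc k') + A * (2 ^ t * ?b * state_wt t k')"
      by (simp add: A_def algebra_simps)
    also have "\<dots> \<le> real q1 * (A * real (t + 1)) ^ Suc k' + A * (real q1 * (A * real (t + 1)) ^ k')"
      using A0 by (intro add_mono mult_left_mono IH) auto
    also have "\<dots> = real q1 * ((A * real (t + 1)) ^ k' * (A * real (Suc t + 1)))"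
      by (simp add: algebra_simps)
    also have "\<dots> \<le> real q1 * ((A * real (Suc t + 1)) ^ k' * (A * real (Suc t + 1)))"
      using A0 by (intro mult_left_mono mult_right_mono power_mono) auto
    finally show ?thesis using Suc by (simp add: A_def mult_ac)
  qed
qed

end

context ap_pair
begin

text \<open>The old part of the initial state is the single point \<open>u\<close>, which no edge
  can meet twice.\<close>

lemma generic_initial:
  assumes "e \<in> long" "u \<in> e"
  shows "generic (e, e, u)"
proof -
  have "closure2 {u} = {u}"
  proof -
    have "card (f \<inter> {u}) \<le> 1" for f using card_mono[of "{u}" "f \<inter> {u}"] by simp
    then have "{f \<in> long \<union> short. 2 \<le> card (f \<inter> {u})} = {}" by (metis (mono_tags, lifting) Collect_empty_eq Suc_1 not_less_eq_eq One_nat_def)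
    then show ?thesis unfolding closure2_def by (simp only: Sup_empty Un_empty_right)
  qed
  moreover have "e - (e - {u}) = {u}" using assms(2) by blast
  ultimately show ?thesis using ap_edges_finite_edge[OF assms(1)] by (simp add: generic_def)
qed

end

section \<open>Obstructions inside uncolourable sets and their total weight\<close>

context ap_scaled
begin

definition obstructions :: "nat \<Rightarrow> nat set set" where
  "obstructions T = tangled \<union> (fst ` states T 0 \<union> fst ` states T 1) \<union> (\<Union>t\<in>{..T}. fst ` states t 2)
     \<union> (\<Union>t\<in>{..<T}. \<Union>k\<in>{0, 1}. \<Union>(W, e, u)\<in>states t k. bad W e)"

lemma finite_edge_family: "finite V \<Longrightarrow> finite {e \<in> long. e \<subseteq> V}"
  by simp

lemma obstruction_exists:
  assumes fin: "finite V" and unc: "\<And>B. B \<subseteq> V \<Longrightarrow> (\<And>e. e \<in> long \<Longrightarrow> e \<subseteq> V \<Longrightarrow> e \<inter> B \<noteq> {}) \<Longrightarrow> \<exists>s\<in>short. s \<subseteq> B"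
  shows "\<exists>X\<in>obstructions T. X \<subseteq> V"
proof (rule ccontr)
  assume none: "\<not> ?thesis"
  have ne: "{} \<notin> short" using short_card[of "{}"] q2 by auto
  obtain M where M: "M \<subseteq> {e \<in> long. e \<subseteq> V}" "M \<noteq> {}"
    "\<And>e v. e \<in> M \<Longrightarrow> v \<in> e \<Longrightarrow> \<exists>s\<in>short. s \<inter> e = {v} \<and> s \<subseteq> V \<and> (\<exists>E. E v = e \<and> (\<forall>y\<in>s. E y \<in> M \<and> E y \<inter> s = {y}))"
  proof (rule critical_family_exists[OF fin finite_edge_family[OF fin] _ ne])
    show "\<exists>s\<in>short. s \<subseteq> B" if "B \<subseteq> V" "\<And>e. e \<in> {e \<in> long. e \<subseteq> V} \<Longrightarrow> e \<inter> B \<noteq> {}" for B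
      using unc that by simp
  qed (simp_all add: that)
  have Mlong: "M \<subseteq> long" "\<And>f. f \<in> M \<Longrightarrow> f \<subseteq> V" using M(1) by auto
  have disj: "E x \<inter> E z = {}"
    if s: "s \<in> short" "s \<subseteq> V" and E: "\<And>y. y \<in> s \<Longrightarrow> E y \<in> M \<and> E y \<inter> s = {y}" and xz: "x \<in> s" "z \<in> s" "x \<noteq> z" for s E x z
  proof (rule ccontr)
    assume "E x \<inter> E z \<noteq> {}"
    moreover have "E \<in> clusters s" using E Mlong(1) by (auto simp: clusters_def)
    ultimately have "s \<union> \<Union>(E ` s) \<in> tangled" unfolding tangled_def using s(1) xz by blast
    moreover have "s \<union> \<Union>(E ` s) \<subseteq> V" using s(2) E Mlong(2) by blast
    ultimately show False using none unfolding obstructions_def by blast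
  qed
  \<comment> \<open>Without an obstruction inside \<open>V\<close> the exploration goes on for
    \<open>T\<close> steps with at most one double hit; the state at time \<open>T\<close> is then
    itself an obstruction.\<close>
  have "\<exists>k\<in>{0, 1}. \<exists>W e u. (W, e, u) \<in> states t k \<and> generic (W, e, u) \<and> W \<subseteq> V \<and> e \<in> M" if "t \<le> T" for t
    using that
  proof (induction t)
    case 0
    obtain e where e: "e \<in> M" using M(2) by blast
    then have "e \<noteq> {}" using long_card[of e] Mlong(1) q12 by auto
    then obtain u where u: "u \<in> e" by blast
    have "(e, e, u) \<in> states 0 0" using e u Mlong(1) by auto
    then show ?case using generic_initial[of e u] e u Mlong by blast
  next
    case (Suc t)
    then obtain k W e u where k: "k \<in> {0, 1}" and st: "(W, e, u) \<in> states t k" and g: "generic (W, e, u)" "W \<subseteq> V" "e \<in> M"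
      by (metis Suc_leD)
    have "\<not> (\<exists>X\<in>bad W e. X \<subseteq> V)"
    proof
      assume "\<exists>X\<in>bad W e. X \<subseteq> V"
      then obtain X where "X \<in> bad W e" "X \<subseteq> V" by blast
      moreover have "t \<in> {..<T}" using Suc.prems by simp
      ultimately have "X \<in> obstructions T" unfolding obstructions_def using st k by blast
      then show False using none \<open>X \<subseteq> V\<close> by blast
    qed
    moreover have "(\<exists>X\<in>bad W e. X \<subseteq> V) \<or> (\<exists>S\<in>{clean_starts W e, double_hits W}. \<exists>(W', e', u')\<in>extensions S W.
      generic (W', e', u') \<and> W' \<subseteq> V \<and> e' \<in> M)"
    proof (rule exploration_step[OF g(1,2) Mlong(1) _ g(3)])
      show "E x \<inter> E z = {}"
        if "s \<in> short" "s \<subseteq> V" "\<And>y. y \<in> s \<Longrightarrow> E y \<in> M \<and> E y \<inter> s = {y}" "x \<in> s" "z \<in> s" "x \<noteq> z" for s E x z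
        by (rule disj[of s E x z]) (simp_all add: that)
    qed (simp_all add: Mlong(2) M(3))
    ultimately have "\<exists>S\<in>{clean_starts W e, double_hits W}. \<exists>(W', e', u')\<in>extensions S W. generic (W', e', u') \<and> W' \<subseteq> V \<and> e' \<in> M"
      by argo
    then obtain S i where Si: "S \<in> {clean_starts W e, double_hits W}" "i \<in> extensions S W"
      "case i of (W', e', u') \<Rightarrow> generic (W', e', u') \<and> W' \<subseteq> V \<and> e' \<in> M" by blast
    obtain W' e' u' where i: "i = (W', e', u')" by (rule prod_cases3)
    note S = Si(1,2)[unfolded i]
    have g': "generic (W', e', u')" "W' \<subseteq> V" "e' \<in> M" using Si(3) i by simp_all
    have "(W', e', u') \<in> states (Suc t) k \<or> (W', e', u') \<in> states (Suc t) (Suc k)"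
      using S st by auto
    moreover have "(W', e', u') \<notin> states (Suc t) 2"
    proof
      assume "(W', e', u') \<in> states (Suc t) 2"
      then have "W' \<in> fst ` states (Suc t) 2" by (metis fst_conv image_eqI)
      moreover have "Suc t \<in> {..T}" using Suc.prems by simp
      ultimately have "W' \<in> obstructions T" unfolding obstructions_def by blast
      then show False using none g'(2) by blast
    qed
    ultimately have "(W', e', u') \<in> states (Suc t) 0 \<or> (W', e', u') \<in> states (Suc t) 1"
      using k by (auto simp: numeral_2_eq_2 simp del: states.simps)
    then show ?case using g' by blast
  qed
  then obtain k W e u where k: "k \<in> {0, 1}" and st: "(W, e, u) \<in> states T k" and WV: "W \<subseteq> V"
    by (metis order_refl)
  have "W \<in> fst ` states T k" using st by (metis fst_conv image_eqI)
  then have "W \<in> obstructions T" using k unfolding obstructions_def by blast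
  then show False using none WV by blast
qed

lemma finite_tangled: "finite tangled"
  by (rule finite_subset[of _ "Pow {1..n}"]) (auto simp: tangled_def clusters_def ap_edges_def)

lemma finite_fst_states: "finite (fst ` states t k)"
  by (intro finite_imageI finite_states)

lemma finite_bad_states: "finite (\<Union>(W, e, u)\<in>states t k. bad W e)"
proof -
  have "finite (bad W e)" if "(W, e, u) \<in> states t k" for W e u
    using states_invariant[OF that] finite_bad by blast
  then show ?thesis by (intro finite_UN_I finite_states) auto
qed

lemma finite_obstructions: "finite (obstructions T)"
  unfolding obstructions_def
  by (intro finite_UnI finite_UN_I finite_tangled finite_fst_states finite_bad_states) auto

text \<open>A single quantity dominating the number of steps as well as the loss per step, so that
  all bounds become powers of it.\<close>

definition growth :: "nat \<Rightarrow> real" where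
  "growth T = 2 * step_const T * real (T + 1)"

lemma growth_ge: "1 \<le> growth T" "real (T + 1) \<le> growth T" "step_const T \<le> growth T"
proof -
  have s: "1 \<le> step_const T" by (rule step_const_ge_1)
  have "1 * real (T + 1) \<le> 2 * step_const T * real (T + 1)" using s by (intro mult_right_mono) auto
  then show T: "real (T + 1) \<le> growth T" by (simp add: growth_def)
  then show "1 \<le> growth T" by simp
  have "2 * step_const T * 1 \<le> 2 * step_const T * real (T + 1)" using s by (intro mult_left_mono) auto
  then show "step_const T \<le> growth T" using s by (simp add: growth_def)
qed

context
  fixes T :: nat
  assumes c_small: "2 * real q1 ^ q2 * (real q2)\<^sup>2 * c \<le> 1" and nT: "n \<le> 2 ^ T"
begin

lemma state_wt_growth:
  assumes "t \<le> T"
  shows "2 ^ t * y ^ (q1 * (q2 - 2)) * state_wt t k \<le> real q1 * growth T ^ k * (y ^ (q1 * (q2 - 2))) ^ k"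
proof -
  let ?b = "y ^ (q1 * (q2 - 2))"
  have "2 ^ t * ?b * state_wt t k \<le> real q1 * (2 * step_const T * ?b * real (t + 1)) ^ k"
    by (rule state_wt_le[OF c_small assms])
  also have "\<dots> \<le> real q1 * (growth T * ?b) ^ k"
  proof (intro mult_left_mono power_mono)
    have "(2 * step_const T * ?b) * real (t + 1) \<le> (2 * step_const T * ?b) * real (T + 1)"
      using assms y step_const_ge_1[of T] by (intro mult_left_mono) auto
    then show "2 * step_const T * ?b * real (t + 1) \<le> growth T * ?b" by (simp add: growth_def mult_ac)
  qed (use y step_const_ge_1[of T] in auto)
  finally show ?thesis by (simp add: power_mult_distrib mult.assoc)
qed

lemma state_wt_growth_le:
  assumes "t \<le> T"
  shows "y ^ (q1 * (q2 - 2)) * state_wt t k \<le> real q1 * growth T ^ k * (y ^ (q1 * (q2 - 2))) ^ k"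
proof -
  have "1 * (y ^ (q1 * (q2 - 2)) * state_wt t k) \<le> 2 ^ t * (y ^ (q1 * (q2 - 2)) * state_wt t k)"
    using y state_wt_nonneg by (intro mult_right_mono mult_nonneg_nonneg) auto
  then show ?thesis using state_wt_growth[OF assms, of k] by (simp add: mult.assoc)
qed

text \<open>As \<open>n \<le> 2 ^ T\<close>, the halvings gain a factor \<open>1 / n\<close>. Since
  \<open>n * y ^ (q1 * (q2 - 2) + q1) = 1\<close>, this pays for the starts and leaves
  \<open>y ^ q1\<close>.\<close>

lemma long_exploration_wt_le:
  assumes "k \<le> 1"
  shows "state_wt T k \<le> real q1 * growth T * y"
proof -
  let ?b = "y ^ (q1 * (q2 - 2))"
  have b: "0 < ?b" "?b \<le> 1" using y by (auto intro: power_le_one)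
  have m: "q1 * (q2 - 1) = q1 * (q2 - 2) + q1"
  proof -
    obtain r where "q2 = r + 3" using q2 by (metis le_add_diff_inverse2)
    then show ?thesis by simp
  qed
  have w0: "0 \<le> state_wt T k" by (rule state_wt_nonneg)
  have "real n * (?b * state_wt T k) \<le> 2 ^ T * (?b * state_wt T k)"
  proof (rule mult_right_mono)
    have "real n \<le> real (2 ^ T)" using nT by (simp only: of_nat_le_iff)
    then show "real n \<le> 2 ^ T" by simp
  qed (use w0 b in simp)
  also have "\<dots> \<le> real q1 * growth T ^ k * ?b ^ k" using state_wt_growth[of T k] by (simp add: mult.assoc)
  also have "\<dots> \<le> real q1 * growth T ^ 1 * 1"
    using b y growth_ge(1)[of T] assms by (intro mult_mono power_increasing power_le_one) auto
  finally have "real n * (?b * state_wt T k) \<le> real q1 * growth T" by simp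
  then have "real n * (?b * state_wt T k) * y ^ q1 \<le> real q1 * growth T * y ^ q1"
    using y by (intro mult_right_mono) auto
  also have "real n * (?b * state_wt T k) * y ^ q1 = (real n * y ^ (q1 * (q2 - 1))) * state_wt T k"
    unfolding m power_add by (simp add: mult_ac)
  finally have "state_wt T k \<le> real q1 * growth T * y ^ q1" using ny by simp
  also have "\<dots> \<le> real q1 * growth T * y ^ 1"
    using y q12 growth_ge(1)[of T] by (intro mult_left_mono power_decreasing) auto
  finally show ?thesis by simp
qed

lemma two_hits_wt_le:
  assumes "t \<le> T"
  shows "state_wt t 2 \<le> real q1 * growth T ^ 2 * y"
proof -
  let ?b = "y ^ (q1 * (q2 - 2))"
  have b: "0 < ?b" using y by auto
  have "?b * state_wt t 2 \<le> ?b * (real q1 * growth T ^ 2 * ?b)"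
    using state_wt_growth_le[OF assms, of 2] by (simp add: power2_eq_square mult_ac)
  then have "state_wt t 2 \<le> real q1 * growth T ^ 2 * ?b" using b by simp
  also have "\<dots> \<le> real q1 * growth T ^ 2 * y ^ 1"
  proof (intro mult_left_mono power_decreasing)
    have "1 * 1 \<le> q1 * (q2 - 2)" using q12 q2 by (intro mult_le_mono) auto
    then show "1 \<le> q1 * (q2 - 2)" by simp
  qed (use y in auto)
  finally show ?thesis by simp
qed

text \<open>The gain \<open>y ^ (q1 * (q2 - 2) + 1)\<close> of a bad set pays for the number of
  starts and leaves one factor \<open>y\<close>, whether or not a double hit has occurred.\<close>

lemma bad_states_wt_le:
  assumes "t \<le> T" "k \<le> 1"
  shows "(\<Sum>X\<in>(\<Union>(W, e, u)\<in>states t k. bad W e). P ^ card X) \<le> 3 * real q1 * growth T ^ 2 * y"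
proof -
  let ?b = "y ^ (q1 * (q2 - 2))"
  have b: "0 < ?b" "?b \<le> 1" using y by (auto intro: power_le_one)
  have "(\<Sum>X\<in>(\<Union>(W, e, u)\<in>states t k. bad W e). P ^ card X)
     \<le> 3 * (step_const T * y ^ (q1 * (q2 - 2) + 1)) * state_wt t k"
    unfolding state_wt_def step_const_def
  proof (rule sum_UN_case_le[OF finite_states])
    fix W e u assume st: "(W, e, u) \<in> states t k"
    note * = states_size[OF st assms(1)]
    show "finite (bad W e)" using *(1) by (rule finite_bad)
    show "(\<Sum>X\<in>bad W e. P ^ card X) \<le> 3 * (size_const (explored_size T) ^ q2 * y ^ (q1 * (q2 - 2) + 1)) * P ^ card W"
      by (rule bad_weight_le[OF *(1,4,2,3)])
  qed (use P in auto)
  also have "\<dots> = 3 * step_const T * (?b * state_wt t k) * y" by simp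
  also have "\<dots> \<le> 3 * growth T * (real q1 * growth T ^ 1 * 1) * y"
  proof (rule mult_right_mono[OF mult_mono])
    have "?b * state_wt t k \<le> real q1 * growth T ^ k * ?b ^ k" by (rule state_wt_growth_le[OF assms(1)])
    also have "\<dots> \<le> real q1 * growth T ^ 1 * 1"
      using b y growth_ge(1)[of T] assms by (intro mult_mono power_increasing power_le_one) auto
    finally show "?b * state_wt t k \<le> real q1 * growth T ^ 1 * 1" .
  qed (use y growth_ge[of T] state_wt_nonneg[of t k] step_const_ge_1[of T] in auto)
  finally show ?thesis by (simp add: power2_eq_square mult_ac)
qed

text \<open>The 9 collects 1 + 1 for states at time \<open>T\<close> with no or one double hit, 1
  for states with two, and 3 for bad sets at each of the two values of \<open>k\<close>. Summation
  over the times raises the power of \<open>growth T\<close> from 2 to 3.\<close>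

lemma obstructions_weight_le:
  "(\<Sum>X\<in>obstructions T. P ^ card X) \<le> (tangled_const + 9 * real q1 * growth T ^ 3) * y"
proof -
  let ?g = "\<lambda>X :: nat set. P ^ card X" and ?G = "growth T"
  have g0: "0 \<le> ?g X" for X using P by simp
  note G = growth_ge[of T]
  have fst_le: "sum ?g (fst ` states t k) \<le> state_wt t k" for t k
    using sum_image_le[where g = ?g and f = fst, OF finite_states] P by (simp add: state_wt_def o_def case_prod_beta')
  have G23: "?G ^ i \<le> ?G ^ 3" if "i \<le> 3" for i using G(1) that by (intro power_increasing) auto
  have qy: "0 \<le> real q1 * y" using y by simp
  have A: "sum ?g (fst ` states T k) \<le> real q1 * ?G ^ 3 * y" if "k \<le> 1" for k
  proof -
    have "state_wt T k \<le> real q1 * ?G ^ 1 * y" using long_exploration_wt_le[OF that] by simp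
    also have "\<dots> \<le> real q1 * ?G ^ 3 * y" using y by (intro mult_right_mono mult_left_mono G23) auto
    finally show ?thesis using fst_le[of T k] by linarith
  qed
  have mulT: "real (T + 1) * (K * real q1 * ?G ^ 2 * y) \<le> K * real q1 * ?G ^ 3 * y" if "0 \<le> K" for K
  proof -
    have "real (T + 1) * (K * real q1 * ?G ^ 2 * y) \<le> ?G * (K * real q1 * ?G ^ 2 * y)"
      using G y that by (intro mult_right_mono) auto
    then show ?thesis by (simp add: eval_nat_numeral mult_ac)
  qed
  have B: "sum ?g (\<Union>t\<in>{..T}. fst ` states t 2) \<le> real q1 * ?G ^ 3 * y"
  proof -
    have "sum ?g (\<Union>t\<in>{..T}. fst ` states t 2) \<le> (\<Sum>t\<in>{..T}. sum ?g (fst ` states t 2))"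
      using g0 finite_fst_states by (intro sum_UN_le) auto
    also have "\<dots> \<le> (\<Sum>t\<in>{..T}. real q1 * ?G ^ 2 * y)"
      using fst_le two_hits_wt_le by (intro sum_mono) (meson atMost_iff order_trans)
    finally show ?thesis using mulT[of 1] by simp
  qed
  have C: "sum ?g (\<Union>t\<in>{..<T}. \<Union>k\<in>{0, 1}. \<Union>(W, e, u)\<in>states t k. bad W e) \<le> 6 * real q1 * ?G ^ 3 * y"
  proof -
    have "sum ?g (\<Union>t\<in>{..<T}. \<Union>k\<in>{0, 1}. \<Union>(W, e, u)\<in>states t k. bad W e)
       \<le> (\<Sum>t\<in>{..<T}. sum ?g (\<Union>k\<in>{0, 1}. \<Union>(W, e, u)\<in>states t k. bad W e))"
      using g0 finite_bad_states by (intro sum_UN_le) auto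
    also have "\<dots> \<le> (\<Sum>t\<in>{..<T}. \<Sum>k\<in>{0, 1}. sum ?g (\<Union>(W, e, u)\<in>states t k. bad W e))"
      using g0 finite_bad_states by (intro sum_mono sum_UN_le) auto
    also have "\<dots> \<le> (\<Sum>t\<in>{..<T}. \<Sum>k\<in>{0, 1::nat}. 3 * real q1 * ?G ^ 2 * y)"
      by (intro sum_mono bad_states_wt_le) auto
    also have "\<dots> = real T * (6 * real q1 * ?G ^ 2 * y)" by simp
    also have "\<dots> \<le> real (T + 1) * (6 * real q1 * ?G ^ 2 * y)"
      using y G by (intro mult_right_mono mult_nonneg_nonneg) auto
    finally show ?thesis using mulT[of 6] by linarith
  qed
  have "sum ?g (obstructions T) \<le> tangled_const * y + (real q1 * ?G ^ 3 * y + real q1 * ?G ^ 3 * y) + real q1 * ?G ^ 3 * y + 6 * real q1 * ?G ^ 3 * y"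
    unfolding obstructions_def
  proof (intro order_trans[OF sum_Un_le] add_mono A B C tangled_weight_le)
    show "finite (\<Union>t\<in>{..<T}. \<Union>k\<in>{0, 1}. \<Union>(W, e, u)\<in>states t k. bad W e)"
      "finite (\<Union>t\<in>{..T}. fst ` states t 2)"
      by (intro finite_UN_I finite_bad_states finite_fst_states; simp)+
  qed (use finite_tangled finite_fst_states g0 in auto)
  also have "\<dots> = (tangled_const + 9 * real q1 * ?G ^ 3) * y" by (simp add: algebra_simps)
  finally show ?thesis .
qed

end

end

section \<open>The random hypergraph\<close>

lemma prob_random_subset_superset_le:
  assumes p: "0 \<le> p" "p \<le> 1"
  shows "measure_pmf.prob (random_subset n p) {V. X \<subseteq> V} \<le> p ^ card X"
proof (cases "X \<subseteq> {1..n}")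
  case True
  let ?B = "\<lambda>i. if i \<in> X then {True} else UNIV"
  have "measure_pmf.prob (random_subset n p) {V. X \<subseteq> V}
     = measure_pmf.prob (Pi_pmf {1..n} False (\<lambda>_. bernoulli_pmf p)) (Pi {1..n} ?B)"
    unfolding random_subset_def measure_map_pmf
    using True by (intro arg_cong[of _ _ "measure _"]) (auto simp: Pi_def split: if_splits)
  also have "\<dots> = (\<Prod>i\<in>{1..n}. measure_pmf.prob (bernoulli_pmf p) (?B i))"
    by (rule measure_Pi_pmf_Pi) simp
  also have "\<dots> = (\<Prod>i\<in>{1..n}. if i \<in> X then p else 1)"
    using p by (intro prod.cong refl) (simp add: measure_pmf_single)
  also have "\<dots> = p ^ card ({1..n} \<inter> X)" by (simp add: prod.If_cases)
  also have "{1..n} \<inter> X = X" using True by blast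
  finally show ?thesis by simp
next
  case False
  have "{V. X \<subseteq> V} \<inter> set_pmf (random_subset n p) = {}" using False by (auto simp: random_subset_def)
  then have "measure_pmf.prob (random_subset n p) {V. X \<subseteq> V} = 0" by (simp add: measure_pmf_zero_iff Int_commute)
  then show ?thesis using p by simp
qed

lemma uncolourable_induced_APs:
  assumes q: "q1 \<noteq> q2" and unc: "\<not> asym_2_colorable q1 q2 (induced (AP_hypergraph n q1 q2) V)"
    and B: "B \<subseteq> V \<inter> {1..n}" "\<And>e. e \<in> ap_edges n q1 \<Longrightarrow> e \<subseteq> V \<inter> {1..n} \<Longrightarrow> e \<inter> B \<noteq> {}"
  shows "\<exists>s\<in>ap_edges n q2. s \<subseteq> B"
proof (rule ccontr)
  assume none: "\<not> ?thesis"
  let ?col = "\<lambda>v. if v \<in> B then Blue else Red"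
  \<comment> \<open>As \<open>q1\<close> and \<open>q2\<close> differ, the size of an edge tells
    which kind of progression it is.\<close>
  have edge: "e \<in> ap_edges n q \<and> e \<subseteq> V \<inter> {1..n}"
    if "e \<in> edges (induced (AP_hypergraph n q1 q2) V)" "card e = q" "q = q1 \<or> q = q2" for e q
    using that by (auto simp: edges_def induced_def AP_hypergraph_def ap_edges_def dest: card_arith_prog)
  have "asym_2_colorable q1 q2 (induced (AP_hypergraph n q1 q2) V)"
    unfolding asym_2_colorable_def
  proof (intro exI[of _ ?col] conjI ballI impI notI)
    fix e assume e: "e \<in> edges (induced (AP_hypergraph n q1 q2) V)" "card e = q1" "\<forall>v\<in>e. ?col v = Red"
    then have "e \<inter> B \<noteq> {}" using edge[OF e(1,2)] B(2) by blast
    then show False using e(3) by (auto split: if_splits)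
  next
    fix e assume e: "e \<in> edges (induced (AP_hypergraph n q1 q2) V)" "card e = q2" "\<forall>v\<in>e. ?col v = Blue"
    then have "e \<subseteq> B" by (metis colour.distinct(1) subsetI)
    then show False using edge[OF e(1,2)] none by blast
  qed
  then show False using unc by simp
qed

context ap_scaled
begin

lemma prob_colourable_ge:
  assumes c_small: "2 * real q1 ^ q2 * (real q2)\<^sup>2 * c \<le> 1" and nT: "n \<le> 2 ^ T" and p: "0 \<le> p" "p \<le> P"
  shows "1 - (tangled_const + 9 * real q1 * growth T ^ 3) * y
    \<le> measure_pmf.prob (random_AP_hypergraph n q1 q2 p) {H. asym_2_colorable q1 q2 H}"
proof -
  let ?R = "random_subset n p"
  let ?C = "{V. asym_2_colorable q1 q2 (induced (AP_hypergraph n q1 q2) V)}"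
  have eq: "measure_pmf.prob (random_AP_hypergraph n q1 q2 p) {H. asym_2_colorable q1 q2 H} = measure_pmf.prob ?R ?C"
    unfolding random_AP_hypergraph_def measure_map_pmf by (simp add: vimage_def)
  have "UNIV - ?C \<subseteq> (\<Union>X\<in>obstructions T. {V. X \<subseteq> V})"
  proof
    fix V assume "V \<in> UNIV - ?C"
    then have "\<exists>s\<in>short. s \<subseteq> B"
      if "B \<subseteq> V \<inter> {1..n}" "\<And>e. e \<in> long \<Longrightarrow> e \<subseteq> V \<inter> {1..n} \<Longrightarrow> e \<inter> B \<noteq> {}" for B
      using uncolourable_induced_APs[of q1 q2 n V B] that q12 by simp
    then have "\<exists>X\<in>obstructions T. X \<subseteq> V \<inter> {1..n}" by (intro obstruction_exists) auto
    then show "V \<in> (\<Union>X\<in>obstructions T. {V. X \<subseteq> V})" by blast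
  qed
  then have "measure_pmf.prob ?R (UNIV - ?C) \<le> measure_pmf.prob ?R (\<Union>X\<in>obstructions T. {V. X \<subseteq> V})"
    by (intro measure_pmf.finite_measure_mono) auto
  also have "\<dots> \<le> (\<Sum>X\<in>obstructions T. measure_pmf.prob ?R {V. X \<subseteq> V})"
    by (intro measure_pmf.finite_measure_subadditive_finite finite_obstructions) auto
  also have "\<dots> \<le> (\<Sum>X\<in>obstructions T. P ^ card X)"
  proof (rule sum_mono)
    fix X
    have "measure_pmf.prob ?R {V. X \<subseteq> V} \<le> p ^ card X" using p P by (intro prob_random_subset_superset_le) auto
    also have "\<dots> \<le> P ^ card X" using p by (intro power_mono)
    finally show "measure_pmf.prob ?R {V. X \<subseteq> V} \<le> P ^ card X" .
  qed
  also have "\<dots> \<le> (tangled_const + 9 * real q1 * growth T ^ 3) * y" by (rule obstructions_weight_le[OF c_small nT])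
  finally show ?thesis using measure_pmf.prob_compl[of ?C ?R] eq by simp
qed

text \<open>\<open>explored_size\<close> is linear in \<open>T\<close>, \<open>size_const\<close>
  has degree 4 in it, \<open>step_const\<close> takes the power \<open>q2\<close>, and
  \<open>growth\<close> has one more factor \<open>T + 1\<close>; the bound is thus polynomial in
  \<open>T\<close>.\<close>

lemma growth_le:
  "growth T \<le> 2 * (27 * real (q1 + q2 + q1 * q2) ^ 4 * real q1 ^ 11) ^ q2 * real (T + 1) ^ (4 * q2 + 1)"
proof -
  let ?D = "q1 + q2 + q1 * q2"
  have "explored_size T \<le> ?D * (T + 1)" unfolding explored_size_def by (simp add: algebra_simps)
  then have "real (explored_size T) \<le> real ?D * real (T + 1)" by (metis of_nat_le_iff of_nat_mult)
  then have "size_const (explored_size T) \<le> 27 * (real ?D * real (T + 1)) ^ 4 * real q1 ^ 11"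
    unfolding size_const_def by (intro mult_right_mono mult_left_mono power_mono) auto
  also have "\<dots> = (27 * real ?D ^ 4 * real q1 ^ 11) * real (T + 1) ^ 4" by (simp add: power_mult_distrib)
  finally have "step_const T \<le> ((27 * real ?D ^ 4 * real q1 ^ 11) * real (T + 1) ^ 4) ^ q2"
    unfolding step_const_def by (intro power_mono) (auto simp: size_const_def)
  also have "\<dots> = (27 * real ?D ^ 4 * real q1 ^ 11) ^ q2 * real (T + 1) ^ (4 * q2)"
    by (simp only: power_mult_distrib power_mult)
  finally have "growth T \<le> 2 * ((27 * real ?D ^ 4 * real q1 ^ 11) ^ q2 * real (T + 1) ^ (4 * q2)) * real (T + 1)"
    unfolding growth_def by (intro mult_right_mono mult_left_mono) auto
  then show ?thesis by (simp only: power_add power_one_right mult.assoc)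
qed

end

section \<open>Passage to the limit\<close>

lemma log_power_times_powr_tendsto_0:
  fixes d :: real
  assumes "d > 0"
  shows "(\<lambda>n. (log 2 (real n) + 2) ^ K * real n powr (- d)) \<longlonglongrightarrow> 0"
  using assms by real_asymp

theorem theorem6p3:
  fixes q1 q2 :: nat
  assumes "q1 > q2" and "q2 \<ge> 3"
  shows "\<exists>c::real. c > 0 \<and>
    (\<forall>p :: nat \<Rightarrow> real.
      (\<forall>n\<ge>1. 0 \<le> p n \<and> p n \<le> 1 \<and>
             p n \<le> c * real n powr (- (real q2 / (real q1 * (real q2 - 1))))) \<longrightarrow>
      (\<lambda>n. measure_pmf.prob (random_AP_hypergraph n q1 q2 (p n))
             {H. asym_2_colorable q1 q2 H}) \<longlonglongrightarrow> 1)"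
proof -
  define m where "m = q1 * (q2 - 1)"
  define d where "d = 1 / real m"
  \<comment> \<open>The largest \<open>c\<close> for which the constant of a clean step meets the
    hypothesis of \<open>clean_extensions_weight_le\<close>.\<close>
  define c where "c = 1 / (2 * real q1 ^ q2 * (real q2)\<^sup>2)"
  define y where "y n = real n powr (- d)" for n
  define K where "K = 4 * q2 + 1"
  define G where "G = 2 * (27 * real (q1 + q2 + q1 * q2) ^ 4 * real q1 ^ 11) ^ q2"
  \<comment> \<open>\<open>tangled_const\<close> depends on \<open>q1\<close> and \<open>q2\<close>
    alone, so one \<open>a\<close> serves all \<open>n\<close>.\<close>
  define a where "a = ap_scaled.tangled_const q1 q2"
  have m: "0 < m" using assms by (simp add: m_def)
  then have d: "0 < d" by (simp add: d_def)
  have q: "0 < real q1" "0 < real q2" using assms by auto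
  then have c0: "0 < c" by (simp add: c_def)
  have "1 * 1 * 1 \<le> 2 * real q1 ^ q2 * (real q2)\<^sup>2"
    using assms by (intro mult_mono one_le_power) auto
  then have c1: "c \<le> 1" unfolding c_def by simp
  have c_small: "2 * real q1 ^ q2 * (real q2)\<^sup>2 * c \<le> 1" using q by (simp add: c_def)
  have exponent: "- (real q2 / (real q1 * (real q2 - 1))) = - d * real q2"
    using assms by (simp add: d_def m_def of_nat_diff)
  have lower: "1 - (a * real n powr (- d) + 9 * real q1 * G ^ 3 * ((log 2 (real n) + 2) ^ (K * 3) * real n powr (- d)))
      \<le> measure_pmf.prob (random_AP_hypergraph n q1 q2 p) {H. asym_2_colorable q1 q2 H}"
    if n: "1 \<le> n" and p: "0 \<le> p" "p \<le> c * real n powr (- (real q2 / (real q1 * (real q2 - 1))))" for n p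
  proof -
    have y0: "0 < y n" using n by (simp add: y_def)
    have y1: "y n \<le> 1" unfolding y_def using powr_mono[of "- d" 0 "real n"] n d by simp
    have "y n ^ m = real n powr (- d * real m)"
      unfolding y_def using n by (simp add: powr_powr flip: powr_realpow)
    then have "y n ^ m = 1 / real n" using m n by (simp add: d_def powr_minus_divide)
    then have ny: "real n * y n ^ (q1 * (q2 - 1)) = 1" using n by (simp add: m_def)
    have p_eq: "c * real n powr (- (real q2 / (real q1 * (real q2 - 1)))) = c * y n ^ q2"
      unfolding exponent y_def using n by (simp add: powr_powr flip: powr_realpow)
    have yq: "0 < y n ^ q2" "y n ^ q2 \<le> 1" using y0 y1 by (auto intro: power_le_one)
    interpret ap_scaled q1 q2 n "c * y n ^ q2" "y n" c
    proof
      show "c * y n ^ q2 \<le> 1" using mult_mono[OF c1 yq(2)] yq by simp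
    qed (use assms c0 c1 y0 y1 ny yq in auto)
    \<comment> \<open>Just large enough for \<open>n \<le> 2 ^ T\<close>, so \<open>growth T\<close>
      is bounded by a power of the logarithm and is beaten by \<open>y n\<close>.\<close>
    define T where "T = nat \<lceil>log 2 (real n)\<rceil>"
    have l: "0 \<le> log 2 (real n)" using n by simp
    have "log 2 (real n) \<le> real T" unfolding T_def by linarith
    then have "real n \<le> 2 powr real T" using n by (simp add: log_le_iff)
    then have "real n \<le> real (2 ^ T)" by (simp add: powr_realpow)
    then have nT: "n \<le> 2 ^ T" by (simp only: of_nat_le_iff)
    have T: "real (T + 1) \<le> log 2 (real n) + 2" using l unfolding T_def by linarith
    have "growth T \<le> G * real (T + 1) ^ K" unfolding G_def K_def by (rule growth_le)
    also have "\<dots> \<le> G * (log 2 (real n) + 2) ^ K" using T by (intro mult_left_mono power_mono) (auto simp: G_def)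
    finally have "growth T ^ 3 \<le> (G * (log 2 (real n) + 2) ^ K) ^ 3" using growth_ge(1)[of T] by (intro power_mono) auto
    then have "growth T ^ 3 \<le> G ^ 3 * (log 2 (real n) + 2) ^ (K * 3)" by (simp only: power_mult_distrib power_mult)
    then have "(a + 9 * real q1 * growth T ^ 3) * y n \<le> (a + 9 * real q1 * (G ^ 3 * (log 2 (real n) + 2) ^ (K * 3))) * y n"
      using y0 by (intro mult_right_mono add_left_mono mult_left_mono) auto
    moreover have "1 - (a + 9 * real q1 * growth T ^ 3) * y n
      \<le> measure_pmf.prob (random_AP_hypergraph n q1 q2 p) {H. asym_2_colorable q1 q2 H}"
      unfolding a_def by (intro prob_colourable_ge c_small nT p(1) p(2)[unfolded p_eq])
    ultimately show ?thesis unfolding y_def by (simp add: algebra_simps)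
  qed
  have "(\<lambda>n. 1 - (a * real n powr (- d) + 9 * real q1 * G ^ 3 * ((log 2 (real n) + 2) ^ (K * 3) * real n powr (- d)))) \<longlonglongrightarrow> 1 - (a * 0 + 9 * real q1 * G ^ 3 * 0)"
    using log_power_times_powr_tendsto_0[OF d, of 0] log_power_times_powr_tendsto_0[OF d, of "K * 3"]
    by (intro tendsto_intros) simp_all
  then have lim: "(\<lambda>n. 1 - (a * real n powr (- d) + 9 * real q1 * G ^ 3 * ((log 2 (real n) + 2) ^ (K * 3) * real n powr (- d)))) \<longlonglongrightarrow> 1"
    by simp
  show ?thesis
  proof (intro exI[of _ c] conjI allI impI c0)
    fix p :: "nat \<Rightarrow> real"
    assume p: "\<forall>n\<ge>1. 0 \<le> p n \<and> p n \<le> 1 \<and> p n \<le> c * real n powr (- (real q2 / (real q1 * (real q2 - 1))))"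
    show "(\<lambda>n. measure_pmf.prob (random_AP_hypergraph n q1 q2 (p n)) {H. asym_2_colorable q1 q2 H}) \<longlonglongrightarrow> 1"
      by (rule tendsto_sandwich[OF _ _ lim tendsto_const])
        (use lower p in \<open>auto intro!: eventually_sequentiallyI[of 1]\<close>)
  qed
qed

end
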